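(* Let $M$ be a surface with a tame conformally euclidean structure $\widetilde M\subset\mathbb E^2$, and let $\gamma_1$ and $\gamma_2$ be regular closed curves on $M$ having the same base point $p$. Fix a lift $\widetilde p\in\widetilde M$ of $p$. Then the following are equivalent. (1) $\gamma_1$ and $\gamma_2$ are regularly homotopic fixing the base point. (2) $[\gamma_1]=[\gamma_2]\in\pi_1(M,p)$ and $w_{\widetilde p}(\gamma_1)=w_{\widetilde p}(\gamma_2)$, where $w_{\widetilde p}$ denotes the based winding number.
   Context: Surfaces and structures. Surfaces are connected, smooth and without boundary; $\mathbb E^2$ is the euclidean plane with its standard orientation. For a riemannian surface $M$, $p_M:\widetilde M\to M$ is the universal cover, with the riemannian metric induced from $M$. A conformally euclidean structure on $M$ is a conformal embedding $\widetilde M\subset\mathbb E^2$ (conformal: preserving non-oriented angles at each point); $\widetilde M$ is regarded as a subset of $\mathbb E^2$ and given the orientation of $\mathbb E^2$. It is tame if (1) any two points of $\widetilde M$ can be joined by a unique shortest geodesic in $\widetilde M$ (for the metric induced from $M$), and (2) for any compact subset $K$ of the interior of $\widetilde M$ there is a regular map $f:\mathbb E^2\to\widetilde M$ (smooth with everywhere invertible differential) with $f|_K=\mathrm{id}_K$. Curves. Curves are $C^1$ maps $\gamma:[a,b]\to M$ (or into $\mathbb E^2$), identified under orientation-preserving reparametrization. $\gamma$ is regular if its velocity $v_\gamma(u)$ never vanishes; then $e_\gamma(u)=v_\gamma(u)/|v_\gamma(u)|$. A regular closed curve on $M$ is a regular curve with $\gamma(a)=\gamma(b)$ (the base point) and $e_\gamma(a)=e_\gamma(b)$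 (the base direction). A regular homotopy between regular closed curves is a homotopy $\{\sigma_t\}_{0\le t\le1}$ such that every $\sigma_t$ is a regular closed curve and $(t,u)\mapsto v_{\sigma_t}(u)$ is continuous. It fixes the base point if the base point of every $\sigma_t$ is the same; the base direction may vary. Indices. An angle function of a regular curve $\gamma:[a,b]\to\mathbb E^2$ is a continuous $\theta_\gamma:[a,b]\to\mathbb R$ with $e_\gamma(u)=(\cos\theta_\gamma(u),\sin\theta_\gamma(u))$. Put $i_\gamma=\frac{\theta_\gamma(b)-\theta_\gamma(a)}{2\pi}\in\mathbb R$ and $j_\gamma=\frac{\theta_\gamma(b)+\theta_\gamma(a)}{2\pi}$; $i_\gamma$ does not depend on $\theta_\gamma$, and $j_\gamma$ is well defined modulo $2$. Sign. For a closed curve $\gamma:[a,b]\to M$ and a lift $\widetilde\gamma$ to $\widetilde M$, let $T_{\widetilde\gamma}$ be the deck transformation sending $\widetilde\gamma(a)$ to $\widetilde\gamma(b)$. $\gamma$ is orientation preserving ($\varepsilon_\gamma=1$) or orientation reversing ($\varepsilon_\gamma=-1$) according as $T_{\widetilde\gamma}$ preserves or reverses the orientation of $\widetilde M$. Based winding number. Let $\gamma:[a,b]\to M$ be a regular closed curve based at $p$, $\widetilde p$ a lift of $p$, and $\widetilde\gamma$ the lift of $\gamma$ with $\widetilde\gamma(a)=\widetilde p$, viewed as a curve in $\mathbb E^2$. If $\gamma$ is not null-homotopic, let $\widetilde\delta:[a,b]\to\widetilde M$ be the unique shortest geodesic (metric induced from $M$) from $\widetilde\gamma(a)$ to $\widetilde\gamma(b)$,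 $\delta=p_M\circ\widetilde\delta$, and $\widehat\delta$ the lift of $\delta$ with $\widehat\delta(a)=\widetilde\delta(b)$. The external angle $\chi_{\delta,\widetilde p}$ is the unique real number with $\chi_{\delta,\widetilde p}\equiv\theta_{\widehat\delta}(a)-\theta_{\widetilde\delta}(b)\pmod{2\pi}$ and $-\pi<\chi_{\delta,\widetilde p}<\pi$. Then $w_{\widetilde p}(\gamma)=i_{\widetilde\gamma}\in\mathbb Z$ if $\gamma$ is null-homotopic; $w_{\widetilde p}(\gamma)=i_{\widetilde\gamma}-i_{\widetilde\delta}-\frac{\chi_{\delta,\widetilde p}}{2\pi}\in\mathbb Z$ if $\varepsilon_\gamma=1$ and $\gamma$ is not null-homotopic; $w_{\widetilde p}(\gamma)=\left(j_{\widetilde\gamma}-j_{\widetilde\delta}-\frac{\chi_{\delta,\widetilde p}}{2\pi}\right)+2\mathbb Z\in\mathbb Z/2\mathbb Z$ if $\varepsilon_\gamma=-1$. *)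

theory Defs
  imports "HOL-Analysis.Analysis"
begin

text \<open>The euclidean plane with its standard orientation is the type \<open>complex\<close>, regarded as a
  real inner product space; all derivatives below are real derivatives.\<close>

section \<open>Smooth maps\<close>

text \<open>Intended for open \<open>S\<close> in finite dimension, where continuity of all iterated directional
  derivatives is the usual notion of class \<open>C\<^sup>k\<close>.\<close>

primrec Ck_on :: "nat \<Rightarrow> 'a::real_normed_vector set \<Rightarrow> ('a \<Rightarrow> 'b::real_normed_vector) \<Rightarrow> bool" where
  "Ck_on 0 S f \<longleftrightarrow> continuous_on S f"
| "Ck_on (Suc k) S f \<longleftrightarrow>
     (\<forall>x\<in>S. f differentiable (at x)) \<and> (\<forall>v. Ck_on k S (\<lambda>x. frechet_derivative f (at x) v))"

definition smooth_on :: "'a::real_normed_vector set \<Rightarrow> ('a \<Rightarrow> 'b::real_normed_vector) \<Rightarrow> bool" where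
  "smooth_on S f \<longleftrightarrow> (\<forall>k. Ck_on k S f)"

definition regular_map_on :: "complex set \<Rightarrow> (complex \<Rightarrow> complex) \<Rightarrow> bool" where
  "regular_map_on S f \<longleftrightarrow> smooth_on S f \<and> (\<forall>z\<in>S. bij (frechet_derivative f (at z)))"

section \<open>Riemannian surfaces\<close>

text \<open>A chart is a coordinate domain together with a coordinate map, which matters only on the
  domain.  The riemannian metric is given by its coordinate expressions: \<open>riem_metric S c z v w\<close> is the
  inner product of the two tangent vectors at the point with coordinate \<open>z\<close> in the chart \<open>c\<close> whose
  components in \<open>c\<close> are \<open>v\<close> and \<open>w\<close>.\<close>

type_synonym 'm chart = "'m set \<times> ('m \<Rightarrow> complex)"

record 'm surface =
  points :: "'m set"
  atlas :: "'m chart set"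
  riem_metric :: "'m chart \<Rightarrow> complex \<Rightarrow> complex \<Rightarrow> complex \<Rightarrow> real"

definition transition :: "'m chart \<Rightarrow> 'm chart \<Rightarrow> complex \<Rightarrow> complex" where
  "transition c d = snd d \<circ> inv_into (fst c) (snd c)"

definition smooth_surface :: "'m::topological_space surface \<Rightarrow> bool" where
  "smooth_surface S \<longleftrightarrow>
     points S \<noteq> {} \<and> connected (points S) \<and>
     Hausdorff_space (top_of_set (points S)) \<and> second_countable (top_of_set (points S)) \<and>
     (\<Union>c\<in>atlas S. fst c) = points S \<and>
     (\<forall>c\<in>atlas S. openin (top_of_set (points S)) (fst c) \<and> open (snd c ` fst c) \<and>
        homeomorphism (fst c) (snd c ` fst c) (snd c) (inv_into (fst c) (snd c))) \<and>
     (\<forall>c\<in>atlas S. \<forall>d\<in>atlas S. smooth_on (snd c ` (fst c \<inter> fst d)) (transition c d))"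

definition riemannian_surface :: "'m::topological_space surface \<Rightarrow> bool" where
  "riemannian_surface S \<longleftrightarrow>
     smooth_surface S \<and>
     (\<forall>c\<in>atlas S. \<forall>v w. smooth_on (snd c ` fst c) (\<lambda>z. riem_metric S c z v w)) \<and>
     (\<forall>c\<in>atlas S. \<forall>z\<in>snd c ` fst c.
        bilinear (riem_metric S c z) \<and>
        (\<forall>v w. riem_metric S c z v w = riem_metric S c z w v) \<and>
        (\<forall>v. v \<noteq> 0 \<longrightarrow> riem_metric S c z v v > 0)) \<and>
     (\<forall>c\<in>atlas S. \<forall>d\<in>atlas S. \<forall>z\<in>snd c ` (fst c \<inter> fst d). \<forall>v w.
        riem_metric S c z v w =
          riem_metric S d (transition c d z)
            (frechet_derivative (transition c d) (at z) v)
            (frechet_derivative (transition c d) (at z) w))"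

section \<open>Conformally euclidean structures\<close>

text \<open>The universal cover is identified with its image \<open>U\<close> under the conformal embedding, so the
  smooth structure of \<open>U\<close> as an open subset of the plane is the one for which the covering
  projection \<open>pr\<close> is a local diffeomorphism.\<close>

definition planar_universal_cover ::
    "'m::topological_space surface \<Rightarrow> complex set \<Rightarrow> (complex \<Rightarrow> 'm) \<Rightarrow> bool" where
  "planar_universal_cover S U pr \<longleftrightarrow>
     open U \<and> simply_connected U \<and> covering_space U pr (points S) \<and>
     (\<forall>c\<in>atlas S. regular_map_on (U \<inter> pr -` fst c) (snd c \<circ> pr))"

text \<open>The metric induced on \<open>U\<close>; the choice of the chart around \<open>pr z\<close> is immaterial.\<close>

definition cover_metric ::
    "'m surface \<Rightarrow> (complex \<Rightarrow> 'm) \<Rightarrow> complex \<Rightarrow> complex \<Rightarrow> complex \<Rightarrow> real" where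
  "cover_metric S pr z v w =
     (let c = (SOME c. c \<in> atlas S \<and> pr z \<in> fst c);
          D = frechet_derivative (snd c \<circ> pr) (at z)
      in riem_metric S c (snd c (pr z)) (D v) (D w))"

definition unoriented_angle :: "(complex \<Rightarrow> complex \<Rightarrow> real) \<Rightarrow> complex \<Rightarrow> complex \<Rightarrow> real" where
  "unoriented_angle B v w = arccos (B v w / (sqrt (B v v) * sqrt (B w w)))"

definition conformally_euclidean_structure ::
    "'m::topological_space surface \<Rightarrow> complex set \<Rightarrow> (complex \<Rightarrow> 'm) \<Rightarrow> bool" where
  "conformally_euclidean_structure S U pr \<longleftrightarrow>
     planar_universal_cover S U pr \<and>
     (\<forall>z\<in>U. \<forall>v w. v \<noteq> 0 \<longrightarrow> w \<noteq> 0 \<longrightarrow>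
        unoriented_angle (cover_metric S pr z) v w = unoriented_angle inner v w)"

section \<open>Curves in the plane\<close>

definition velocity :: "real \<Rightarrow> real \<Rightarrow> (real \<Rightarrow> 'a::real_normed_vector) \<Rightarrow> real \<Rightarrow> 'a" where
  "velocity a b c u = vector_derivative c (at u within {a..b})"

definition C1_curve :: "real \<Rightarrow> real \<Rightarrow> (real \<Rightarrow> 'a::real_normed_vector) \<Rightarrow> bool" where
  "C1_curve a b c \<longleftrightarrow>
     a < b \<and> (\<forall>u\<in>{a..b}. c differentiable (at u within {a..b})) \<and>
     continuous_on {a..b} (velocity a b c)"

text \<open>Identification of curves under orientation preserving \<open>C\<^sup>1\<close> reparametrization.\<close>

definition same_curve ::
    "real \<Rightarrow> real \<Rightarrow> (real \<Rightarrow> 'a) \<Rightarrow> real \<Rightarrow> real \<Rightarrow> (real \<Rightarrow> 'a) \<Rightarrow> bool" where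
  "same_curve a b c a' b' c' \<longleftrightarrow>
     (\<exists>h. C1_curve a b h \<and> (\<forall>u\<in>{a..b}. velocity a b h u > 0) \<and>
          h a = a' \<and> h b = b' \<and> (\<forall>u\<in>{a..b}. c u = c' (h u)))"

definition angle_function :: "real \<Rightarrow> real \<Rightarrow> (real \<Rightarrow> complex) \<Rightarrow> (real \<Rightarrow> real) \<Rightarrow> bool" where
  "angle_function a b c \<theta> \<longleftrightarrow>
     continuous_on {a..b} \<theta> \<and>
     (\<forall>u\<in>{a..b}. velocity a b c u /\<^sub>R norm (velocity a b c u) = cis (\<theta> u))"

definition i_index :: "real \<Rightarrow> real \<Rightarrow> (real \<Rightarrow> complex) \<Rightarrow> real" where
  "i_index a b c = (let \<theta> = (SOME \<theta>. angle_function a b c \<theta>) in (\<theta> b - \<theta> a) / (2 * pi))"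

text \<open>Only meaningful modulo 2.\<close>

definition j_index :: "real \<Rightarrow> real \<Rightarrow> (real \<Rightarrow> complex) \<Rightarrow> real" where
  "j_index a b c = (let \<theta> = (SOME \<theta>. angle_function a b c \<theta>) in (\<theta> b + \<theta> a) / (2 * pi))"

section \<open>Geodesics and tameness\<close>

text \<open>Here \<open>G\<close> is a riemannian metric on the open set \<open>U\<close>.  The last condition is the geodesic
  equation with lowered index: the expression is the \<open>G\<close>-inner product of the covariant
  acceleration of \<open>c\<close> with \<open>w\<close>, the Christoffel symbols of the first kind being written out.
  In particular geodesics are parametrized proportionally to arc length.\<close>

definition geodesic ::
    "(complex \<Rightarrow> complex \<Rightarrow> complex \<Rightarrow> real) \<Rightarrow> complex set \<Rightarrow> real \<Rightarrow> real \<Rightarrow> (real \<Rightarrow> complex) \<Rightarrow> bool"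
  where
  "geodesic G U a b c \<longleftrightarrow>
     a < b \<and> c ` {a..b} \<subseteq> U \<and>
     (\<exists>c' c''. \<forall>u\<in>{a..b}.
        (c has_vector_derivative c' u) (at u within {a..b}) \<and>
        (c' has_vector_derivative c'' u) (at u within {a..b}) \<and>
        (\<forall>w. G (c u) (c'' u) w
             + frechet_derivative (\<lambda>x. G x (c' u) w) (at (c u)) (c' u)
             - frechet_derivative (\<lambda>x. G x (c' u) (c' u)) (at (c u)) w / 2 = 0))"

definition curve_length ::
    "(complex \<Rightarrow> complex \<Rightarrow> complex \<Rightarrow> real) \<Rightarrow> real \<Rightarrow> real \<Rightarrow> (real \<Rightarrow> complex) \<Rightarrow> real" where
  "curve_length G a b c =
     integral {a..b} (\<lambda>u. sqrt (G (c u) (velocity a b c u) (velocity a b c u)))"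

definition shortest_geodesic ::
    "(complex \<Rightarrow> complex \<Rightarrow> complex \<Rightarrow> real) \<Rightarrow> complex set \<Rightarrow> complex \<Rightarrow> complex \<Rightarrow>
     real \<Rightarrow> real \<Rightarrow> (real \<Rightarrow> complex) \<Rightarrow> bool" where
  "shortest_geodesic G U x y a b c \<longleftrightarrow>
     geodesic G U a b c \<and> c a = x \<and> c b = y \<and>
     (\<forall>a' b' d. C1_curve a' b' d \<and> d ` {a'..b'} \<subseteq> U \<and> d a' = x \<and> d b' = y \<longrightarrow>
        curve_length G a b c \<le> curve_length G a' b' d)"

definition tame_conformally_euclidean_structure ::
    "'m::topological_space surface \<Rightarrow> complex set \<Rightarrow> (complex \<Rightarrow> 'm) \<Rightarrow> bool" where
  "tame_conformally_euclidean_structure S U pr \<longleftrightarrow>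
     conformally_euclidean_structure S U pr \<and>
     (\<forall>x\<in>U. \<forall>y\<in>U. x \<noteq> y \<longrightarrow>
        (\<exists>a b c. shortest_geodesic (cover_metric S pr) U x y a b c \<and>
           (\<forall>a' b' c'. shortest_geodesic (cover_metric S pr) U x y a' b' c' \<longrightarrow>
              same_curve a b c a' b' c'))) \<and>
     (\<forall>K. compact K \<and> K \<subseteq> interior U \<longrightarrow>
        (\<exists>f. regular_map_on UNIV f \<and> range f \<subseteq> U \<and> (\<forall>z\<in>K. f z = z)))"

section \<open>Regular closed curves on a surface\<close>

text \<open>The components in the chart \<open>c\<close> of the velocity of \<open>\<gamma>\<close>, meaningful when \<open>\<gamma> u \<in> fst c\<close>.\<close>

definition chart_velocity :: "'m chart \<Rightarrow> real \<Rightarrow> real \<Rightarrow> (real \<Rightarrow> 'm) \<Rightarrow> real \<Rightarrow> complex" where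
  "chart_velocity c a b \<gamma> u = velocity a b (snd c \<circ> \<gamma>) u"

definition chart_direction ::
    "'m surface \<Rightarrow> 'm chart \<Rightarrow> real \<Rightarrow> real \<Rightarrow> (real \<Rightarrow> 'm) \<Rightarrow> real \<Rightarrow> complex" where
  "chart_direction S c a b \<gamma> u =
     (let v = chart_velocity c a b \<gamma> u in v /\<^sub>R sqrt (riem_metric S c (snd c (\<gamma> u)) v v))"

definition regular_curve ::
    "'m::topological_space surface \<Rightarrow> real \<Rightarrow> real \<Rightarrow> (real \<Rightarrow> 'm) \<Rightarrow> bool" where
  "regular_curve S a b \<gamma> \<longleftrightarrow>
     a < b \<and> continuous_on {a..b} \<gamma> \<and> \<gamma> ` {a..b} \<subseteq> points S \<and>
     (\<forall>c\<in>atlas S.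
        (\<forall>u\<in>{a..b}. \<gamma> u \<in> fst c \<longrightarrow>
           (snd c \<circ> \<gamma>) differentiable (at u within {a..b}) \<and> chart_velocity c a b \<gamma> u \<noteq> 0) \<and>
        continuous_on {u\<in>{a..b}. \<gamma> u \<in> fst c} (chart_velocity c a b \<gamma>))"

definition regular_closed_curve ::
    "'m::topological_space surface \<Rightarrow> real \<Rightarrow> real \<Rightarrow> (real \<Rightarrow> 'm) \<Rightarrow> bool" where
  "regular_closed_curve S a b \<gamma> \<longleftrightarrow>
     regular_curve S a b \<gamma> \<and> \<gamma> a = \<gamma> b \<and>
     (\<forall>c\<in>atlas S. \<gamma> a \<in> fst c \<longrightarrow>
        chart_direction S c a b \<gamma> a = chart_direction S c a b \<gamma> b)"

text \<open>As curves are considered up to reparametrization, the ends of the homotopy are only required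
  to represent the same curves as \<open>\<gamma>\<^sub>1\<close> and \<open>\<gamma>\<^sub>2\<close>.  Continuity of the velocity as a map into the
  tangent bundle is expressed in charts.\<close>

definition regularly_homotopic_fixing_base_point ::
    "'m::topological_space surface \<Rightarrow> real \<Rightarrow> real \<Rightarrow> (real \<Rightarrow> 'm) \<Rightarrow>
     real \<Rightarrow> real \<Rightarrow> (real \<Rightarrow> 'm) \<Rightarrow> bool" where
  "regularly_homotopic_fixing_base_point S a\<^sub>1 b\<^sub>1 \<gamma>\<^sub>1 a\<^sub>2 b\<^sub>2 \<gamma>\<^sub>2 \<longleftrightarrow>
     (\<exists>a b \<sigma>.
        continuous_on ({0..1} \<times> {a..b}) (\<lambda>(t, u). \<sigma> t u) \<and>
        (\<forall>t\<in>{0..1::real}. regular_closed_curve S a b (\<sigma> t)) \<and>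
        (\<forall>c\<in>atlas S.
           continuous_on {(t, u). t \<in> {0..1} \<and> u \<in> {a..b} \<and> \<sigma> t u \<in> fst c}
             (\<lambda>(t, u). chart_velocity c a b (\<sigma> t) u)) \<and>
        (\<forall>t\<in>{0..1}. \<sigma> t a = \<sigma> 0 a) \<and>
        same_curve a b (\<sigma> 0) a\<^sub>1 b\<^sub>1 \<gamma>\<^sub>1 \<and> same_curve a b (\<sigma> 1) a\<^sub>2 b\<^sub>2 \<gamma>\<^sub>2)"

definition unit_interval_param :: "real \<Rightarrow> real \<Rightarrow> (real \<Rightarrow> 'm) \<Rightarrow> real \<Rightarrow> 'm" where
  "unit_interval_param a b \<gamma> = (\<lambda>s. \<gamma> (a + s * (b - a)))"

definition same_pi1_class ::
    "'m::topological_space surface \<Rightarrow> real \<Rightarrow> real \<Rightarrow> (real \<Rightarrow> 'm) \<Rightarrow>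
     real \<Rightarrow> real \<Rightarrow> (real \<Rightarrow> 'm) \<Rightarrow> bool" where
  "same_pi1_class S a\<^sub>1 b\<^sub>1 \<gamma>\<^sub>1 a\<^sub>2 b\<^sub>2 \<gamma>\<^sub>2 \<longleftrightarrow>
     homotopic_paths (points S) (unit_interval_param a\<^sub>1 b\<^sub>1 \<gamma>\<^sub>1) (unit_interval_param a\<^sub>2 b\<^sub>2 \<gamma>\<^sub>2)"

definition null_homotopic ::
    "'m::topological_space surface \<Rightarrow> real \<Rightarrow> real \<Rightarrow> (real \<Rightarrow> 'm) \<Rightarrow> bool" where
  "null_homotopic S a b \<gamma> \<longleftrightarrow>
     homotopic_paths (points S) (unit_interval_param a b \<gamma>) (\<lambda>_. \<gamma> a)"

section \<open>The based winding number\<close>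

text \<open>The lift of \<open>\<gamma>\<close> starting at \<open>z\<close>; its values outside \<open>{a..b}\<close> are arbitrary and never used.\<close>

definition lift_curve ::
    "complex set \<Rightarrow> (complex \<Rightarrow> 'm) \<Rightarrow> real \<Rightarrow> real \<Rightarrow> (real \<Rightarrow> 'm) \<Rightarrow> complex \<Rightarrow> real \<Rightarrow> complex" where
  "lift_curve U pr a b \<gamma> z =
     (SOME l. continuous_on {a..b} l \<and> l ` {a..b} \<subseteq> U \<and> (\<forall>u\<in>{a..b}. pr (l u) = \<gamma> u) \<and> l a = z)"

definition deck_transformation ::
    "complex set \<Rightarrow> (complex \<Rightarrow> 'm) \<Rightarrow> (complex \<Rightarrow> complex) \<Rightarrow> bool" where
  "deck_transformation U pr T \<longleftrightarrow>
     (\<exists>T'. homeomorphism U U T T') \<and> (\<forall>z\<in>U. pr (T z) = pr z)"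

definition plane_det :: "(complex \<Rightarrow> complex) \<Rightarrow> real" where
  "plane_det L = Re (L 1) * Im (L \<i>) - Im (L 1) * Re (L \<i>)"

text \<open>A deck transformation of the connected \<open>U\<close> that does not preserve orientation reverses it.\<close>

definition curve_sign ::
    "complex set \<Rightarrow> (complex \<Rightarrow> 'm) \<Rightarrow> real \<Rightarrow> real \<Rightarrow> (real \<Rightarrow> 'm) \<Rightarrow> complex \<Rightarrow> int" where
  "curve_sign U pr a b \<gamma> z =
     (let l = lift_curve U pr a b \<gamma> z;
          T = (SOME T. deck_transformation U pr T \<and> T (l a) = l b)
      in if \<forall>x\<in>U. plane_det (frechet_derivative T (at x)) > 0 then 1 else - 1)"

text \<open>\<open>dt\<close> and \<open>dh\<close> are the two lifts of the closed geodesic: \<open>dh\<close> starts where \<open>dt\<close> ends.\<close>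

definition external_angle :: "real \<Rightarrow> real \<Rightarrow> (real \<Rightarrow> complex) \<Rightarrow> (real \<Rightarrow> complex) \<Rightarrow> real" where
  "external_angle a b dt dh =
     (THE x. - pi < x \<and> x < pi \<and>
        (\<exists>\<theta>t \<theta>h. \<exists>k::int. angle_function a b dt \<theta>t \<and> angle_function a b dh \<theta>h \<and>
           x = \<theta>h a - \<theta>t b + 2 * pi * of_int k))"

text \<open>The winding number is an integer \<open>n\<close>, rendered as \<open>Inl n\<close> with \<open>n\<close> an (integral) real
  number, or an element of the integers modulo 2, rendered as \<open>Inr C\<close> with \<open>C\<close> a coset of the
  even integers in the reals.\<close>

definition based_winding_number ::
    "'m::topological_space surface \<Rightarrow> complex set \<Rightarrow> (complex \<Rightarrow> 'm) \<Rightarrow> complex \<Rightarrow>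
     real \<Rightarrow> real \<Rightarrow> (real \<Rightarrow> 'm) \<Rightarrow> real + real set" where
  "based_winding_number S U pr z a b \<gamma> =
     (let l = lift_curve U pr a b \<gamma> z;
          dt = (SOME d. shortest_geodesic (cover_metric S pr) U (l a) (l b) a b d);
          dh = lift_curve U pr a b (pr \<circ> dt) (dt b);
          ext = external_angle a b dt dh
      in if null_homotopic S a b \<gamma> then Inl (i_index a b l)
         else if curve_sign U pr a b \<gamma> z = 1 then
           Inl (i_index a b l - i_index a b dt - ext / (2 * pi))
         else
           Inr (range (\<lambda>k::int. j_index a b l - j_index a b dt - ext / (2 * pi) + 2 * of_int k)))"

end

theory Submission
  imports Defs "HOL-Complex_Analysis.Complex_Analysis"
begin

text \<open>
Everything is moved to the universal cover \<open>U\<close>, an open part of the plane. Let \<open>l1\<close> and \<open>l2\<close> be the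
lifts of the two curves that start at \<open>p'\<close>.

The geodesic disappears. If the curves have the same homotopy class, then their lifts have the same
end \<open>q\<close>, and both winding numbers are formed with the shortest geodesic from \<open>p'\<close> to \<open>q\<close>, which by
tameness is unique up to reparametrization. Its index (modulo 2 for the index \<open>j\<close>) and its external
angle cancel, so equal winding numbers mean equal indices \<open>i\<close> of \<open>l1\<close> and \<open>l2\<close>, or indices \<open>j\<close> that
are congruent modulo 2 when the curves reverse the orientation (\<open>based_winding_number_eq_iff\<close>).
Null-homotopic curves fit in: there \<open>q = p'\<close> and the deck transformation is the identity.

Closing up is a condition on the turning. The deck transformation \<open>T\<close> with \<open>T p' = q\<close> is an isometry
of the induced metric, which is a positive multiple of the euclidean one at each point; hence the
derivative of \<open>T\<close> at \<open>p'\<close> is \<open>v \<mapsto> \<alpha> v\<close> or \<open>v \<mapsto> \<alpha> (cnj v)\<close>. A regular curve \<open>l\<close> from \<open>p'\<close> to \<open>q\<close> projects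
to a regular closed curve exactly if its final velocity is a positive multiple of the image of its
initial velocity under that derivative. For an angle function \<open>\<theta>\<close> on \<open>[a, b]\<close> this says that
\<open>\<theta> b - \<epsilon> (\<theta> a)\<close> is an argument of \<open>\<alpha>\<close>, where \<open>\<epsilon>\<close> is \<open>1\<close> or \<open>-1\<close> according to the orientation
(\<open>deck_turn\<close>).

A regular homotopy that fixes the base point lifts to curves from \<open>p'\<close> to a fixed \<open>q\<close>. The number
\<open>\<theta> b - \<epsilon> (\<theta> a)\<close> varies continuously with the homotopy parameter and stays in one coset of the
multiples of \<open>2\<pi>\<close>, so it is constant; this is the equality of indices
(\<open>regular_homotopy_invariants\<close>).

Conversely, write the velocities of the lifts, parametrized by \<open>[0, 1]\<close>, as \<open>exp \<circ> Z1\<close> and \<open>exp \<circ> Z2\<close>.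
By hypothesis \<open>Im Z 1 - \<epsilon> (Im Z 0)\<close> is the same number for both, for a suitable choice of \<open>Z2\<close>, and
the integral of \<open>exp \<circ> Z\<close> is \<open>q - p'\<close> for both. The functions \<open>Z1\<close> and \<open>Z2\<close> can be joined within the
continuous functions with these two properties (\<open>log_velocities_homotopic\<close>). Linear interpolation
respects the first property and spoils the second. To repair it, each velocity is first made constant
near \<open>1/2\<close>, and then a wiggle is put there, which turns the velocity by \<open>2\<pi>/3\<close> to the left and to the
right and back. After that the velocity takes, near \<open>1/2\<close>, three directions which span the plane with
positive coefficients, so every error of the integral is compensated by a suitable increase of the speed
where these directions are taken.

The plane curves with velocities \<open>exp \<circ> Z\<close> run from \<open>p'\<close> to \<open>q\<close>, but they may leave \<open>U\<close>. Here tameness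
enters a second time: a regular map of the plane into \<open>U\<close> that is the identity on both lifts and near
\<open>p'\<close> and \<open>q\<close> moves the homotopy into \<open>U\<close>, and it changes neither the two lifts nor the velocities
at the ends (\<open>regular_homotopy_exists\<close>).
\<close>

section \<open>Lifting to a covering space\<close>

text \<open>Lifts are required for every initial point and value, so that liftability of a set follows from
liftability of two pieces by gluing.\<close>

definition liftable :: "'c::real_normed_vector set \<Rightarrow> ('c \<Rightarrow> 'm::topological_space) \<Rightarrow>
    ('a::topological_space \<Rightarrow> 'm) \<Rightarrow> 'a set \<Rightarrow> bool" where
  "liftable C p f R \<longleftrightarrow>
     (\<forall>x0\<in>R. \<forall>y0\<in>C. p y0 = f x0 \<longrightarrow>
        (\<exists>g. continuous_on R g \<and> g ` R \<subseteq> C \<and> (\<forall>x\<in>R. p (g x) = f x) \<and> g x0 = y0))"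

text \<open>Two lifts that agree at one point of the connected intersection agree on all of it, by uniqueness
of lifts, and can be glued.\<close>

lemma liftable_Un_aux:
  assumes cov: "covering_space C p S"
    and f: "continuous_on (R1 \<union> R2) f" "f ` (R1 \<union> R2) \<subseteq> S"
    and cl: "closed R1" "closed R2" and conn: "connected (R1 \<inter> R2)" "R1 \<inter> R2 \<noteq> {}"
    and l1: "liftable C p f R1" and l2: "liftable C p f R2"
    and x0: "x0 \<in> R1" and y0: "y0 \<in> C" "p y0 = f x0"
  shows "\<exists>g. continuous_on (R1 \<union> R2) g \<and> g ` (R1 \<union> R2) \<subseteq> C \<and>
           (\<forall>x\<in>R1 \<union> R2. p (g x) = f x) \<and> g x0 = y0"
proof -
  obtain g1 where g1: "continuous_on R1 g1" "g1 ` R1 \<subseteq> C" "\<forall>x\<in>R1. p (g1 x) = f x" "g1 x0 = y0"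
    using l1 x0 y0 unfolding liftable_def by blast
  obtain x1 where x1: "x1 \<in> R1" "x1 \<in> R2" using conn by auto
  have "g1 x1 \<in> C" "p (g1 x1) = f x1" using g1 x1 by auto
  then obtain g2 where g2: "continuous_on R2 g2" "g2 ` R2 \<subseteq> C" "\<forall>x\<in>R2. p (g2 x) = f x" "g2 x1 = g1 x1"
    using l2 x1 unfolding liftable_def by blast
  have agree: "g1 x = g2 x" if "x \<in> R1 \<inter> R2" for x
  proof (rule covering_space_lift_unique[OF cov, where f = f and T = "R1 \<inter> R2" and a = x1])
    show "continuous_on (R1 \<inter> R2) f" using f(1) by (rule continuous_on_subset) auto
    show "continuous_on (R1 \<inter> R2) g1" using g1(1) by (rule continuous_on_subset) auto
    show "continuous_on (R1 \<inter> R2) g2" using g2(1) by (rule continuous_on_subset) auto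
  qed (use g1 g2 f(2) conn x1 that in auto)
  define g where "g = (\<lambda>x. if x \<in> R1 then g1 x else g2 x)"
  have "continuous_on (R1 \<union> R2) g" unfolding g_def
    by (rule continuous_on_cases) (use cl g1 g2 agree in auto)
  moreover have "g x = g1 x" if "x \<in> R1" for x using that by (simp add: g_def)
  moreover have "g x = g2 x" if "x \<in> R2" for x using that agree by (auto simp: g_def)
  ultimately show ?thesis using g1 g2 x0
    by (intro exI[of _ g]) (auto simp: image_subset_iff g_def)
qed

lemma liftable_Un:
  assumes "covering_space C p S"
    and "continuous_on (R1 \<union> R2) f" "f ` (R1 \<union> R2) \<subseteq> S"
    and "closed R1" "closed R2" and "connected (R1 \<inter> R2)" "R1 \<inter> R2 \<noteq> {}"
    and "liftable C p f R1" and "liftable C p f R2"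
  shows "liftable C p f (R1 \<union> R2)"
proof -
  have "\<exists>g. continuous_on (R1 \<union> R2) g \<and> g ` (R1 \<union> R2) \<subseteq> C \<and>
           (\<forall>x\<in>R1 \<union> R2. p (g x) = f x) \<and> g x0 = y0"
    if "x0 \<in> R1 \<union> R2" "y0 \<in> C" "p y0 = f x0" for x0 y0
  proof (cases "x0 \<in> R1")
    case True
    show ?thesis by (rule liftable_Un_aux[OF assms True that(2,3)])
  next
    case False
    then have x2: "x0 \<in> R2" using that by auto
    show ?thesis
      using liftable_Un_aux[of C p S R2 R1 f x0 y0] assms x2 that by (simp add: Un_commute Int_commute)
  qed
  then show ?thesis unfolding liftable_def by blast
qed

text \<open>Near a point \<open>f\<close> takes values in an evenly covered set, over which the inverse of a sheet lifts.\<close>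

lemma liftable_near_point:
  assumes cov: "covering_space C p S" and f: "continuous_on R f" "f ` R \<subseteq> S" and z: "z \<in> R"
  obtains N where "openin (top_of_set R) N" "z \<in> N" "\<And>Q. Q \<subseteq> N \<Longrightarrow> liftable C p f Q"
proof -
  have "f z \<in> S" using f z by auto
  then obtain T v where T: "f z \<in> T" "openin (top_of_set S) T" "\<Union>v = C \<inter> p -` T"
    "\<forall>u\<in>v. openin (top_of_set C) u" "\<forall>u\<in>v. \<exists>q. homeomorphism u T p q"
    using cov unfolding covering_space_def by meson
  define N where "N = R \<inter> f -` T"
  have "openin (top_of_set R) N" unfolding N_def
    using f T(2) by (intro continuous_openin_preimage) (auto simp: Pi_iff)
  moreover have "liftable C p f Q" if Q: "Q \<subseteq> N" for Q
    unfolding liftable_def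
  proof (intro ballI impI)
    fix x0 y0 assume x0: "x0 \<in> Q" and y0: "y0 \<in> C" "p y0 = f x0"
    then have "y0 \<in> \<Union>v" using T(3) Q by (auto simp: N_def)
    then obtain u where u: "u \<in> v" "y0 \<in> u" by auto
    then obtain q where q: "homeomorphism u T p q" using T by blast
    have QT: "f ` Q \<subseteq> T" "Q \<subseteq> R" using Q by (auto simp: N_def)
    have "continuous_on Q (q \<circ> f)"
      using q QT f(1) by (intro continuous_on_compose)
        (auto simp: homeomorphism_def intro: continuous_on_subset)
    moreover have "(q \<circ> f) ` Q \<subseteq> C"
    proof -
      have "q ` T = u" using q by (auto simp: homeomorphism_def)
      moreover have "u \<subseteq> C" using T u by (auto simp: openin_subset dest!: openin_imp_subset)
      ultimately show ?thesis using QT by auto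
    qed
    moreover have "\<forall>x\<in>Q. p ((q \<circ> f) x) = f x" using q QT by (auto simp: homeomorphism_def)
    moreover have "(q \<circ> f) x0 = y0" using q u y0 by (metis comp_apply homeomorphism_apply1)
    ultimately show "\<exists>g. continuous_on Q g \<and> g ` Q \<subseteq> C \<and> (\<forall>x\<in>Q. p (g x) = f x) \<and> g x0 = y0" by blast
  qed
  moreover have "z \<in> N" using z T(1) by (auto simp: N_def)
  ultimately show ?thesis using that by blast
qed

lemma connected_box: "connected ({a..b::real} \<times> {c..d::real})"
  by (intro connected_Times connected_Icc)

text \<open>A bisection argument in each of the two coordinates: being liftable passes from two adjacent boxes to
their union, and small boxes are liftable.\<close>

lemma liftable_box:
  fixes f :: "real \<times> real \<Rightarrow> 'm::topological_space"
  assumes cov: "covering_space C p S"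
    and f: "continuous_on ({a..b} \<times> {c..d}) f" "f ` ({a..b} \<times> {c..d}) \<subseteq> S"
    and ab: "a \<le> b" and cd: "c \<le> d"
  shows "liftable C p f ({a..b} \<times> {c..d})"
proof -
  define P where "P = (\<lambda>x y. a \<le> x \<longrightarrow> y \<le> b \<longrightarrow> liftable C p f ({x..y} \<times> {c..d}))"
  have "P a b"
  proof (rule Bolzano[OF ab])
    fix x y z assume xyz: "P x y" "P y z" "x \<le> y" "y \<le> z"
    show "P x z" unfolding P_def
    proof (intro impI)
      assume "a \<le> x" "z \<le> b"
      have eq: "{x..z} \<times> {c..d} = {x..y} \<times> {c..d} \<union> {y..z} \<times> {c..d}" using xyz by auto
      have int: "({x..y} \<times> {c..d}) \<inter> ({y..z} \<times> {c..d}) = {y..y} \<times> {c..d}" using xyz by auto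
      have sub: "{x..y} \<times> {c..d} \<union> {y..z} \<times> {c..d} \<subseteq> {a..b} \<times> {c..d}"
        using xyz \<open>a \<le> x\<close> \<open>z \<le> b\<close> by auto
      have l12: "liftable C p f ({x..y} \<times> {c..d})" "liftable C p f ({y..z} \<times> {c..d})"
        using xyz \<open>a \<le> x\<close> \<open>z \<le> b\<close> by (auto simp: P_def)
      have cl: "closed ({u..v} \<times> {c..d})" for u v :: real by (intro closed_Times) auto
      show "liftable C p f ({x..z} \<times> {c..d})" unfolding eq
      proof (rule liftable_Un[OF cov _ _ cl cl _ _ l12])
        show "f ` ({x..y} \<times> {c..d} \<union> {y..z} \<times> {c..d}) \<subseteq> S" using f(2) sub by blast
        show "continuous_on ({x..y} \<times> {c..d} \<union> {y..z} \<times> {c..d}) f"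
          using continuous_on_subset[OF f(1) sub] .
        show "connected ({x..y} \<times> {c..d} \<inter> {y..z} \<times> {c..d})"
          unfolding int by (rule connected_box)
        show "{x..y} \<times> {c..d} \<inter> {y..z} \<times> {c..d} \<noteq> {}"
          unfolding int using cd by auto
      qed
    qed
  next
    fix x assume x: "a \<le> x" "x \<le> b"
    \<comment> \<open>All boxes over \<open>[y, z]\<close> that are thin enough around \<open>x\<close> are liftable; the width depends on \<open>[y, z]\<close>, and two widths have a minimum.\<close>
    define Q where "Q = (\<lambda>y z. c \<le> y \<longrightarrow> z \<le> d \<longrightarrow>
        (\<exists>e>0. \<forall>u v. u \<le> x \<and> x \<le> v \<and> v - u < e \<and> a \<le> u \<and> v \<le> b \<longrightarrow> liftable C p f ({u..v} \<times> {y..z})))"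
    have "Q c d"
    proof (rule Bolzano[OF cd])
      fix y1 y2 y3 assume y: "Q y1 y2" "Q y2 y3" "y1 \<le> y2" "y2 \<le> y3"
      show "Q y1 y3" unfolding Q_def
      proof (intro impI)
        assume cy: "c \<le> y1" "y3 \<le> d"
        have cy2: "y2 \<le> d" "c \<le> y2" using y cy by auto
        obtain e1 where e1: "e1 > 0" "\<And>u v. u \<le> x \<and> x \<le> v \<and> v - u < e1 \<and> a \<le> u \<and> v \<le> b \<Longrightarrow> liftable C p f ({u..v} \<times> {y1..y2})"
          using y(1) cy(1) cy2(1) unfolding Q_def by blast
        obtain e2 where e2: "e2 > 0" "\<And>u v. u \<le> x \<and> x \<le> v \<and> v - u < e2 \<and> a \<le> u \<and> v \<le> b \<Longrightarrow> liftable C p f ({u..v} \<times> {y2..y3})"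
          using y(2) cy(2) cy2(2) unfolding Q_def by blast
        show "\<exists>e>0. \<forall>u v. u \<le> x \<and> x \<le> v \<and> v - u < e \<and> a \<le> u \<and> v \<le> b \<longrightarrow> liftable C p f ({u..v} \<times> {y1..y3})"
        proof (intro exI[of _ "min e1 e2"] conjI allI impI)
          show "0 < min e1 e2" using e1 e2 by auto
          fix u v assume uv: "u \<le> x \<and> x \<le> v \<and> v - u < min e1 e2 \<and> a \<le> u \<and> v \<le> b"
          have eq: "{u..v} \<times> {y1..y3} = {u..v} \<times> {y1..y2} \<union> {u..v} \<times> {y2..y3}" using y by auto
          have int: "({u..v} \<times> {y1..y2}) \<inter> ({u..v} \<times> {y2..y3}) = {u..v} \<times> {y2..y2}" using y by auto
          have sub: "{u..v} \<times> {y1..y2} \<union> {u..v} \<times> {y2..y3} \<subseteq> {a..b} \<times> {c..d}"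
            using uv cy y by auto
          have l12: "liftable C p f ({u..v} \<times> {y1..y2})" "liftable C p f ({u..v} \<times> {y2..y3})"
            using e1(2) e2(2) uv by auto
          have cl: "closed ({u..v} \<times> {y..z})" for y z :: real by (intro closed_Times) auto
          show "liftable C p f ({u..v} \<times> {y1..y3})" unfolding eq
          proof (rule liftable_Un[OF cov _ _ cl cl _ _ l12])
            show "f ` ({u..v} \<times> {y1..y2} \<union> {u..v} \<times> {y2..y3}) \<subseteq> S" using f(2) sub by blast
            show "continuous_on ({u..v} \<times> {y1..y2} \<union> {u..v} \<times> {y2..y3}) f"
              using continuous_on_subset[OF f(1) sub] .
            show "connected ({u..v} \<times> {y1..y2} \<inter> {u..v} \<times> {y2..y3})"
              unfolding int by (rule connected_box)
            show "{u..v} \<times> {y1..y2} \<inter> {u..v} \<times> {y2..y3} \<noteq> {}"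
              unfolding int using uv by auto
          qed
        qed
      qed
    next
      fix y assume y: "c \<le> y" "y \<le> d"
      have xy: "(x, y) \<in> {a..b} \<times> {c..d}" using x y by auto
      obtain N where N: "openin (top_of_set ({a..b} \<times> {c..d})) N" "(x, y) \<in> N"
        "\<And>Q. Q \<subseteq> N \<Longrightarrow> liftable C p f Q"
        using liftable_near_point[OF cov f xy] by blast
      then obtain W where W: "open W" "N = ({a..b} \<times> {c..d}) \<inter> W"
        by (auto simp: openin_open)
      then obtain e where e: "e > 0" "ball (x, y) e \<subseteq> W" using N(2)
        by (meson IntD2 open_contains_ball_eq)
      show "\<exists>e>0. \<forall>y1 y2. y1 \<le> y \<and> y \<le> y2 \<and> y2 - y1 < e \<longrightarrow> Q y1 y2"
      proof (intro exI[of _ "e/2"] conjI allI impI)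
        show "0 < e / 2" using e by auto
        fix y1 y2 assume y12: "y1 \<le> y \<and> y \<le> y2 \<and> y2 - y1 < e/2"
        show "Q y1 y2" unfolding Q_def
        proof (intro impI exI[of _ "e/2"] conjI allI)
          show "0 < e / 2" using e by auto
          assume cy: "c \<le> y1" "y2 \<le> d"
          fix u v assume uv: "u \<le> x \<and> x \<le> v \<and> v - u < e/2 \<and> a \<le> u \<and> v \<le> b"
          have "{u..v} \<times> {y1..y2} \<subseteq> N"
          proof
            fix w assume w: "w \<in> {u..v} \<times> {y1..y2}"
            obtain w1 w2 where w12: "w = (w1, w2)" by fastforce
            have *: "dist x w1 < e/2" "dist y w2 < e/2" using w w12 uv y12 by (auto simp: dist_real_def abs_less_iff split: abs_split)
            have "dist (x, y) w \<le> dist x w1 + dist y w2"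
              unfolding w12 dist_prod_def by (simp add: sqrt_sum_squares_le_sum)
            then have "dist (x, y) w < e" using * by linarith
            then have "w \<in> W" using e by (meson mem_ball subsetD)
            moreover have "w \<in> {a..b} \<times> {c..d}" using w uv cy by auto
            ultimately show "w \<in> N" using W by auto
          qed
          then show "liftable C p f ({u..v} \<times> {y1..y2})" by (rule N(3))
        qed
      qed
    qed
    then obtain e where "e > 0" "\<forall>u v. u \<le> x \<and> x \<le> v \<and> v - u < e \<and> a \<le> u \<and> v \<le> b \<longrightarrow> liftable C p f ({u..v} \<times> {c..d})"
      unfolding Q_def by auto
    then show "\<exists>e>0. \<forall>u v. u \<le> x \<and> x \<le> v \<and> v - u < e \<longrightarrow> P u v"
      unfolding P_def by blast
  qed
  then show ?thesis by (simp add: P_def)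
qed

corollary covering_lift_box:
  fixes p :: "'c::real_normed_vector \<Rightarrow> 'm::topological_space" and f :: "real \<times> real \<Rightarrow> 'm::topological_space"
  assumes "covering_space C p S"
    and "continuous_on ({a..b} \<times> {c..d}) f" "f ` ({a..b} \<times> {c..d}) \<subseteq> S"
    and "z0 \<in> {a..b} \<times> {c..d}" "y0 \<in> C" "p y0 = f z0"
  obtains g where "continuous_on ({a..b} \<times> {c..d}) g" "g ` ({a..b} \<times> {c..d}) \<subseteq> C"
    "\<And>z. z \<in> {a..b} \<times> {c..d} \<Longrightarrow> p (g z) = f z" "g z0 = y0"
proof -
  have "a \<le> b" "c \<le> d" using assms(4) by auto
  from liftable_box[OF assms(1-3) this] show ?thesis
    using assms(4-6) that unfolding liftable_def by blast
qed

corollary covering_lift_interval: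
  fixes p :: "'c::real_normed_vector \<Rightarrow> 'm::topological_space" and f :: "real \<Rightarrow> 'm::topological_space"
  assumes cov: "covering_space C p S" and f: "continuous_on {a..b} f" "f ` {a..b} \<subseteq> S"
    and a: "a \<le> b" "y0 \<in> C" "p y0 = f a"
  obtains g where "continuous_on {a..b} g" "g ` {a..b} \<subseteq> C"
    "\<And>u. u \<in> {a..b} \<Longrightarrow> p (g u) = f u" "g a = y0"
proof -
  have "continuous_on ({0..0::real} \<times> {a..b}) (\<lambda>z. f (snd z))"
    by (rule continuous_on_compose2[OF f(1)]) (auto intro!: continuous_intros)
  then obtain g where g: "continuous_on ({0..0::real} \<times> {a..b}) g" "g ` ({0..0} \<times> {a..b}) \<subseteq> C"
    "\<And>z. z \<in> {0..0} \<times> {a..b} \<Longrightarrow> p (g z) = f (snd z)" "g (0, a) = y0"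
    using covering_lift_box[OF cov, of 0 0 a b "\<lambda>z. f (snd z)" "(0, a)" y0 thesis] f a by (auto simp: image_subset_iff)
  show ?thesis
  proof
    show "continuous_on {a..b} (\<lambda>u. g (0, u))"
      by (rule continuous_on_compose2[OF g(1)]) (auto intro!: continuous_intros)
  qed (use g in \<open>auto simp: image_subset_iff\<close>)
qed

lemma covering_lift_interval_unique:
  fixes p :: "'c::real_normed_vector \<Rightarrow> 'm::topological_space" 
  assumes cov: "covering_space C p S"
    and g: "continuous_on {a..b::real} g" "g ` {a..b} \<subseteq> C"
    and h: "continuous_on {a..b} h" "h ` {a..b} \<subseteq> C"
    and eq: "\<And>u. u \<in> {a..b} \<Longrightarrow> p (g u) = p (h u)" "g a = h a" and u: "u \<in> {a..b}"
  shows "g u = h u"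
proof (rule covering_space_lift_unique[OF cov, where f = "\<lambda>u. p (g u)" and T = "{a..b}" and a = a])
  have "continuous_on C p" using cov by (rule covering_space_imp_continuous)
  then show "continuous_on {a..b} (\<lambda>u. p (g u))"
    by (rule continuous_on_compose2) (use g in auto)
  show "(\<lambda>u. p (g u)) \<in> {a..b} \<rightarrow> S"
    using g covering_space_imp_surjective[OF cov] by auto
qed (use assms in \<open>auto intro: connected_Icc\<close>)

lemma covering_lift_box_unique:
  fixes p :: "'c::real_normed_vector \<Rightarrow> 'm::topological_space" and g h :: "real \<times> real \<Rightarrow> 'c"
  assumes cov: "covering_space C p S"
    and g: "continuous_on ({a..b} \<times> {c..d}) g" "g ` ({a..b} \<times> {c..d}) \<subseteq> C"
    and h: "continuous_on ({a..b} \<times> {c..d}) h" "h ` ({a..b} \<times> {c..d}) \<subseteq> C"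
    and eq: "\<And>z. z \<in> {a..b} \<times> {c..d} \<Longrightarrow> p (g z) = p (h z)" "g z0 = h z0"
    and z: "z0 \<in> {a..b} \<times> {c..d}" "z \<in> {a..b} \<times> {c..d}"
  shows "g z = h z"
proof (rule covering_space_lift_unique[OF cov, where f = "\<lambda>z. p (g z)" and T = "{a..b} \<times> {c..d}" and a = z0])
  have "continuous_on C p" using cov by (rule covering_space_imp_continuous)
  then show "continuous_on ({a..b} \<times> {c..d}) (\<lambda>z. p (g z))"
    by (rule continuous_on_compose2) (use g in auto)
  show "(\<lambda>z. p (g z)) \<in> {a..b} \<times> {c..d} \<rightarrow> S"
    using g covering_space_imp_surjective[OF cov] by blast
qed (use assms in \<open>auto intro: connected_box simp: image_subset_iff\<close>)

text \<open>The cover \<open>U\<close> is homeomorphic to the plane by the Riemann mapping theorem, and the plane is exhausted by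
squares. The lifts of \<open>p\<close> on these squares with the prescribed value at one point extend one another.\<close>

lemma covering_self_lift:
  fixes p :: "complex \<Rightarrow> 'm::topological_space"
  assumes cov: "covering_space U p S" and U: "open U" "simply_connected U"
    and zw: "z \<in> U" "w \<in> U" "p w = p z"
  obtains T where "continuous_on U T" "T ` U \<subseteq> U" "\<And>x. x \<in> U \<Longrightarrow> p (T x) = p x" "T z = w"
proof -
  have "U homeomorphic ball (0::complex) 1"
    using simply_connected_eq_homeomorphic_to_disc[OF U(1)] U zw by auto
  then have "U homeomorphic (UNIV :: complex set)"
    using homeomorphic_ball01_UNIV homeomorphic_trans by blast
  then obtain h k where hk: "homeomorphism U (UNIV :: complex set) h k" unfolding homeomorphic_def by blast
  have hk': "continuous_on U h" "continuous_on UNIV k" "k ` UNIV = U" "\<And>x. x \<in> U \<Longrightarrow> k (h x) = x"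
    using hk by (auto simp: homeomorphism_def)
  define B where "B = (\<lambda>n::nat. {-real n..real n} \<times> {-real n..real n})"
  define f where "f = (\<lambda>q::real \<times> real. p (k (Complex (fst q) (snd q))))"
  define q0 where "q0 = (Re (h z), Im (h z))"
  have contp: "continuous_on U p" using cov by (rule covering_space_imp_continuous)
  have cf: "continuous_on X f" for X unfolding f_def
    by (rule continuous_on_compose2[OF contp], rule continuous_on_compose2[OF hk'(2)])
      (use hk' in \<open>auto intro!: continuous_intros\<close>)
  have fS: "f ` X \<subseteq> S" for X using covering_space_imp_surjective[OF cov] hk' by (auto simp: f_def)
  \<comment> \<open>the first square that contains the point where the value is prescribed\<close>
  obtain N where N: "q0 \<in> B N"
  proof
    have "\<bar>Re (h z)\<bar> \<le> real (nat \<lceil>\<bar>Re (h z)\<bar> + \<bar>Im (h z)\<bar>\<rceil>)"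
         "\<bar>Im (h z)\<bar> \<le> real (nat \<lceil>\<bar>Re (h z)\<bar> + \<bar>Im (h z)\<bar>\<rceil>)" by linarith+
    then show "q0 \<in> B (nat \<lceil>\<bar>Re (h z)\<bar> + \<bar>Im (h z)\<bar>\<rceil>)" unfolding q0_def B_def by auto
  qed
  have mono: "B m \<subseteq> B n" if "m \<le> n" for m n using that unfolding B_def by auto
  have fq0: "f q0 = p w" using zw hk' by (simp add: f_def q0_def)
  have "\<exists>g. continuous_on (B n) g \<and> g ` B n \<subseteq> U \<and> (\<forall>q\<in>B n. p (g q) = f q) \<and> g q0 = w" if "N \<le> n" for n
  proof -
    have q0: "q0 \<in> {-real n..real n} \<times> {-real n..real n}" using N mono[OF that] by (auto simp: B_def)
    obtain g where "continuous_on ({-real n..real n} \<times> {-real n..real n}) g"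
      "g ` ({-real n..real n} \<times> {-real n..real n}) \<subseteq> U"
      "\<And>z. z \<in> {-real n..real n} \<times> {-real n..real n} \<Longrightarrow> p (g z) = f z" "g q0 = w"
      using covering_lift_box[OF cov cf fS q0 zw(2) fq0[symmetric]] by blast
    then show ?thesis unfolding B_def by blast
  qed
  then obtain G where G: "\<And>n. N \<le> n \<Longrightarrow> continuous_on (B n) (G n)" "\<And>n. N \<le> n \<Longrightarrow> G n ` B n \<subseteq> U"
    "\<And>n q. N \<le> n \<Longrightarrow> q \<in> B n \<Longrightarrow> p (G n q) = f q" "\<And>n. N \<le> n \<Longrightarrow> G n q0 = w"
    by metis
  have agree: "G m q = G n q" if mn: "N \<le> m" "m \<le> n" and q: "q \<in> B m" for m n q
  proof -
    have n: "N \<le> n" using mn by simp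
    have "continuous_on (B m) (G n)" "G n ` B m \<subseteq> U"
      using G(1,2)[OF n] mono[OF mn(2)] by (auto intro: continuous_on_subset)
    moreover have "p (G m q) = p (G n q)" if "q \<in> B m" for q
      using G(3)[OF mn(1) that] G(3)[OF n subsetD[OF mono[OF mn(2)] that]] by simp
    moreover have "q0 \<in> B m" using N mono[OF mn(1)] by auto
    ultimately show ?thesis
      using covering_lift_box_unique[OF cov, of "-real m" "real m" "-real m" "real m" "G m" "G n" q0 q]
        G(1,2,4) mn n q unfolding B_def by auto
  qed
  define g where "g = (\<lambda>q. G (N + nat \<lceil>\<bar>fst q\<bar> + \<bar>snd q\<bar>\<rceil>) q)"
  define O' where "O' = (\<lambda>n::nat. {-real n<..<real n} \<times> {-real n<..<real n})"
  have inB: "q \<in> B (N + nat \<lceil>\<bar>fst q\<bar> + \<bar>snd q\<bar>\<rceil>)" for q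
  proof -
    have "\<bar>fst q\<bar> \<le> real (nat \<lceil>\<bar>fst q\<bar> + \<bar>snd q\<bar>\<rceil>)" "\<bar>snd q\<bar> \<le> real (nat \<lceil>\<bar>fst q\<bar> + \<bar>snd q\<bar>\<rceil>)"
      by linarith+
    then show ?thesis by (cases q) (auto simp: B_def)
  qed
  have geq: "g q = G n q" if n: "N \<le> n" "q \<in> B n" for n q
  proof (cases "n \<le> N + nat \<lceil>\<bar>fst q\<bar> + \<bar>snd q\<bar>\<rceil>")
    case True
    then show ?thesis using agree[OF n(1) True n(2)] by (simp add: g_def)
  next
    case False
    then show ?thesis using agree[of "N + nat \<lceil>\<bar>fst q\<bar> + \<bar>snd q\<bar>\<rceil>" n q] inB by (simp add: g_def)
  qed
  have "continuous_on (\<Union>n\<in>{N..}. O' n) g"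
  proof (rule continuous_on_open_UN)
    fix n assume "n \<in> {N..}"
    then have n: "N \<le> n" by simp
    show "open (O' n)" unfolding O'_def by (intro open_Times) auto
    have sub: "O' n \<subseteq> B n" by (auto simp: O'_def B_def)
    then have "continuous_on (O' n) (G n)" using G(1)[OF n] continuous_on_subset by blast
    then show "continuous_on (O' n) g"
      using geq[OF n] sub by (subst continuous_on_cong[OF refl, of _ _ "G n"]) auto
  qed
  moreover have "(\<Union>n\<in>{N..}. O' n) = UNIV"
  proof -
    have "q \<in> O' (Suc (N + nat \<lceil>\<bar>fst q\<bar> + \<bar>snd q\<bar>\<rceil>))" for q
      using inB[of q] by (cases q) (auto simp: B_def O'_def)
    then have "q \<in> (\<Union>n\<in>{N..}. O' n)" for q
      by (intro UN_I[of "Suc (N + nat \<lceil>\<bar>fst q\<bar> + \<bar>snd q\<bar>\<rceil>)"]) auto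
    then show ?thesis by blast
  qed
  ultimately have cg: "continuous_on UNIV g" by simp
  have gU: "g q \<in> U" and pg: "p (g q) = f q" for q
    using G(2,3)[of "N + nat \<lceil>\<bar>fst q\<bar> + \<bar>snd q\<bar>\<rceil>"] inB[of q] by (auto simp: g_def)
  have gq0: "g q0 = w" using geq[OF le_refl N] G(4) by simp
  show ?thesis
  proof
    show "continuous_on U (\<lambda>x. g (Re (h x), Im (h x)))"
      by (rule continuous_on_compose2[OF cg]) (auto intro!: continuous_intros hk')
    show "(\<lambda>x. g (Re (h x), Im (h x))) ` U \<subseteq> U" using gU by auto
    show "p (g (Re (h x), Im (h x))) = p x" if "x \<in> U" for x
      using pg hk'(4)[OF that] by (simp add: f_def)
    show "g (Re (h z), Im (h z)) = w" using gq0 by (simp add: q0_def)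
  qed
qed

lemma covering_self_map_unique:
  fixes p :: "complex \<Rightarrow> 'm::topological_space"
  assumes cov: "covering_space U p S" and U: "connected U"
    and T1: "continuous_on U T1" "T1 ` U \<subseteq> U" "\<And>x. x \<in> U \<Longrightarrow> p (T1 x) = p x"
    and T2: "continuous_on U T2" "T2 ` U \<subseteq> U" "\<And>x. x \<in> U \<Longrightarrow> p (T2 x) = p x"
    and z: "z \<in> U" "T1 z = T2 z" and x: "x \<in> U"
  shows "T1 x = T2 x"
proof (rule covering_space_lift_unique[OF cov, where f = p and T = U and a = z and ?g1.0 = T1 and ?g2.0 = T2 and x = x])
  show "continuous_on U p" using cov by (rule covering_space_imp_continuous)
  show "p \<in> U \<rightarrow> S" using covering_space_imp_surjective[OF cov] by auto
qed (use assms in auto)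

text \<open>Lifts of \<open>p\<close> through itself exist in both directions between two points of a fibre; they are inverse to
each other by uniqueness.\<close>

lemma deck_transformation_exists:
  fixes p :: "complex \<Rightarrow> 'm::topological_space"
  assumes cov: "covering_space U p S" and U: "open U" "simply_connected U"
    and zw: "z \<in> U" "w \<in> U" "p w = p z"
  shows "\<exists>T. deck_transformation U p T \<and> T z = w"
proof -
  have conn: "connected U" using U simply_connected_imp_connected by blast
  obtain T where T: "continuous_on U T" "T ` U \<subseteq> U" "\<And>x. x \<in> U \<Longrightarrow> p (T x) = p x" "T z = w"
    using covering_self_lift[OF cov U zw] by blast
  obtain T' where T': "continuous_on U T'" "T' ` U \<subseteq> U" "\<And>x. x \<in> U \<Longrightarrow> p (T' x) = p x" "T' w = z"
    using covering_self_lift[OF cov U zw(2,1)] zw(3) by metis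
  have 1: "T' (T x) = x" if "x \<in> U" for x
    using covering_self_map_unique[OF cov conn, of "\<lambda>x. T' (T x)" "\<lambda>x. x" z x] T T' zw that
    by (auto intro!: continuous_on_compose2[OF T'(1)] simp: image_subset_iff)
  have 2: "T (T' x) = x" if "x \<in> U" for x
    using covering_self_map_unique[OF cov conn, of "\<lambda>x. T (T' x)" "\<lambda>x. x" w x] T T' zw that
    by (auto intro!: continuous_on_compose2[OF T(1)] simp: image_subset_iff)
  have "T ` U = U" "T' ` U = U" using 1 2 T T' by (auto simp: image_subset_iff image_iff) (metis)+
  then have "homeomorphism U U T T'" using T T' 1 2 by (auto simp: homeomorphism_def)
  then show ?thesis using T by (auto simp: deck_transformation_def)
qed

section \<open>Regular curves in the plane with prescribed ends and turning\<close>

text \<open>The condition on a logarithm \<open>Z\<close> of the velocity of a curve on \<open>[0, 1]\<close>: the displacement is \<open>d\<close>, and \<open>c\<close>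
is the turning, which for \<open>\<epsilon> = 1\<close> is the total turning and for \<open>\<epsilon> = -1\<close> the sum of the angles at the
ends. Logarithms keep the velocity away from 0 automatically.\<close>

definition log_velocity_ok :: "real \<Rightarrow> real \<Rightarrow> complex \<Rightarrow> (real \<Rightarrow> complex) \<Rightarrow> bool" where
  "log_velocity_ok \<epsilon> c d Z \<longleftrightarrow>
     integral {0..1} (\<lambda>u. exp (Z u)) = d \<and> Im (Z 1) - \<epsilon> * Im (Z 0) = c"

abbreviation log_velocity_homotopic where
  "log_velocity_homotopic \<epsilon> c d \<equiv> homotopic_with_canon (log_velocity_ok \<epsilon> c d) {0..1} (UNIV :: complex set)"

lemma log_velocity_ok_cong:
  assumes "\<And>u. u \<in> {0..1} \<Longrightarrow> Z u = Z' u"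
  shows "log_velocity_ok \<epsilon> c d Z \<longleftrightarrow> log_velocity_ok \<epsilon> c d Z'"
proof -
  have "integral {0..1} (\<lambda>u. exp (Z u)) = integral {0..1} (\<lambda>u. exp (Z' u))"
    using assms by (intro integral_cong) auto
  then show ?thesis using assms[of 0] assms[of 1] by (simp add: log_velocity_ok_def)
qed

lemma log_velocity_homotopic_iff:
  "log_velocity_homotopic \<epsilon> c d Z Z' \<longleftrightarrow>
     (\<exists>h. continuous_on ({0..1::real} \<times> {0..1}) h \<and> (\<forall>u\<in>{0..1}. h (0, u) = Z u) \<and>
          (\<forall>u\<in>{0..1}. h (1, u) = Z' u) \<and> (\<forall>t\<in>{0..1}. log_velocity_ok \<epsilon> c d (\<lambda>u. h (t, u))))"
proof -
  have cong: "log_velocity_ok \<epsilon> c d h = log_velocity_ok \<epsilon> c d k"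
    if "\<And>x. x \<in> topspace (top_of_set {0..1}) \<Longrightarrow> h x = k x" for h k
    using that by (intro log_velocity_ok_cong) auto
  show ?thesis
    by (rule trans[OF homotopic_with[OF cong]]) (auto simp flip: subtopology_Times)
qed

lemma bump_exists:
  fixes c r :: real
  assumes "r > 0" "0 \<le> c - r" "c + r \<le> 1"
  obtains e :: "real \<Rightarrow> real" where "continuous_on UNIV e" "\<And>u. 0 \<le> e u"
    "\<And>u. r \<le> \<bar>u - c\<bar> \<Longrightarrow> e u = 0" "integral {0..1} e = 1"
proof -
  define f where "f = (\<lambda>u. max 0 (r - \<bar>u - c\<bar>))"
  have cont: "continuous_on X f" for X unfolding f_def by (intro continuous_intros)
  have int: "f integrable_on {0..1}" by (intro integrable_continuous_real cont)
  have "integral {0..1} f \<noteq> 0"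
  proof
    assume "integral {0..1} f = 0"
    moreover have "\<And>u. f u \<ge> 0" by (simp add: f_def)
    ultimately have "\<forall>u\<in>{0..1}. f u = 0"
      using integral_eq_0_iff[OF cont, of 0 1] \<open>integral {0..1} f = 0\<close> by simp
    then have "f c = 0" using assms by simp
    then show False using assms(1) by (simp add: f_def max_def split: if_splits)
  qed
  moreover have "integral {0..1} f \<ge> 0" by (intro integral_nonneg int) (auto simp: f_def)
  ultimately have pos: "integral {0..1} f > 0" by simp
  show ?thesis
  proof
    show "continuous_on UNIV (\<lambda>u. f u / integral {0..1} f)" using pos by (intro continuous_intros cont) auto
    show "integral {0..1} (\<lambda>u. f u / integral {0..1} f) = 1" using pos by simp
  qed (use pos in \<open>auto simp: f_def\<close>)
qed

text \<open>Equal to 1 on \<open>[-1, 1]\<close> and to 0 outside \<open>[-2, 2]\<close>, and linear in between.\<close>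

definition plateau :: "real \<Rightarrow> real" where
  "plateau x = max 0 (min 1 (2 - \<bar>x\<bar>))"

lemma plateau: "0 \<le> plateau x" "plateau x \<le> 1" "\<bar>x\<bar> \<le> 1 \<Longrightarrow> plateau x = 1" "2 \<le> \<bar>x\<bar> \<Longrightarrow> plateau x = 0"
  "plateau (- x) = plateau x"
  by (auto simp: plateau_def)

lemma continuous_on_plateau: "continuous_on X f \<Longrightarrow> continuous_on X (\<lambda>x. plateau (f x))"
  unfolding plateau_def by (intro continuous_intros)

text \<open>The angle \<open>\<phi>\<close> of a wiggle near \<open>1/2\<close>, together with bumps of integral 1 in the regions where the angle is
\<open>0\<close>, \<open>2\<pi>/3\<close> and \<open>-2\<pi>/3\<close>. That \<open>\<phi>\<close> is odd about \<open>1/2\<close> makes the integral of \<open>cis (s * \<phi> u)\<close> real for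
every \<open>s\<close>, so that a wiggle of any amplitude can be compensated by the bump \<open>e0\<close> alone.\<close>

locale wiggle =
  fixes \<delta> :: real and \<phi> e0 e1 e2 :: "real \<Rightarrow> real"
  assumes \<delta>: "0 < \<delta>" "\<delta> < 1/2"
    and \<phi>: "continuous_on UNIV \<phi>" and odd: "\<And>u. \<phi> (1 - u) = - \<phi> u"
    and e: "continuous_on UNIV e0" "continuous_on UNIV e1" "continuous_on UNIV e2"
    and e_nonneg: "\<And>u. 0 \<le> e0 u" "\<And>u. 0 \<le> e1 u" "\<And>u. 0 \<le> e2 u"
    and supp: "\<And>u. \<delta> \<le> \<bar>u - 1/2\<bar> \<Longrightarrow> \<phi> u = 0 \<and> e0 u = 0 \<and> e1 u = 0 \<and> e2 u = 0"
    and on_e: "\<And>u. e0 u \<noteq> 0 \<Longrightarrow> \<phi> u = 0" "\<And>u. e1 u \<noteq> 0 \<Longrightarrow> \<phi> u = 2 * pi / 3"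
      "\<And>u. e2 u \<noteq> 0 \<Longrightarrow> \<phi> u = - (2 * pi / 3)"
    and int_e: "integral {0..1} e0 = 1" "integral {0..1} e1 = 1" "integral {0..1} e2 = 1"

lemma wiggle_exists:
  assumes "0 < \<delta>" "\<delta> < 1/2"
  obtains \<phi> e0 e1 e2 where "wiggle \<delta> \<phi> e0 e1 e2"
proof -
  \<comment> \<open>In the coordinate \<open>x\<close> the plateaus of \<open>\<phi>\<close> have centres \<open>1/2\<close> and \<open>-1/2\<close> and half width \<open>1/8\<close>.\<close>
  define x where "x = (\<lambda>u::real. (u - 1/2) / \<delta>)"
  define \<phi> where "\<phi> = (\<lambda>u. (2 * pi / 3) * (plateau (8 * (x u - 1/2)) - plateau (8 * (x u + 1/2))))"
  define r where "r = \<delta> / 8"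
  obtain e0 :: "real \<Rightarrow> real" where e0: "continuous_on UNIV e0" "\<And>u. 0 \<le> e0 u"
    "\<And>u. r \<le> \<bar>u - 1/2\<bar> \<Longrightarrow> e0 u = 0" "integral {0..1} e0 = 1"
    using bump_exists[of r "1/2"] assms unfolding r_def by auto
  obtain e1 :: "real \<Rightarrow> real" where e1: "continuous_on UNIV e1" "\<And>u. 0 \<le> e1 u"
    "\<And>u. r \<le> \<bar>u - (1/2 + \<delta>/2)\<bar> \<Longrightarrow> e1 u = 0" "integral {0..1} e1 = 1"
    using bump_exists[of r "1/2 + \<delta>/2"] assms unfolding r_def by auto
  obtain e2 :: "real \<Rightarrow> real" where e2: "continuous_on UNIV e2" "\<And>u. 0 \<le> e2 u"
    "\<And>u. r \<le> \<bar>u - (1/2 - \<delta>/2)\<bar> \<Longrightarrow> e2 u = 0" "integral {0..1} e2 = 1"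
    using bump_exists[of r "1/2 - \<delta>/2"] assms unfolding r_def by auto
  have x: "u = 1/2 + \<delta> * x u" for u using assms by (simp add: x_def)
  have xr: "\<bar>u - (1/2 + \<delta> * a)\<bar> = \<delta> * \<bar>x u - a\<bar>" for u a
  proof -
    have "u - (1/2 + \<delta> * a) = \<delta> * (x u - a)" using x[of u] by (simp add: algebra_simps)
    then show ?thesis using assms by (simp add: abs_mult)
  qed
  have near: "\<bar>x u - a\<bar> < 1/8" if "\<not> r \<le> \<bar>u - (1/2 + \<delta> * a)\<bar>" for u a
    using that assms unfolding xr r_def by (simp add: field_simps not_le)
  have "wiggle \<delta> \<phi> e0 e1 e2"
  proof unfold_locales
    show "continuous_on UNIV \<phi>" unfolding \<phi>_def x_def
      using assms by (intro continuous_intros continuous_on_plateau) auto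
    show "\<phi> (1 - u) = - \<phi> u" for u
    proof -
      have "x (1 - u) = - x u" by (simp add: x_def diff_divide_distrib)
      then have "8 * (x (1 - u) - 1/2) = - (8 * (x u + 1/2))" "8 * (x (1 - u) + 1/2) = - (8 * (x u - 1/2))"
        by (simp_all add: algebra_simps)
      then show ?thesis unfolding \<phi>_def by (simp only: plateau) (simp add: algebra_simps)
    qed
    show "\<phi> u = 0" if "e0 u \<noteq> 0" for u
    proof -
      have xb: "\<bar>x u - 0\<bar> < 1/8" using near[of u 0] e0(3)[of u] that by auto
      have "2 \<le> \<bar>8 * (x u - 1/2)\<bar>" using xb by (auto simp: abs_if split: if_splits)
      moreover have "2 \<le> \<bar>8 * (x u + 1/2)\<bar>" using xb by (auto simp: abs_if split: if_splits)
      ultimately have "plateau (8 * (x u - 1/2)) = 0" "plateau (8 * (x u + 1/2)) = 0" by (simp_all only: plateau)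
      then show ?thesis by (simp add: \<phi>_def)
    qed
    show "\<phi> u = 2 * pi / 3" if "e1 u \<noteq> 0" for u
    proof -
      have xb: "\<bar>x u - 1/2\<bar> < 1/8" using near[of u "1/2"] e1(3)[of u] that by auto
      have "\<bar>8 * (x u - 1/2)\<bar> \<le> 1" using xb by (auto simp: abs_if split: if_splits)
      moreover have "2 \<le> \<bar>8 * (x u + 1/2)\<bar>" using xb by (auto simp: abs_if split: if_splits)
      ultimately have "plateau (8 * (x u - 1/2)) = 1" "plateau (8 * (x u + 1/2)) = 0" by (simp_all only: plateau)
      then show ?thesis by (simp add: \<phi>_def)
    qed
    show "\<phi> u = - (2 * pi / 3)" if "e2 u \<noteq> 0" for u
    proof -
      have xb: "\<bar>x u - (-1/2)\<bar> < 1/8" using near[of u "-1/2"] e2(3)[of u] that by auto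
      have "2 \<le> \<bar>8 * (x u - 1/2)\<bar>" using xb by (auto simp: abs_if split: if_splits)
      moreover have "\<bar>8 * (x u + 1/2)\<bar> \<le> 1" using xb by (auto simp: abs_if split: if_splits)
      ultimately have "plateau (8 * (x u - 1/2)) = 0" "plateau (8 * (x u + 1/2)) = 1" by (simp_all only: plateau)
      then show ?thesis by (simp add: \<phi>_def)
    qed
    show "\<phi> u = 0 \<and> e0 u = 0 \<and> e1 u = 0 \<and> e2 u = 0" if "\<delta> \<le> \<bar>u - 1/2\<bar>" for u
    proof -
      have xb: "1 \<le> \<bar>x u\<bar>" using that assms by (simp add: x_def)
      have "2 \<le> \<bar>8 * (x u - 1/2)\<bar>" using xb by (auto simp: abs_if split: if_splits)
      moreover have "2 \<le> \<bar>8 * (x u + 1/2)\<bar>" using xb by (auto simp: abs_if split: if_splits)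
      ultimately have "plateau (8 * (x u - 1/2)) = 0" "plateau (8 * (x u + 1/2)) = 0" by (simp_all only: plateau)
      moreover have "r \<le> \<bar>u - 1/2\<bar>" "r \<le> \<bar>u - (1/2 + \<delta>/2)\<bar>" "r \<le> \<bar>u - (1/2 - \<delta>/2)\<bar>"
        using that assms unfolding r_def by linarith+
      ultimately show ?thesis using e0 e1 e2 by (simp add: \<phi>_def)
    qed
  qed (use assms e0 e1 e2 in auto)
  then show ?thesis by (rule that)
qed

text \<open>The velocity \<open>v\<close> is moved linearly towards a constant \<open>m\<close> with a weight \<open>\<kappa>\<close> supported near \<open>1/2\<close>. If \<open>m\<close> is the
average of \<open>v\<close> with weight \<open>\<kappa>\<close>, then the displacement does not change at any time of this homotopy. If the
support is small, then \<open>m\<close> is so close to the values of \<open>v\<close> there that the velocity stays away from 0.\<close>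

lemma log_flatten:
  fixes Z :: "real \<Rightarrow> complex"
  assumes Z: "continuous_on {0..1} Z" and ok: "log_velocity_ok \<epsilon> c d Z"
  obtains \<delta>0 where "0 < \<delta>0" "\<delta>0 < 1/4"
    "\<And>\<delta>. 0 < \<delta> \<Longrightarrow> \<delta> \<le> \<delta>0 \<Longrightarrow> \<exists>Z'. continuous_on {0..1} Z' \<and> log_velocity_homotopic \<epsilon> c d Z Z' \<and>
        (\<forall>u. \<bar>u - 1/2\<bar> \<le> \<delta> \<longrightarrow> Z' u = Z' (1/2))"
proof -
  define v where "v = (\<lambda>u. exp (Z u))"
  have v: "continuous_on {0..1} v" unfolding v_def by (intro continuous_intros Z)
  obtain u0 where u0: "u0 \<in> {0..1}" "\<And>u. u \<in> {0..1} \<Longrightarrow> norm (v u0) \<le> norm (v u)"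
    using continuous_attains_inf[of "{0..1}" "\<lambda>u. norm (v u)"] continuous_on_norm[OF v] by auto
  define \<mu> where "\<mu> = norm (v u0)"
  have \<mu>: "\<mu> > 0" "\<And>u. u \<in> {0..1} \<Longrightarrow> \<mu> \<le> norm (v u)" using u0 by (auto simp: \<mu>_def v_def)
  have half: "1/2 \<in> {0..1::real}" by simp
  have "\<forall>e>0. \<exists>r>0. \<forall>u\<in>{0..1}. dist u (1/2) < r \<longrightarrow> dist (v u) (v (1/2)) < e"
    using v half unfolding continuous_on_iff by blast
  then obtain r1 where r1: "r1 > 0" "\<And>u. u \<in> {0..1} \<Longrightarrow> dist u (1/2) < r1 \<Longrightarrow> dist (v u) (v (1/2)) < \<mu> / 4"
    using \<mu>(1) by (meson divide_pos_pos zero_less_numeral)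
  have "\<forall>e>0. \<exists>r>0. \<forall>u\<in>{0..1}. dist u (1/2) < r \<longrightarrow> dist (Z u) (Z (1/2)) < e"
    using Z half unfolding continuous_on_iff by blast
  then obtain r2 where r2: "r2 > 0" "\<And>u. u \<in> {0..1} \<Longrightarrow> dist u (1/2) < r2 \<Longrightarrow> dist (Z u) (Z (1/2)) < 1"
    by (meson zero_less_one)
  \<comment> \<open>The support of the weight, of half width \<open>2 * \<delta>\<close>, has to lie in \<open>[0, 1]\<close> and where \<open>v\<close> and \<open>Z\<close> are almost constant.\<close>
  define \<delta>0 where "\<delta>0 = min (1/8) (min (r1/4) (r2/4))"
  show ?thesis
  proof
    show "0 < \<delta>0" "\<delta>0 < 1/4" using r1 r2 by (auto simp: \<delta>0_def)
    fix \<delta> assume \<delta>: "0 < \<delta>" "\<delta> \<le> \<delta>0"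
    have \<delta>': "2 * \<delta> \<le> 1/4" "2 * \<delta> < r1" "2 * \<delta> < r2" using \<delta> r1 r2 by (auto simp: \<delta>0_def)
    define \<kappa> where "\<kappa> = (\<lambda>u::real. plateau ((u - 1/2) / \<delta>))"
    have \<kappa>: "continuous_on X \<kappa>" for X unfolding \<kappa>_def using \<delta> by (intro continuous_intros continuous_on_plateau) auto
    have \<kappa>01: "0 \<le> \<kappa> u" "\<kappa> u \<le> 1" for u by (auto simp: \<kappa>_def plateau)
    have \<kappa>1: "\<kappa> u = 1" if "\<bar>u - 1/2\<bar> \<le> \<delta>" for u
      using that \<delta> unfolding \<kappa>_def by (intro plateau) (simp add: field_simps)
    have \<kappa>0: "\<kappa> u = 0" if "2 * \<delta> \<le> \<bar>u - 1/2\<bar>" for u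
      using that \<delta> unfolding \<kappa>_def by (intro plateau) (simp add: field_simps)
    have close: "\<bar>u - 1/2\<bar> < 2 * \<delta>" if "\<kappa> u \<noteq> 0" for u
      using \<kappa>0[of u] that by (meson not_le)
    have supp: "u \<in> {0..1}" "dist u (1/2) < r1" "dist u (1/2) < r2" if "\<kappa> u \<noteq> 0" for u
      using close[OF that] \<delta>' unfolding dist_real_def atLeastAtMost_iff by arith+
    define X where "X = integral {0..1} \<kappa>"
    have "X \<noteq> 0"
    proof
      assume "X = 0"
      then have "\<kappa> (1/2) = 0" using integral_eq_0_iff[of 0 1 \<kappa>] \<kappa> \<kappa>01 by (auto simp: X_def)
      then show False using \<kappa>1[of "1/2"] \<delta> by simp
    qed
    moreover have "X \<ge> 0" unfolding X_def using \<kappa>01 \<kappa> by (intro integral_nonneg integrable_continuous_real) auto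
    ultimately have X: "X > 0" by simp
    have icv: "(\<lambda>u. \<kappa> u * v u) integrable_on {0..1}" and ic: "\<kappa> integrable_on {0..1}"
      by (intro integrable_continuous_real continuous_intros \<kappa> v)+
    have ic': "(\<lambda>u. complex_of_real (\<kappa> u)) integrable_on {0..1}"
      by (intro integrable_continuous_real continuous_intros \<kappa>)
    have X': "integral {0..1} (\<lambda>u. complex_of_real (\<kappa> u)) = of_real X"
      unfolding X_def using integral_linear[OF ic bounded_linear_of_real] by (simp add: o_def)
    define m where "m = integral {0..1} (\<lambda>u. \<kappa> u * v u) / X"
    have "norm (m - v (1/2)) \<le> \<mu> / 4"
    proof -
      have "integral {0..1} (\<lambda>u. \<kappa> u * (v u - v (1/2))) = integral {0..1} (\<lambda>u. \<kappa> u * v u) - X * v (1/2)"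
        unfolding right_diff_distrib using integral_diff[OF icv integrable_on_mult_left[OF ic', of "v (1/2)"]] X' by simp
      also have "\<dots> = X * (m - v (1/2))" using X by (simp add: m_def algebra_simps)
      finally have eq: "X * (m - v (1/2)) = integral {0..1} (\<lambda>u. \<kappa> u * (v u - v (1/2)))" by simp
      have "norm (integral {0..1} (\<lambda>u. \<kappa> u * (v u - v (1/2)))) \<le> integral {0..1} (\<lambda>u. \<kappa> u * (\<mu> / 4))"
      proof (rule integral_norm_bound_integral)
        show "(\<lambda>u. \<kappa> u * (v u - v (1/2))) integrable_on {0..1}"
          by (intro integrable_continuous_real continuous_intros \<kappa> v)
        show "(\<lambda>u. \<kappa> u * (\<mu> / 4)) integrable_on {0..1}"
          by (intro integrable_continuous_real continuous_intros \<kappa>)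
        fix u :: real assume u: "u \<in> {0..1}"
        show "norm (\<kappa> u * (v u - v (1/2))) \<le> \<kappa> u * (\<mu> / 4)"
        proof (cases "\<kappa> u = 0")
          case False
          then have "dist (v u) (v (1/2)) < \<mu> / 4" using r1(2) supp by blast
          then have "\<kappa> u * norm (v u - v (1/2)) \<le> \<kappa> u * (\<mu> / 4)"
            using \<kappa>01[of u] by (intro mult_left_mono) (auto simp: dist_norm)
          then show ?thesis using \<kappa>01[of u] by (simp add: norm_mult)
        qed simp
      qed
      also have "\<dots> = X * (\<mu> / 4)" unfolding X_def using ic by simp
      finally have "norm (X * (m - v (1/2))) \<le> X * (\<mu> / 4)" unfolding eq .
      then show ?thesis using X by (simp add: norm_mult)
    qed
    then have mv: "norm (m - v u) \<le> \<mu> / 2" if "\<kappa> u \<noteq> 0" for u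
    proof -
      have "norm (v u - v (1/2)) < \<mu> / 4" using r1(2) supp[OF that] by (auto simp: dist_norm)
      then show ?thesis
        using norm_diff_triangle_le[of m "v (1/2)" "\<mu> / 4" "v u" "\<mu> / 4"] \<open>norm (m - v (1/2)) \<le> \<mu> / 4\<close>
        by (simp add: norm_minus_commute)
    qed
    define q where "q = (\<lambda>(s::real, u). 1 + s * \<kappa> u * (m / v u - 1))"
    have v0: "v u \<noteq> 0" for u by (simp add: v_def)
    have q: "norm (q (s, u) - 1) \<le> 1/2" if "s \<in> {0..1}" "u \<in> {0..1}" for s u
    proof (cases "\<kappa> u = 0")
      case False
      have "norm (m / v u - 1) = norm (m - v u) / norm (v u)"
        using v0[of u] by (simp add: field_simps flip: norm_divide)
      also have "\<dots> \<le> (\<mu> / 2) / \<mu>" using mv[OF False] \<mu> that(2) by (intro frac_le) auto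
      also have "\<dots> = 1/2" using \<mu> by simp
      finally have "norm (m / v u - 1) \<le> 1/2" .
      moreover have "\<bar>s * \<kappa> u\<bar> \<le> 1" using that \<kappa>01[of u] by (auto simp: abs_mult intro: mult_le_one)
      ultimately have "\<bar>s * \<kappa> u\<bar> * norm (m / v u - 1) \<le> 1 * (1/2)" by (intro mult_mono) auto
      then show ?thesis by (simp add: q_def norm_mult flip: of_real_mult)
    qed (simp add: q_def)
    have Req: "Re (q (s, u)) > 0" if "s \<in> {0..1}" "u \<in> {0..1}" for s u
      using q[OF that] abs_Re_le_cmod[of "q (s, u) - 1"] by (simp add: abs_le_iff)
    have cq: "continuous_on ({0..1} \<times> {0..1}) q" unfolding q_def case_prod_unfold
      using v0 by (auto intro!: continuous_intros continuous_on_compose2[OF \<kappa>] continuous_on_compose2[OF v])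
    \<comment> \<open>Here \<open>v * q\<close> is \<open>v + s \<kappa> (m - v)\<close>, and \<open>q\<close> stays in the right half plane, where \<open>Ln\<close> is continuous.\<close>
    define h where "h = (\<lambda>(s, u). Z u + Ln (q (s, u)))"
    have ch: "continuous_on ({0..1} \<times> {0..1}) h" unfolding h_def case_prod_unfold
    proof (intro continuous_intros)
      show "continuous_on ({0..1::real} \<times> {0..1}) (\<lambda>p. Z (snd p))"
        by (rule continuous_on_compose2[OF Z]) (auto intro!: continuous_intros)
      show "continuous_on ({0..1} \<times> {0..1}) (\<lambda>p. q (fst p, snd p))" using cq by simp
      show "q (fst p, snd p) \<notin> \<real>\<^sub>\<le>\<^sub>0" if "p \<in> {0..1} \<times> {0..1}" for p
        using Req[of "fst p" "snd p"] that by (auto simp: complex_nonpos_Reals_iff)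
    qed
    have exph: "exp (h (s, u)) = v u + s * (m * \<kappa> u - \<kappa> u * v u)" if "s \<in> {0..1}" "u \<in> {0..1}" for s u
    proof -
      have "q (s, u) \<noteq> 0" using Req[OF that] by auto
      then have "exp (h (s, u)) = v u * q (s, u)" by (simp add: h_def exp_add v_def)
      also have "\<dots> = v u + s * (m * \<kappa> u - \<kappa> u * v u)"
        using v0[of u] by (simp add: q_def field_simps)
      finally show ?thesis .
    qed
    have ends: "h (s, 0) = Z 0" "h (s, 1) = Z 1" for s
    proof -
      have "\<kappa> 0 = 0" "\<kappa> 1 = 0" using \<delta>' by (auto intro!: \<kappa>0)
      then show "h (s, 0) = Z 0" "h (s, 1) = Z 1" by (auto simp: h_def q_def)
    qed
    define Z' where "Z' = (\<lambda>u. h (1, u))"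
    have "log_velocity_homotopic \<epsilon> c d Z Z'"
      unfolding log_velocity_homotopic_iff
    proof (intro exI[of _ h] conjI ballI)
      fix s :: real assume s: "s \<in> {0..1}"
      have "integral {0..1} (\<lambda>u. exp (h (s, u))) = integral {0..1} (\<lambda>u. v u + s * (m * \<kappa> u - \<kappa> u * v u))"
        using exph[OF s] by (intro integral_cong) auto
      also have "\<dots> = integral {0..1} v + s * (m * X - X * m)"
      proof -
        have "integral {0..1} (\<lambda>u. \<kappa> u * v u) = X * m" using X by (simp add: m_def)
        moreover have "v integrable_on {0..1}" by (intro integrable_continuous_real v)
        moreover have "(\<lambda>u. m * \<kappa> u - \<kappa> u * v u) integrable_on {0..1}"
          by (intro integrable_continuous_real continuous_intros \<kappa> v)
        ultimately show ?thesis using icv ic' X'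
          by (simp add: integral_add integral_diff integrable_on_mult_right)
      qed
      finally show "log_velocity_ok \<epsilon> c d (\<lambda>u. h (s, u))"
        using ok ends by (simp add: log_velocity_ok_def v_def)
    qed (use ch in \<open>auto simp: Z'_def h_def q_def\<close>)
    moreover have cZ': "continuous_on {0..1} Z'" unfolding Z'_def
      by (rule continuous_on_compose2[OF ch]) (auto intro!: continuous_intros)
    moreover have "Z' u = Z' (1/2)" if u: "\<bar>u - 1/2\<bar> \<le> \<delta>" for u
    proof -
      have eq: "exp (Z' w) = m" if "\<bar>w - 1/2\<bar> \<le> \<delta>" for w
      proof -
        have "\<kappa> w = 1" using \<kappa>1 that by simp
        moreover then have "w \<in> {0..1}" using supp by auto
        ultimately show ?thesis using exph[of 1 w] by (simp add: Z'_def)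
      qed
      have im: "\<bar>Im (Z' w - Z w)\<bar> < pi / 2" if "\<bar>w - 1/2\<bar> \<le> \<delta>" for w
      proof -
        have "\<kappa> w \<noteq> 0" using \<kappa>1 that by simp
        then have "w \<in> {0..1}" using supp by auto
        then have "Re (q (1, w)) > 0" using Req by simp
        then have "\<bar>Im (Ln (q (1, w)))\<bar> < pi / 2" using Re_Ln_pos_lt[of "q (1, w)"]
          by (metis less_irrefl zero_complex.sel(1))
        then show ?thesis by (simp add: Z'_def h_def)
      qed
      have "\<kappa> u \<noteq> 0" using \<kappa>1 u by simp
      then have "dist (Z u) (Z (1/2)) < 1" using r2 supp by blast
      then have "\<bar>Im (Z u - Z (1/2))\<bar> < 1" using abs_Im_le_cmod[of "Z u - Z (1/2)"] by (simp add: dist_norm)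
      moreover have "\<bar>Im (Z' (1/2) - Z (1/2))\<bar> < pi / 2" using im \<delta> by simp
      ultimately have "\<bar>Im (Z' u) - Im (Z' (1/2))\<bar> < 2 * pi" using im[OF u] pi_gt3 unfolding minus_complex.sel by arith
      moreover have "exp (Z' u) = exp (Z' (1/2))" using eq[OF u] eq[of "1/2"] \<delta> by simp
      ultimately show ?thesis by (rule exp_complex_eqI)
    qed
    ultimately show "\<exists>Z'. continuous_on {0..1} Z' \<and> log_velocity_homotopic \<epsilon> c d Z Z' \<and>
        (\<forall>u. \<bar>u - 1/2\<bar> \<le> \<delta> \<longrightarrow> Z' u = Z' (1/2))" by blast
  qed
qed

lemma integral_flip:
  assumes "continuous_on {0..1} f"
  shows "integral {0..1} (\<lambda>u::real. f (1 - u) :: 'a::banach) = integral {0..1} f"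
proof (rule integral_unique)
  have "(f has_integral integral {0..1} f) (cbox 0 1)"
    using assms by (auto intro: integrable_integral integrable_continuous_real)
  from has_integral_affinity[OF this, of "-1" 1]
  show "((\<lambda>u. f (1 - u)) has_integral integral {0..1} f) {0..1}"
    by (simp add: image_affinity_atLeastAtMost)
qed

context wiggle
begin

text \<open>Adding this to the logarithm of a velocity turns it by \<open>s * \<phi>\<close> and multiplies the speed by a factor that
grows with \<open>c0\<close>, \<open>c1\<close>, \<open>c2\<close> on the three bumps.\<close>

definition wiggle_log :: "real \<Rightarrow> real \<Rightarrow> real \<Rightarrow> real \<Rightarrow> real \<Rightarrow> complex" where
  "wiggle_log s c0 c1 c2 u = \<i> * (s * \<phi> u) + ln (1 + (c0 * e0 u + c1 * e1 u + c2 * e2 u))"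

lemma continuous_on_profiles [continuous_intros]:
  "continuous_on X f \<Longrightarrow> continuous_on X (\<lambda>x. \<phi> (f x))"
  "continuous_on X f \<Longrightarrow> continuous_on X (\<lambda>x. e0 (f x))"
  "continuous_on X f \<Longrightarrow> continuous_on X (\<lambda>x. e1 (f x))"
  "continuous_on X f \<Longrightarrow> continuous_on X (\<lambda>x. e2 (f x))"
  using \<phi> e by (auto intro: continuous_on_compose2)

lemma factor_pos:
  assumes "0 \<le> c0" "0 \<le> c1" "0 \<le> c2"
  shows "0 < 1 + (c0 * e0 u + c1 * e1 u + c2 * e2 u)"
  using assms e_nonneg by (intro add_pos_nonneg add_nonneg_nonneg mult_nonneg_nonneg) auto

lemma wiggle_log_ends: "wiggle_log s c0 c1 c2 0 = 0" "wiggle_log s c0 c1 c2 1 = 0"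
  using supp[of 0] supp[of 1] \<delta> by (auto simp: wiggle_log_def)

lemma wiggle_log_zero: "wiggle_log 0 0 0 0 u = 0"
  by (simp add: wiggle_log_def)

lemma continuous_on_wiggle_log:
  assumes "continuous_on X s" "continuous_on X c0" "continuous_on X c1" "continuous_on X c2" "continuous_on X f"
    and "\<And>x. x \<in> X \<Longrightarrow> 0 \<le> c0 x" "\<And>x. x \<in> X \<Longrightarrow> 0 \<le> c1 x" "\<And>x. x \<in> X \<Longrightarrow> 0 \<le> c2 x"
  shows "continuous_on X (\<lambda>x. wiggle_log (s x) (c0 x) (c1 x) (c2 x) (f x))"
  unfolding wiggle_log_def
proof (intro continuous_intros assms(1-5) ballI)
  fix x assume "x \<in> X"
  then show "1 + (c0 x * e0 (f x) + c1 x * e1 (f x) + c2 x * e2 (f x)) \<noteq> 0"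
    using factor_pos[of "c0 x" "c1 x" "c2 x" "f x"] assms(6-8) by auto
qed

text \<open>The displacement lost by turning through the angle \<open>s * \<phi>\<close>, relative to the constant velocity near \<open>1/2\<close>.\<close>

definition cos_defect :: "real \<Rightarrow> real" where
  "cos_defect s = 1 - integral {0..1} (\<lambda>u. cos (s * \<phi> u))"

lemma cos_defect_nonneg: "0 \<le> cos_defect s"
proof -
  have "integral {0..1} (\<lambda>u. cos (s * \<phi> u)) \<le> integral {0..1} (\<lambda>u::real. 1)"
    by (intro integral_le integrable_continuous_real continuous_intros) auto
  then show ?thesis by (simp add: cos_defect_def)
qed

lemma cos_defect_zero: "cos_defect 0 = 0"
  by (simp add: cos_defect_def)

lemma continuous_on_cos_defect: "continuous_on X cos_defect"
proof -
  have "continuous_on UNIV (\<lambda>s. integral (cbox 0 1) (\<lambda>u. cos (s * \<phi> u)))"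
    by (rule integral_continuous_on_param) (auto simp: case_prod_unfold intro!: continuous_intros)
  then have "continuous_on UNIV cos_defect" unfolding cos_defect_def by (intro continuous_intros) simp
  then show ?thesis by (rule continuous_on_subset) auto
qed

lemma integral_cis: "integral {0..1} (\<lambda>u. cis (s * \<phi> u)) = of_real (1 - cos_defect s)"
proof -
  have int: "(\<lambda>u. cis (s * \<phi> u)) integrable_on {0..1}"
    by (intro integrable_continuous_real continuous_intros)
  have "integral {0..1} (\<lambda>u. sin (s * \<phi> u)) = integral {0..1} (\<lambda>u. sin (s * \<phi> (1 - u)))"
    by (rule integral_flip[symmetric]) (intro continuous_intros)
  also have "\<dots> = - integral {0..1} (\<lambda>u. sin (s * \<phi> u))"
    by (simp add: odd)
  finally have "integral {0..1} (\<lambda>u. sin (s * \<phi> u)) = 0" by simp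
  moreover have "Im (integral {0..1} (\<lambda>u. cis (s * \<phi> u))) = integral {0..1} (\<lambda>u. sin (s * \<phi> u))"
    using integral_linear[OF int bounded_linear_Im] by (simp add: o_def)
  moreover have "Re (integral {0..1} (\<lambda>u. cis (s * \<phi> u))) = 1 - cos_defect s"
    using integral_linear[OF int bounded_linear_Re] by (simp add: o_def cos_defect_def)
  ultimately show ?thesis by (simp add: complex_eq_iff)
qed

lemma exp_wiggle_log:
  assumes "0 \<le> c0" "0 \<le> c1" "0 \<le> c2" and s: "s = 1 \<or> c1 = 0 \<and> c2 = 0"
  shows "exp (wiggle_log s c0 c1 c2 u) =
     cis (s * \<phi> u) + (c0 * e0 u + c1 * cis (2 * pi / 3) * e1 u + c2 * cis (- (2 * pi / 3)) * e2 u)"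
proof -
  have E: "exp (wiggle_log s c0 c1 c2 u) = cis (s * \<phi> u) * of_real (1 + (c0 * e0 u + c1 * e1 u + c2 * e2 u))"
  proof -
    have "exp (complex_of_real (ln (1 + (c0 * e0 u + c1 * e1 u + c2 * e2 u)))) =
        of_real (1 + (c0 * e0 u + c1 * e1 u + c2 * e2 u))"
      using factor_pos[OF assms(1-3), of u] by (metis exp_ln exp_of_real)
    then show ?thesis unfolding wiggle_log_def exp_add by (simp add: cis_conv_exp)
  qed
  have w: "e1 u \<noteq> 0 \<Longrightarrow> c1 \<noteq> 0 \<Longrightarrow> cis (s * \<phi> u) = cis (2 * pi / 3)"
    "e2 u \<noteq> 0 \<Longrightarrow> c2 \<noteq> 0 \<Longrightarrow> cis (s * \<phi> u) = cis (- (2 * pi / 3))"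
    using on_e(2,3)[of u] s by (metis mult_1)+
  have A: "cis (s * \<phi> u) * (c0 * e0 u) = c0 * e0 u" using on_e(1)[of u] by (cases "e0 u = 0") simp_all
  have B: "cis (s * \<phi> u) * (c1 * e1 u) = c1 * cis (2 * pi / 3) * e1 u" using w(1) by (cases "e1 u = 0 \<or> c1 = 0") (elim disjE, simp_all)
  have C: "cis (s * \<phi> u) * (c2 * e2 u) = c2 * cis (- (2 * pi / 3)) * e2 u" using w(2) by (cases "e2 u = 0 \<or> c2 = 0") (elim disjE, simp_all)
  show ?thesis
    using A B C by (simp only: E of_real_mult of_real_add of_real_1 distrib_left mult_1_right)
qed

text \<open>On the bump \<open>e1\<close> the turned velocity has a constant direction as soon as \<open>s = 1\<close>, and likewise on \<open>e2\<close>;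
on \<open>e0\<close> this is so for every \<open>s\<close>. Hence the displacement is an affine function of the coefficients.\<close>

lemma integral_exp_wiggle_log:
  assumes Z: "continuous_on {0..1} Z" and flat: "\<And>u. \<bar>u - 1/2\<bar> \<le> \<delta> \<Longrightarrow> Z u = Z (1/2)"
    and c: "0 \<le> c0" "0 \<le> c1" "0 \<le> c2" and s: "s = 1 \<or> c1 = 0 \<and> c2 = 0"
  shows "integral {0..1} (\<lambda>u. exp (Z u + wiggle_log s c0 c1 c2 u)) =
     integral {0..1} (\<lambda>u. exp (Z u)) +
       exp (Z (1/2)) * (c0 - cos_defect s + c1 * cis (2 * pi / 3) + c2 * cis (- (2 * pi / 3)))"
proof -
  define w where "w = cis (2 * pi / 3)"
  define w' where "w' = cis (- (2 * pi / 3))"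
  define m where "m = exp (Z (1/2))"
  have eq: "exp (Z u + wiggle_log s c0 c1 c2 u) =
      exp (Z u) + m * ((cis (s * \<phi> u) - 1) + (c0 * e0 u + c1 * w * e1 u + c2 * w' * e2 u))" for u
  proof (cases "\<bar>u - 1/2\<bar> \<le> \<delta>")
    case True
    then have "exp (Z u) = m" using flat[of u] unfolding m_def by metis
    from this have "exp (Z u + wiggle_log s c0 c1 c2 u) = m * (cis (s * \<phi> u) + (c0 * e0 u + c1 * w * e1 u + c2 * w' * e2 u))"
      unfolding exp_add exp_wiggle_log[OF c s] by (simp only: w_def w'_def)
    also have "\<dots> = m + m * ((cis (s * \<phi> u) - 1) + (c0 * e0 u + c1 * w * e1 u + c2 * w' * e2 u))"
      by (simp add: algebra_simps)
    finally show ?thesis unfolding \<open>exp (Z u) = m\<close> .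
  next
    case False
    then have "\<phi> u = 0 \<and> e0 u = 0 \<and> e1 u = 0 \<and> e2 u = 0" using supp by auto
    then show ?thesis by (simp add: wiggle_log_def)
  qed
  have I: "((\<lambda>u. f u) has_integral integral {0..1} f) {0..1}" if "continuous_on {0..1} f"
    for f :: "real \<Rightarrow> complex" using that by (intro integrable_integral integrable_continuous_real)
  have J: "((\<lambda>u. complex_of_real (f u)) has_integral 1) {0..1}"
    if "continuous_on {0..1} f" "integral {0..1} f = 1" for f :: "real \<Rightarrow> real"
  proof -
    have "(f has_integral 1) {0..1}"
      using that by (metis integrable_integral integrable_continuous_real)
    then show ?thesis using has_integral_linear[OF _ bounded_linear_of_real, of f 1] by (simp add: o_def)
  qed
  have hI: "((\<lambda>u. exp (Z u) + m * ((cis (s * \<phi> u) - 1) + (c0 * e0 u + c1 * w * e1 u + c2 * w' * e2 u)))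
    has_integral integral {0..1} (\<lambda>u. exp (Z u)) +
       m * ((of_real (1 - cos_defect s) - 1 * (1 - 0)) + (complex_of_real c0 * 1 + c1 * w * 1 + c2 * w' * 1))) {0..1}"
  proof -
    have h: "((\<lambda>u. exp (Z u)) has_integral integral {0..1} (\<lambda>u. exp (Z u))) {0..1}"
      by (rule I) (intro continuous_intros Z)
    have hc: "((\<lambda>u. cis (s * \<phi> u)) has_integral complex_of_real (1 - cos_defect s)) {0..1}"
      unfolding integral_cis[symmetric] by (rule I) (intro continuous_intros)
    have h1: "((\<lambda>u. 1) has_integral 1 * (1 - 0 :: complex)) {0..1::real}"
      using has_integral_const_real[of "1::complex" 0 1] by simp
    have ce: "continuous_on {0..1} e0" "continuous_on {0..1} e1" "continuous_on {0..1} e2"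
      using e by (auto intro: continuous_on_subset)
    note J0 = J[OF ce(1) int_e(1)] and J1 = J[OF ce(2) int_e(2)] and J2 = J[OF ce(3) int_e(3)]
    show ?thesis unfolding of_real_mult
      by (rule has_integral_add[OF h has_integral_mult_right[OF has_integral_add[OF has_integral_diff[OF hc h1]
          has_integral_add[OF has_integral_add[OF has_integral_mult_right[OF J0] has_integral_mult_right[OF J1]]
            has_integral_mult_right[OF J2]]]]])
  qed
  then have "integral {0..1} (\<lambda>u. exp (Z u + wiggle_log s c0 c1 c2 u)) = integral {0..1} (\<lambda>u. exp (Z u)) +
       m * ((of_real (1 - cos_defect s) - 1 * (1 - 0)) + (complex_of_real c0 * 1 + c1 * w * 1 + c2 * w' * 1))"
    unfolding eq by (rule integral_unique)
  then show ?thesis by (simp add: m_def w_def w'_def)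
qed

text \<open>The amplitude \<open>s\<close> of the wiggle grows from 0 to 1 while the bump \<open>e0\<close> makes up for the lost displacement.\<close>

lemma wiggle_homotopic:
  assumes Z: "continuous_on {0..1} Z" and flat: "\<And>u. \<bar>u - 1/2\<bar> \<le> \<delta> \<Longrightarrow> Z u = Z (1/2)"
    and ok: "log_velocity_ok \<epsilon> c d Z"
  shows "log_velocity_homotopic \<epsilon> c d Z (\<lambda>u. Z u + wiggle_log 1 (cos_defect 1) 0 0 u)"
  unfolding log_velocity_homotopic_iff
proof (intro exI[of _ "\<lambda>(s, u). Z u + wiggle_log s (cos_defect s) 0 0 u"] conjI ballI)
  show "continuous_on ({0..1} \<times> {0..1}) (\<lambda>(s, u). Z u + wiggle_log s (cos_defect s) 0 0 u)"
    unfolding case_prod_unfold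
    by (intro continuous_on_add continuous_on_wiggle_log continuous_on_compose2[OF Z]
        continuous_on_compose2[OF continuous_on_cos_defect[of UNIV]] continuous_intros cos_defect_nonneg) auto
  fix s :: real assume "s \<in> {0..1}"
  show "log_velocity_ok \<epsilon> c d (\<lambda>u. case (s, u) of (s, u) \<Rightarrow> Z u + wiggle_log s (cos_defect s) 0 0 u)"
    using ok integral_exp_wiggle_log[OF Z flat cos_defect_nonneg order_refl order_refl, of s s]
    by (simp add: log_velocity_ok_def wiggle_log_ends)
qed (auto simp: wiggle_log_zero cos_defect_zero)

text \<open>For \<open>\<alpha>\<close> among \<open>0\<close>, \<open>2\<pi>/3\<close>, \<open>-2\<pi>/3\<close> these are coefficients that write \<open>k\<close> as a combination of the three cube roots
of unity. Without the term \<open>norm k\<close> they could be negative; it cancels as the sum of the roots is 0.\<close>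

definition cone_coeff :: "real \<Rightarrow> complex \<Rightarrow> real" where
  "cone_coeff \<alpha> k = 2/3 * (norm k + Re (k * cnj (cis \<alpha>)))"

lemma cone_coeff_nonneg: "0 \<le> cone_coeff \<alpha> k"
  using abs_Re_le_cmod[of "k * cnj (cis \<alpha>)"] by (simp add: cone_coeff_def norm_mult abs_le_iff)

lemma cone_coeff_sum:
  "cone_coeff 0 k + cone_coeff (2 * pi / 3) k * cis (2 * pi / 3) + cone_coeff (- (2 * pi / 3)) k * cis (- (2 * pi / 3)) = k"
proof -
  have "sqrt 3 * (sqrt 3 * x) = 3 * x" for x :: real
    by (simp flip: mult.assoc)
  then show ?thesis
    by (simp add: cone_coeff_def complex_eq_iff cos_120' sin_120' algebra_simps) (simp add: field_simps)
qed

text \<open>The error of the displacement at time \<open>t\<close> is \<open>exp (Zt t (1/2)) * k t\<close>. It is corrected by the three bumps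
with the coefficients \<open>cone_coeff\<close>, which vanish at \<open>t = 0\<close> and \<open>t = 1\<close>.\<close>

lemma interpolate_homotopic:
  assumes Z1: "continuous_on {0..1} Z1" and flat1: "\<And>u. \<bar>u - 1/2\<bar> \<le> \<delta> \<Longrightarrow> Z1 u = Z1 (1/2)"
    and ok1: "log_velocity_ok \<epsilon> c d Z1"
    and Z2: "continuous_on {0..1} Z2" and flat2: "\<And>u. \<bar>u - 1/2\<bar> \<le> \<delta> \<Longrightarrow> Z2 u = Z2 (1/2)"
    and ok2: "log_velocity_ok \<epsilon> c d Z2"
  shows "log_velocity_homotopic \<epsilon> c d (\<lambda>u. Z1 u + wiggle_log 1 (cos_defect 1) 0 0 u) (\<lambda>u. Z2 u + wiggle_log 1 (cos_defect 1) 0 0 u)"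
proof -
  define Zt where "Zt = (\<lambda>t::real. \<lambda>u. (1 - t) * Z1 u + t * Z2 u)"
  \<comment> \<open>The missing displacement, measured in units of the velocity at \<open>1/2\<close>.\<close>
  define k where "k = (\<lambda>t. (d - integral {0..1} (\<lambda>u. exp (Zt t u))) / exp (Zt t (1/2)))"
  define h where "h = (\<lambda>(t, u). Zt t u +
     wiggle_log 1 (cos_defect 1 + cone_coeff 0 (k t)) (cone_coeff (2 * pi / 3) (k t)) (cone_coeff (- (2 * pi / 3)) (k t)) u)"
  have cZ: "continuous_on ({0..1} \<times> {0..1}) (\<lambda>(t, u). Zt t u)" unfolding Zt_def case_prod_unfold
    by (intro continuous_intros continuous_on_compose2[OF Z1] continuous_on_compose2[OF Z2]) auto
  have "continuous_on {0..1} (\<lambda>t. integral (cbox 0 1) (\<lambda>u. exp (Zt t u)))"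
    by (rule integral_continuous_on_param) (use cZ in \<open>auto simp: case_prod_unfold intro!: continuous_intros\<close>)
  then have ck: "continuous_on {0..1} k"
    unfolding k_def by (intro continuous_intros) (auto simp: Zt_def intro!: continuous_intros)
  have cth: "continuous_on ({0..1} \<times> {0..1}) (\<lambda>p::real \<times> real. cone_coeff \<alpha> (k (fst p)))" for \<alpha>
    unfolding cone_coeff_def by (intro continuous_intros continuous_on_compose2[OF ck]) auto
  have k0: "k 0 = 0" "k 1 = 0" using ok1 ok2 by (auto simp: k_def Zt_def log_velocity_ok_def)
  have th0: "cone_coeff \<alpha> 0 = 0" for \<alpha> by (simp add: cone_coeff_def)
  show ?thesis unfolding log_velocity_homotopic_iff
  proof (intro exI[of _ h] conjI ballI)
    show "continuous_on ({0..1} \<times> {0..1}) h" unfolding h_def case_prod_unfold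
      by (intro continuous_on_add continuous_on_wiggle_log continuous_on_const cth cZ[unfolded case_prod_unfold]
          continuous_intros add_nonneg_nonneg cos_defect_nonneg cone_coeff_nonneg)
    show "h (0, u) = Z1 u + wiggle_log 1 (cos_defect 1) 0 0 u" "h (1, u) = Z2 u + wiggle_log 1 (cos_defect 1) 0 0 u" for u
      by (auto simp: h_def k0 th0 Zt_def)
    fix t :: real assume t: "t \<in> {0..1}"
    have ct: "continuous_on {0..1} (Zt t)" unfolding Zt_def by (intro continuous_intros Z1 Z2)
    have flat: "Zt t u = Zt t (1/2)" if "\<bar>u - 1/2\<bar> \<le> \<delta>" for u
      using flat1[OF that] flat2[OF that] by (simp add: Zt_def)
    have "integral {0..1} (\<lambda>u. exp (h (t, u))) =
      integral {0..1} (\<lambda>u. exp (Zt t u)) + exp (Zt t (1/2)) * (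
        (cos_defect 1 + cone_coeff 0 (k t)) - cos_defect 1 + cone_coeff (2 * pi / 3) (k t) * cis (2 * pi / 3) +
        cone_coeff (- (2 * pi / 3)) (k t) * cis (- (2 * pi / 3)))"
      unfolding h_def prod.case
      by (subst integral_exp_wiggle_log[OF ct flat]) (auto simp: cos_defect_nonneg cone_coeff_nonneg)
    also have "\<dots> = integral {0..1} (\<lambda>u. exp (Zt t u)) + exp (Zt t (1/2)) * k t"
      using cone_coeff_sum[of "k t"] by simp
    also have "\<dots> = d" by (simp add: k_def)
    finally have "integral {0..1} (\<lambda>u. exp (h (t, u))) = d" .
    moreover have "Im (h (t, 1)) - \<epsilon> * Im (h (t, 0)) = (1 - t) * (Im (Z1 1) - \<epsilon> * Im (Z1 0)) + t * (Im (Z2 1) - \<epsilon> * Im (Z2 0))"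
      by (simp add: h_def wiggle_log_ends Zt_def algebra_simps)
    then have "Im (h (t, 1)) - \<epsilon> * Im (h (t, 0)) = c"
      using ok1 ok2 by (simp add: log_velocity_ok_def algebra_simps)
    ultimately show "log_velocity_ok \<epsilon> c d (\<lambda>u. h (t, u))" by (simp add: log_velocity_ok_def)
  qed
qed

end

text \<open>Flatten both logarithms on the same interval around \<open>1/2\<close>, put the same wiggle into both, and interpolate.\<close>

theorem log_velocities_homotopic:
  assumes Z1: "continuous_on {0..1} Z1" and ok1: "log_velocity_ok \<epsilon> c d Z1"
    and Z2: "continuous_on {0..1} Z2" and ok2: "log_velocity_ok \<epsilon> c d Z2"
  shows "log_velocity_homotopic \<epsilon> c d Z1 Z2"
proof -
  obtain \<delta>1 where \<delta>1: "0 < \<delta>1" "\<delta>1 < 1/4"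
    "\<And>\<delta>. 0 < \<delta> \<Longrightarrow> \<delta> \<le> \<delta>1 \<Longrightarrow> \<exists>Z'. continuous_on {0..1} Z' \<and> log_velocity_homotopic \<epsilon> c d Z1 Z' \<and>
        (\<forall>u. \<bar>u - 1/2\<bar> \<le> \<delta> \<longrightarrow> Z' u = Z' (1/2))"
    using log_flatten[OF Z1 ok1] by blast
  obtain \<delta>2 where \<delta>2: "0 < \<delta>2" "\<delta>2 < 1/4"
    "\<And>\<delta>. 0 < \<delta> \<Longrightarrow> \<delta> \<le> \<delta>2 \<Longrightarrow> \<exists>Z'. continuous_on {0..1} Z' \<and> log_velocity_homotopic \<epsilon> c d Z2 Z' \<and>
        (\<forall>u. \<bar>u - 1/2\<bar> \<le> \<delta> \<longrightarrow> Z' u = Z' (1/2))"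
    using log_flatten[OF Z2 ok2] by blast
  define \<delta> where "\<delta> = min \<delta>1 \<delta>2"
  have \<delta>: "0 < \<delta>" "\<delta> < 1/2" "\<delta> \<le> \<delta>1" "\<delta> \<le> \<delta>2" using \<delta>1 \<delta>2 by (auto simp: \<delta>_def)
  obtain Y1 where Y1: "continuous_on {0..1} Y1" "log_velocity_homotopic \<epsilon> c d Z1 Y1"
    "\<And>u. \<bar>u - 1/2\<bar> \<le> \<delta> \<Longrightarrow> Y1 u = Y1 (1/2)" using \<delta>1(3)[OF \<delta>(1,3)] by blast
  obtain Y2 where Y2: "continuous_on {0..1} Y2" "log_velocity_homotopic \<epsilon> c d Z2 Y2"
    "\<And>u. \<bar>u - 1/2\<bar> \<le> \<delta> \<Longrightarrow> Y2 u = Y2 (1/2)" using \<delta>2(3)[OF \<delta>(1,4)] by blast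
  have okY: "log_velocity_ok \<epsilon> c d Y1" "log_velocity_ok \<epsilon> c d Y2"
    using homotopic_with_imp_property[OF Y1(2)] homotopic_with_imp_property[OF Y2(2)] by auto
  obtain \<phi> e0 e1 e2 where "wiggle \<delta> \<phi> e0 e1 e2"
    using wiggle_exists[OF \<delta>(1,2)] .
  then interpret wiggle \<delta> \<phi> e0 e1 e2 .
  have "log_velocity_homotopic \<epsilon> c d Z1 (\<lambda>u. Y1 u + wiggle_log 1 (cos_defect 1) 0 0 u)"
    by (rule homotopic_with_trans[OF Y1(2) wiggle_homotopic[OF Y1(1,3) okY(1)]])
  moreover have "log_velocity_homotopic \<epsilon> c d Z2 (\<lambda>u. Y2 u + wiggle_log 1 (cos_defect 1) 0 0 u)"
    by (rule homotopic_with_trans[OF Y2(2) wiggle_homotopic[OF Y2(1,3) okY(2)]])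
  moreover have "log_velocity_homotopic \<epsilon> c d (\<lambda>u. Y1 u + wiggle_log 1 (cos_defect 1) 0 0 u) (\<lambda>u. Y2 u + wiggle_log 1 (cos_defect 1) 0 0 u)"
    by (rule interpolate_homotopic[OF Y1(1,3) okY(1) Y2(1,3) okY(2)])
  ultimately show ?thesis
    by (meson homotopic_with_trans homotopic_with_sym)
qed

text \<open>Continuity is a local property, also with respect to relatively open pieces of a set that is not open.\<close>

lemma continuous_on_locally:
  fixes f :: "'a::t2_space \<Rightarrow> 'b::topological_space"
  assumes "\<And>y. y \<in> X \<Longrightarrow> \<exists>Y. openin (top_of_set X) Y \<and> y \<in> Y \<and> continuous_on Y f"
  shows "continuous_on X f"
  unfolding continuous_on_eq_continuous_within
proof
  fix y assume "y \<in> X"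
  then obtain Y where Y: "openin (top_of_set X) Y" "y \<in> Y" "continuous_on Y f" using assms by blast
  then obtain W where W: "open W" "Y = X \<inter> W" by (auto simp: openin_open)
  have "at y within X = at y within Y"
    using W Y(2) by (intro at_within_nhd[of y W]) auto
  then show "continuous (at y within X) f"
    using Y by (simp add: continuous_on_eq_continuous_within)
qed

section \<open>Linear maps of the plane\<close>

lemma linear_complex:
  fixes L :: "complex \<Rightarrow> complex"
  assumes "linear L"
  shows "L v = Re v *\<^sub>R L 1 + Im v *\<^sub>R L \<i>"
proof -
  have "L (Re v *\<^sub>R 1 + Im v *\<^sub>R \<i>) = Re v *\<^sub>R L 1 + Im v *\<^sub>R L \<i>"
    using assms by (simp add: linear_add linear_cmul)
  moreover have "Re v *\<^sub>R 1 + Im v *\<^sub>R \<i> = v" by (simp add: complex_eq_iff)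
  ultimately show ?thesis by simp
qed

text \<open>If the determinant vanishes, the rows of the cofactor matrix are vectors in the kernel.\<close>

lemma plane_det_nonzero:
  assumes L: "linear L" "inj L"
  shows "plane_det L \<noteq> 0"
proof
  assume det: "plane_det L = 0"
  define A B where "A = L 1" and "B = L \<i>"
  have L': "L (Complex x y) = x *\<^sub>R A + y *\<^sub>R B" for x y
    using linear_complex[OF L(1), of "Complex x y"] by (simp add: A_def B_def)
  have z: "v = 0" if "L v = 0" for v using that L linear_injective_0 by blast
  have d: "Re A * Im B = Im A * Re B" using det by (simp add: plane_det_def A_def B_def)
  have "Complex (Re B) (- Re A) = 0" by (rule z) (use d in \<open>simp add: L' complex_eq_iff algebra_simps\<close>)
  moreover have "Complex (Im B) (- Im A) = 0" by (rule z) (use d in \<open>simp add: L' complex_eq_iff algebra_simps\<close>)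
  ultimately have "A = 0" by (simp add: complex_eq_iff)
  then show False using z[of 1] by (simp add: A_def)
qed

text \<open>Cramer's rule.\<close>

lemma linear_complex_solve:
  assumes L: "linear L" "plane_det L \<noteq> 0"
  shows "v = Complex ((Re (L v) * Im (L \<i>) - Im (L v) * Re (L \<i>)) / plane_det L)
                     ((Re (L 1) * Im (L v) - Im (L 1) * Re (L v)) / plane_det L)"
proof -
  have "Re (L v) = Re v * Re (L 1) + Im v * Re (L \<i>)" "Im (L v) = Re v * Im (L 1) + Im v * Im (L \<i>)"
    using linear_complex[OF L(1), of v] by simp_all
  then have "Re (L v) * Im (L \<i>) - Im (L v) * Re (L \<i>) = Re v * plane_det L"
     "Re (L 1) * Im (L v) - Im (L 1) * Re (L v) = Im v * plane_det L"
    by (auto simp: plane_det_def algebra_simps)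
  then show ?thesis using L(2) by (simp add: complex_eq_iff)
qed

text \<open>The images of \<open>1\<close> and \<open>\<i>\<close> have the same length, and they are orthogonal because \<open>1 + \<i>\<close> is also stretched
by \<open>k\<close>. So the second is \<open>\<i>\<close> or \<open>-\<i>\<close> times the first.\<close>

lemma similarity_cases:
  assumes L: "linear L" and k: "k > 0" and n: "\<And>v. norm (L v) = k * norm v"
  obtains (direct) \<alpha> where "\<alpha> \<noteq> 0" "\<And>v. L v = \<alpha> * v" "plane_det L > 0"
    | (opposite) \<alpha> where "\<alpha> \<noteq> 0" "\<And>v. L v = \<alpha> * cnj v" "plane_det L < 0"
proof -
  define A B where "A = L 1" and "B = L \<i>"
  have A: "(Re A)\<^sup>2 + (Im A)\<^sup>2 = k\<^sup>2" using n[of 1] by (metis A_def cmod_power2 mult.right_neutral norm_one)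
  have B: "(Re B)\<^sup>2 + (Im B)\<^sup>2 = k\<^sup>2" using n[of \<i>] by (metis B_def cmod_power2 mult.right_neutral norm_ii)
  have AB: "(Re A + Re B)\<^sup>2 + (Im A + Im B)\<^sup>2 = 2 * k\<^sup>2"
  proof -
    have "L (1 + \<i>) = A + B" using L by (simp add: A_def B_def linear_add)
    then have "norm (A + B) = k * sqrt 2" using n[of "1 + \<i>"] by (simp add: cmod_def)
    then have "(norm (A + B))\<^sup>2 = 2 * k\<^sup>2" by (simp add: power_mult_distrib)
    then show ?thesis by (simp add: cmod_power2)
  qed
  have orth: "Re A * Re B + Im A * Im B = 0"
    using A B AB by (simp add: power2_eq_square algebra_simps)
  have k2: "k\<^sup>2 > 0" using k by simp
  have A0: "A \<noteq> 0" using A k2 by auto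
  \<comment> \<open>B is a multiple of i A since it is orthogonal to A\<close>
  define t where "t = (Re A * Im B - Im A * Re B) / k\<^sup>2"
  have B1: "Re B = - t * Im A"
  proof -
    have *: "k\<^sup>2 * Re B = - (Re A * Im B - Im A * Re B) * Im A + Re A * (Re A * Re B + Im A * Im B)"
      unfolding A[symmetric] by (simp add: power2_eq_square algebra_simps)
    show ?thesis using *[unfolded orth] k2 by (simp add: t_def field_simps)
  qed
  have B2: "Im B = t * Re A"
  proof -
    have *: "k\<^sup>2 * Im B = (Re A * Im B - Im A * Re B) * Re A + Im A * (Re A * Re B + Im A * Im B)"
      unfolding A[symmetric] by (simp add: power2_eq_square algebra_simps)
    show ?thesis using *[unfolded orth] k2 by (simp add: t_def field_simps)
  qed
  have "t\<^sup>2 * k\<^sup>2 = k\<^sup>2" using A B unfolding B1 B2 by (simp add: power2_eq_square algebra_simps flip: distrib_left)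
  then have "t\<^sup>2 = 1" using k2 by simp
  then consider "t = 1" | "t = -1" by (auto simp: power2_eq_1_iff)
  then show ?thesis
  proof cases
    case 1
    have "plane_det L = k\<^sup>2" unfolding A[symmetric] plane_det_def A_def[symmetric] B_def[symmetric] B1 B2 1
      by (simp add: power2_eq_square)
    moreover have "L v = A * v" for v
      unfolding linear_complex[OF L, of v] A_def[symmetric] B_def[symmetric]
      by (simp add: complex_eq_iff B1 B2 1 algebra_simps)
    ultimately show ?thesis using direct[of A] A0 k2 by simp
  next
    case 2
    have "plane_det L = - k\<^sup>2" unfolding A[symmetric] plane_det_def A_def[symmetric] B_def[symmetric] B1 B2 2
      by (simp add: power2_eq_square)
    moreover have "L v = A * cnj v" for v
      unfolding linear_complex[OF L, of v] A_def[symmetric] B_def[symmetric]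
      by (simp add: complex_eq_iff B1 B2 2 algebra_simps)
    ultimately show ?thesis using opposite[of A] A0 k2 by simp
  qed
qed

text \<open>A continuous map inherits differentiability from its composition with a map whose derivative is
invertible. Lifts of curves and deck transformations are continuous by construction, and this lemma makes
them differentiable.\<close>

lemma has_derivative_cancel_left:
  fixes F :: "'b::euclidean_space \<Rightarrow> 'b" and l :: "'a::real_normed_vector \<Rightarrow> 'b"
  assumes F: "(F has_derivative L) (at (l x))" and L: "bij L"
    and l: "continuous (at x within s) l"
    and M: "((\<lambda>y. F (l y)) has_derivative M) (at x within s)"
  shows "(l has_derivative (\<lambda>v. inv L (M v))) (at x within s)"
proof -
  have linL: "linear L" using F has_derivative_linear by blast
  have linI: "linear (inv L)"
  proof (rule linearI)
    have fi: "L (inv L x) = x" for x using L by (simp add: bij_is_surj surj_f_inv_f)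
    have uniq: "inv L x = y" if "L y = x" for x y using that L by (auto simp: bij_is_inj)
    show "inv L (x + y) = inv L x + inv L y" for x y
      by (rule uniq) (simp add: linear_add[OF linL] fi)
    show "inv L (c *\<^sub>R x) = c *\<^sub>R inv L x" for c x
      by (rule uniq) (simp add: linear_cmul[OF linL] fi)
  qed
  have bI: "bounded_linear (inv L)" using linI linear_conv_bounded_linear by blast
  obtain C where C: "C > 0" "\<And>v. norm (inv L v) \<le> norm v * C"
    using bounded_linear.pos_bounded[OF bI] by blast
  have bM: "bounded_linear M" using M has_derivative_bounded_linear by blast
  obtain D where D: "D > 0" "\<And>v. norm (M v) \<le> norm v * D"
    using bounded_linear.pos_bounded[OF bM] by blast
  have iL: "inv L (L v) = v" for v using L by (simp add: bij_is_inj)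
  show ?thesis unfolding has_derivative_within_alt
  proof (intro conjI allI impI)
    show "bounded_linear (\<lambda>v. inv L (M v))" using bounded_linear_compose[OF bI bM] .
    fix e :: real assume e: "e > 0"
    \<comment> \<open>With this bound on both error terms, \<open>l\<close> first turns out to be Lipschitz at \<open>x\<close> with constant \<open>4 * C * D\<close>.\<close>
    define q where "q = min (1 / (2 * C)) (min D (e / (C * (4 * C * D + 1))))"
    have q: "q > 0" "C * q \<le> 1 / 2" "q \<le> D" "q * (C * (4 * C * D + 1)) \<le> e"
    proof -
      show "q > 0" using C D e by (auto simp: q_def intro!: divide_pos_pos mult_pos_pos add_pos_pos)
      have "q \<le> 1 / (2 * C)" by (simp add: q_def)
      then show "C * q \<le> 1 / 2" using C by (simp add: field_simps)
      show "q \<le> D" by (simp add: q_def)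
      have "q \<le> e / (C * (4 * C * D + 1))" by (simp add: q_def)
      moreover have "C * (4 * C * D + 1) > 0" using C D by (intro mult_pos_pos add_pos_pos) auto
      ultimately show "q * (C * (4 * C * D + 1)) \<le> e" by (simp add: pos_le_divide_eq)
    qed
    obtain r where r: "r > 0" "\<And>z. norm (z - l x) < r \<Longrightarrow> norm (F z - F (l x) - L (z - l x)) \<le> q * norm (z - l x)"
      using F q(1) unfolding has_derivative_at_alt by blast
    obtain d1 where d1: "d1 > 0" "\<And>y. y \<in> s \<Longrightarrow> norm (y - x) < d1 \<Longrightarrow> norm (l y - l x) < r"
      using l r(1) unfolding continuous_within_eps_delta dist_norm by blast
    obtain d2 where d2: "d2 > 0" "\<And>y. y \<in> s \<Longrightarrow> norm (y - x) < d2 \<Longrightarrow>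
        norm (F (l y) - F (l x) - M (y - x)) \<le> q * norm (y - x)"
      using M q(1) unfolding has_derivative_within_alt by blast
    show "\<exists>d>0. \<forall>y\<in>s. norm (y - x) < d \<longrightarrow> norm (l y - l x - inv L (M (y - x))) \<le> e * norm (y - x)"
    proof (intro exI[of _ "min d1 d2"] conjI ballI impI)
      show "0 < min d1 d2" using d1 d2 by simp
      fix y assume y: "y \<in> s" "norm (y - x) < min d1 d2"
      define \<Delta> where "\<Delta> = norm (l y - l x)"
      define h where "h = norm (y - x)"
      have 1: "norm (F (l y) - F (l x) - L (l y - l x)) \<le> q * \<Delta>" using r(2) d1(2) y by (auto simp: \<Delta>_def)
      have 2: "norm (F (l y) - F (l x) - M (y - x)) \<le> q * h" using d2(2) y by (auto simp: h_def)
      have 3: "norm (L (l y - l x) - M (y - x)) \<le> q * (\<Delta> + h)"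
      proof -
        have "L (l y - l x) - M (y - x) = (F (l y) - F (l x) - M (y - x)) - (F (l y) - F (l x) - L (l y - l x))"
          by simp
        then show ?thesis using 1 2 norm_triangle_ineq4[of "F (l y) - F (l x) - M (y - x)" "F (l y) - F (l x) - L (l y - l x)"]
          by (simp add: algebra_simps)
      qed
      have eq: "l y - l x - inv L (M (y - x)) = inv L (L (l y - l x) - M (y - x))"
        using linear_diff[OF linI] iL by simp
      have 4: "norm (l y - l x - inv L (M (y - x))) \<le> C * (q * (\<Delta> + h))"
      proof -
        have "norm (inv L (L (l y - l x) - M (y - x))) \<le> norm (L (l y - l x) - M (y - x)) * C" by (rule C(2))
        also have "\<dots> \<le> (q * (\<Delta> + h)) * C" using 3 C(1) by (intro mult_right_mono) auto
        finally show ?thesis unfolding eq by (simp add: mult.commute)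
      qed
      have 5: "\<Delta> \<le> 4 * C * D * h"
      proof -
        have "norm (inv L (M (y - x))) \<le> C * (D * h)"
        proof -
          have "norm (inv L (M (y - x))) \<le> norm (M (y - x)) * C" by (rule C(2))
          also have "\<dots> \<le> (h * D) * C" using D(2)[of "y - x"] C(1)
            by (intro mult_right_mono) (auto simp: h_def)
          finally show ?thesis by (simp add: mult_ac)
        qed
        moreover have "\<Delta> \<le> norm (l y - l x - inv L (M (y - x))) + norm (inv L (M (y - x)))"
          unfolding \<Delta>_def using norm_triangle_sub[of "l y - l x" "inv L (M (y - x))"] by (simp add: add.commute)
        ultimately have "\<Delta> \<le> (C * q) * \<Delta> + C * (q * h) + C * (D * h)" using 4 by (simp add: algebra_simps)
        moreover have "(C * q) * \<Delta> \<le> (1/2) * \<Delta>" using q(2) by (intro mult_right_mono) (auto simp: \<Delta>_def)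
        moreover have "C * (q * h) \<le> C * (D * h)"
          using q(3) C(1) by (intro mult_left_mono mult_right_mono) (auto simp: h_def)
        ultimately show ?thesis by (simp add: algebra_simps)
      qed
      have "C * (q * (\<Delta> + h)) \<le> C * (q * (4 * C * D * h + h))"
        using 5 C q by (intro mult_left_mono add_mono) auto
      also have "\<dots> = (q * (C * (4 * C * D + 1))) * h" by (simp add: algebra_simps)
      also have "\<dots> \<le> e * h" using q(4) by (intro mult_right_mono) (auto simp: h_def)
      finally show "norm (l y - l x - inv L (M (y - x))) \<le> e * norm (y - x)" using 4 by (simp add: h_def)
    qed
  qed
qed

section \<open>Charts and the metric of the universal cover\<close>

lemma velocity_eqI:
  fixes c :: "real \<Rightarrow> 'a::real_normed_vector"
  assumes "a < b" "u \<in> {a..b}" "(c has_vector_derivative v) (at u within {a..b})"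
  shows "velocity a b c u = v"
  unfolding velocity_def using vector_derivative_within_cbox[of a b u c v] assms by simp

lemma velocity_works:
  "c differentiable (at u within {a..b}) \<Longrightarrow>
    (c has_vector_derivative velocity a b c u) (at u within {a..b})"
  unfolding velocity_def by (simp add: vector_derivative_works)

lemma velocity_cong:
  fixes c d :: "real \<Rightarrow> 'a::real_normed_vector"
  assumes "\<And>w. w \<in> {a..b} \<Longrightarrow> c w = d w" "u \<in> {a..b}"
  shows "velocity a b c u = velocity a b d u"
proof -
  have "(c has_vector_derivative v) (at u within {a..b}) \<longleftrightarrow> (d has_vector_derivative v) (at u within {a..b})" for v
    using assms by (metis has_vector_derivative_transform)
  then show ?thesis unfolding velocity_def vector_derivative_def by simp
qed

text \<open>In this locale \<open>F c\<close> is the chart \<open>c\<close> read on the universal cover, with domain \<open>chart_dom c\<close> and derivative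
\<open>DF c\<close>, and \<open>G\<close> is the metric induced on the cover.\<close>

locale conformal_cover =
  fixes S :: "'m::topological_space surface" and U :: "complex set" and pr :: "complex \<Rightarrow> 'm"
  assumes riem: "riemannian_surface S" and conf: "conformally_euclidean_structure S U pr"
begin

abbreviation chart_dom :: "'m chart \<Rightarrow> complex set" where "chart_dom c \<equiv> U \<inter> pr -` fst c"
abbreviation F :: "'m chart \<Rightarrow> complex \<Rightarrow> complex" where "F c \<equiv> snd c \<circ> pr"
abbreviation DF :: "'m chart \<Rightarrow> complex \<Rightarrow> complex \<Rightarrow> complex" where
  "DF c z \<equiv> frechet_derivative (snd c \<circ> pr) (at z)"
abbreviation G where "G \<equiv> cover_metric S pr"

lemma smooth: "smooth_surface S"
  using riem by (simp add: riemannian_surface_def)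

lemma cover: "open U" "simply_connected U" "covering_space U pr (points S)"
  and reg: "c \<in> atlas S \<Longrightarrow> regular_map_on (chart_dom c) (F c)"
  using conf by (auto simp: conformally_euclidean_structure_def planar_universal_cover_def)

lemma connU: "connected U"
  using cover(2) simply_connected_imp_connected by blast

lemma contpr: "continuous_on U pr"
  using cover(3) by (rule covering_space_imp_continuous)

lemma pr_points: "pr ` U = points S"
  using cover(3) by (rule covering_space_imp_surjective)

lemma chart_props:
  assumes "c \<in> atlas S"
  shows "openin (top_of_set (points S)) (fst c)" "open (snd c ` fst c)"
    "homeomorphism (fst c) (snd c ` fst c) (snd c) (inv_into (fst c) (snd c))"
  using smooth assms unfolding smooth_surface_def by auto

lemma chart_inj: "c \<in> atlas S \<Longrightarrow> inj_on (snd c) (fst c)"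
  using chart_props(3)[of c] by (metis homeomorphism_def inj_on_inverseI)

lemma chart_at:
  assumes "z \<in> U" obtains c where "c \<in> atlas S" "z \<in> chart_dom c"
proof -
  have "pr z \<in> points S" using assms pr_points by auto
  then show ?thesis using that smooth assms unfolding smooth_surface_def by blast
qed

lemma openin_chart_dom: "c \<in> atlas S \<Longrightarrow> openin (top_of_set U) (chart_dom c)"
  by (rule continuous_openin_preimage[OF contpr _ chart_props(1)]) (use pr_points in auto)

lemma open_chart_dom: "c \<in> atlas S \<Longrightarrow> open (chart_dom c)"
  using openin_chart_dom cover(1) openin_open_eq by blast

lemma DF:
  assumes "c \<in> atlas S" "z \<in> chart_dom c"
  shows "(F c has_derivative DF c z) (at z)" "linear (DF c z)" "bij (DF c z)" "plane_det (DF c z) \<noteq> 0"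
proof -
  have "smooth_on (chart_dom c) (F c)" and b: "bij (DF c z)"
    using reg assms by (auto simp: regular_map_on_def)
  then have "Ck_on (Suc 0) (chart_dom c) (F c)" by (simp add: smooth_on_def)
  then have "F c differentiable (at z)" using assms by simp
  then show 1: "(F c has_derivative DF c z) (at z)" by (simp add: frechet_derivative_works)
  then show 2: "linear (DF c z)" using has_derivative_linear by blast
  show "bij (DF c z)" by (rule b)
  show "plane_det (DF c z) \<noteq> 0" using plane_det_nonzero[OF 2] b by (simp add: bij_is_inj)
qed

lemma DF_diff:
  assumes "c \<in> atlas S" "z \<in> chart_dom c"
  shows "(\<lambda>z. DF c z v) differentiable (at z)"
proof -
  have "smooth_on (chart_dom c) (F c)" using reg assms by (auto simp: regular_map_on_def)
  then have "Ck_on (Suc (Suc 0)) (chart_dom c) (F c)" unfolding smooth_on_def by blast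
  then show ?thesis using assms by simp
qed

lemma DF_cont:
  assumes "c \<in> atlas S"
  shows "continuous_on (chart_dom c) (\<lambda>z. DF c z v)"
  using DF_diff[OF assms] by (meson continuous_at_imp_continuous_on differentiable_imp_continuous_within)

lemma DF_components: "c \<in> atlas S \<Longrightarrow> z \<in> chart_dom c \<Longrightarrow> DF c z v = Re v *\<^sub>R DF c z 1 + Im v *\<^sub>R DF c z \<i>"
  by (rule linear_complex[OF DF(2)])

text \<open>One direction expands \<open>DF c z v\<close> in the components of \<open>v\<close>; the other one is Cramer's rule.\<close>

lemma DF_continuous_iff_local:
  fixes l w :: "'a::t2_space \<Rightarrow> complex"
  assumes c: "c \<in> atlas S" and l: "continuous_on X l" "l ` X \<subseteq> chart_dom c"
  shows "continuous_on X (\<lambda>y. DF c (l y) (w y)) \<longleftrightarrow> continuous_on X w"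
proof
  have D: "continuous_on X (\<lambda>y. DF c (l y) v)" for v
    by (rule continuous_on_compose2[OF DF_cont[OF c] l])
  have ly: "l y \<in> chart_dom c" if "y \<in> X" for y using that l by auto
  {
    assume w: "continuous_on X w"
    have "continuous_on X (\<lambda>y. Re (w y) *\<^sub>R DF c (l y) 1 + Im (w y) *\<^sub>R DF c (l y) \<i>)"
      by (intro continuous_intros D w)
    then show "continuous_on X (\<lambda>y. DF c (l y) (w y))"
      by (rule continuous_on_eq) (rule DF_components[OF c ly, symmetric])
  next
    assume w: "continuous_on X (\<lambda>y. DF c (l y) (w y))"
    define W where "W = (\<lambda>y. DF c (l y) (w y))"
    define A where "A = (\<lambda>y. DF c (l y) 1)"
    define B where "B = (\<lambda>y. DF c (l y) \<i>)"
    define d where "d = (\<lambda>y. Re (A y) * Im (B y) - Im (A y) * Re (B y))"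
    have cW: "continuous_on X W" and cA: "continuous_on X A" and cB: "continuous_on X B"
      using w D by (auto simp: W_def A_def B_def)
    have cd: "continuous_on X d" unfolding d_def by (intro continuous_intros cA cB)
    have d: "d y = plane_det (DF c (l y))" for y by (simp add: d_def plane_det_def A_def B_def)
    have "continuous_on X (\<lambda>y. Complex ((Re (W y) * Im (B y) - Im (W y) * Re (B y)) / d y)
                     ((Re (A y) * Im (W y) - Im (A y) * Re (W y)) / d y))"
      using DF(4)[OF c ly] by (intro continuous_intros cW cA cB cd) (auto simp: d)
    moreover have "w y = Complex ((Re (W y) * Im (B y) - Im (W y) * Re (B y)) / d y)
                     ((Re (A y) * Im (W y) - Im (A y) * Re (W y)) / d y)" if "y \<in> X" for y
      using linear_complex_solve[OF DF(2,4)[OF c ly[OF that]], of "w y"] unfolding d W_def A_def B_def .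
    ultimately show "continuous_on X w"
      by (metis (no_types, lifting) continuous_on_eq)
  }
qed

text \<open>A family of tangent vectors along a continuous map into \<open>U\<close> is continuous exactly if it is continuous in
the charts of the surface. This translates the chart-wise conditions on velocities into conditions in the
plane, for single curves and for homotopies alike.\<close>

lemma DF_continuous_iff:
  fixes l w :: "'a::t2_space \<Rightarrow> complex"
  assumes l: "continuous_on X l" "l ` X \<subseteq> U"
  shows "(\<forall>c\<in>atlas S. continuous_on {y\<in>X. pr (l y) \<in> fst c} (\<lambda>y. DF c (l y) (w y))) \<longleftrightarrow> continuous_on X w"
proof
  have sub: "continuous_on {y\<in>X. pr (l y) \<in> fst c} l" "l ` {y\<in>X. pr (l y) \<in> fst c} \<subseteq> chart_dom c" for c
    using l by (auto intro: continuous_on_subset)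
  assume L: "\<forall>c\<in>atlas S. continuous_on {y\<in>X. pr (l y) \<in> fst c} (\<lambda>y. DF c (l y) (w y))"
  show "continuous_on X w"
  proof (rule continuous_on_locally)
    fix y assume y: "y \<in> X"
    then obtain c where c: "c \<in> atlas S" "l y \<in> chart_dom c" using chart_at[of "l y"] l by blast
    have eq: "{y\<in>X. pr (l y) \<in> fst c} = X \<inter> l -` chart_dom c" using l by auto
    have "openin (top_of_set X) {y\<in>X. pr (l y) \<in> fst c}" unfolding eq
      by (rule continuous_openin_preimage_gen[OF l(1) open_chart_dom[OF c(1)]])
    moreover have "continuous_on {y\<in>X. pr (l y) \<in> fst c} w"
      using L c DF_continuous_iff_local[OF c(1) sub] by blast
    ultimately show "\<exists>Y. openin (top_of_set X) Y \<and> y \<in> Y \<and> continuous_on Y w"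
      using y c by blast
  qed
next
  assume w: "continuous_on X w"
  show "\<forall>c\<in>atlas S. continuous_on {y\<in>X. pr (l y) \<in> fst c} (\<lambda>y. DF c (l y) (w y))"
  proof
    fix c assume c: "c \<in> atlas S"
    have "continuous_on {y\<in>X. pr (l y) \<in> fst c} w" using w by (rule continuous_on_subset) auto
    then show "continuous_on {y\<in>X. pr (l y) \<in> fst c} (\<lambda>y. DF c (l y) (w y))"
      using DF_continuous_iff_local[OF c, of "{y\<in>X. pr (l y) \<in> fst c}" l w] l
      by (auto intro: continuous_on_subset)
  qed
qed

text \<open>The chart chosen in the definition of the induced metric may be replaced by any other one, by the chain
rule and the transformation law of the metric.\<close>

lemma cover_metric_chart:
  assumes d: "d \<in> atlas S" "z \<in> chart_dom d"
  shows "G z v w = riem_metric S d (F d z) (DF d z v) (DF d z w)"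
proof -
  define c where "c = (SOME c. c \<in> atlas S \<and> pr z \<in> fst c)"
  have "c \<in> atlas S \<and> pr z \<in> fst c" unfolding c_def by (rule someI[of _ d]) (use d in auto)
  then have c: "c \<in> atlas S" "z \<in> chart_dom c" using d by auto
  have Gc: "G z v w = riem_metric S c (F c z) (DF c z v) (DF c z w)"
    by (simp add: cover_metric_def Let_def c_def)
  define t where "t = transition c d"
  have zc: "F c z \<in> snd c ` (fst c \<inter> fst d)" using c d by auto
  have inv: "inv_into (fst c) (snd c) (snd c q) = q" if "q \<in> fst c" for q
    using chart_inj[OF c(1)] that by simp
  have tF: "t (F c y) = F d y" if "y \<in> chart_dom c \<inter> chart_dom d" for y
    using that by (simp add: t_def transition_def inv)
  have "smooth_on (snd c ` (fst c \<inter> fst d)) t"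
    using smooth c d unfolding smooth_surface_def t_def by blast
  then have "Ck_on (Suc 0) (snd c ` (fst c \<inter> fst d)) t" unfolding smooth_on_def by blast
  then have dt: "t differentiable (at (F c z))" using zc by auto
  have "((\<lambda>y. t (F c y)) has_derivative (\<lambda>v. frechet_derivative t (at (F c z)) (DF c z v))) (at z)"
    using diff_chain_at[OF DF(1)[OF c] dt[unfolded frechet_derivative_works]] by (simp add: o_def)
  then have "(F d has_derivative (\<lambda>v. frechet_derivative t (at (F c z)) (DF c z v))) (at z)"
    by (rule has_derivative_transform_within_open[of _ _ _ _ "chart_dom c \<inter> chart_dom d"])
      (use c d open_Int[OF open_chart_dom[OF c(1)] open_chart_dom[OF d(1)]] tF in auto)
  then have "DF d z = (\<lambda>v. frechet_derivative t (at (F c z)) (DF c z v))"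
    using DF(1)[OF d] has_derivative_unique by blast
  moreover have "riem_metric S c (F c z) (DF c z v) (DF c z w) =
      riem_metric S d (t (F c z)) (frechet_derivative t (at (F c z)) (DF c z v))
        (frechet_derivative t (at (F c z)) (DF c z w))"
    using riem c d zc unfolding riemannian_surface_def t_def by blast
  ultimately show ?thesis using Gc tF[of z] c d by simp
qed

lemma riem_metric_at:
  assumes "c \<in> atlas S" "z \<in> chart_dom c"
  shows "bilinear (riem_metric S c (F c z))"
    "riem_metric S c (F c z) v w = riem_metric S c (F c z) w v"
    "v \<noteq> 0 \<Longrightarrow> riem_metric S c (F c z) v v > 0"
proof -
  have "F c z \<in> snd c ` fst c" using assms by auto
  then show "bilinear (riem_metric S c (F c z))"
    "riem_metric S c (F c z) v w = riem_metric S c (F c z) w v"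
    "v \<noteq> 0 \<Longrightarrow> riem_metric S c (F c z) v v > 0"
    using riem assms(1) unfolding riemannian_surface_def by blast+
qed

lemma cover_metric_inner_product:
  assumes z: "z \<in> U"
  shows "bilinear (G z)" "G z v w = G z w v" "v \<noteq> 0 \<Longrightarrow> G z v v > 0"
proof -
  obtain c where c: "c \<in> atlas S" "z \<in> chart_dom c" using chart_at z by blast
  note lin = DF(2)[OF c]
  have bij: "bij (DF c z)" by (rule DF(3)[OF c])
  have bl: "bilinear (riem_metric S c (F c z))" by (rule riem_metric_at(1)[OF c])
  show "bilinear (G z)"
    unfolding bilinear_def cover_metric_chart[OF c]
  proof (intro conjI allI)
    show "linear (\<lambda>y. riem_metric S c (F c z) (DF c z x) (DF c z y))" for x
      using linear_compose[OF lin, of "riem_metric S c (F c z) (DF c z x)"] bl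
      by (simp add: bilinear_def o_def)
    show "linear (\<lambda>x. riem_metric S c (F c z) (DF c z x) (DF c z y))" for y
      using linear_compose[OF lin, of "\<lambda>x. riem_metric S c (F c z) x (DF c z y)"] bl
      by (simp add: bilinear_def o_def)
  qed
  show "G z v w = G z w v" unfolding cover_metric_chart[OF c] by (rule riem_metric_at(2)[OF c])
  show "G z v v > 0" if "v \<noteq> 0"
  proof -
    have "DF c z v \<noteq> 0" using that lin bij by (metis bij_is_inj linear_injective_0)
    then show ?thesis unfolding cover_metric_chart[OF c] by (rule riem_metric_at(3)[OF c])
  qed
qed

text \<open>The induced metric is \<open>conf_factor z\<close> times the euclidean one, by \<open>cover_metric_conformal\<close>.\<close>

definition conf_factor :: "complex \<Rightarrow> real" where "conf_factor z = G z 1 1"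

lemma conf_factor_pos: "z \<in> U \<Longrightarrow> conf_factor z > 0"
  by (simp add: conf_factor_def cover_metric_inner_product)

text \<open>Equality of angles makes orthogonal vectors orthogonal for the induced metric; this applies to the pairs
\<open>1, \<i>\<close> and \<open>1 + \<i>, 1 - \<i>\<close>, and the second pair shows that \<open>1\<close> and \<open>\<i>\<close> have the same length. The
Cauchy-Schwarz inequality is needed because \<open>arccos\<close> is injective on \<open>[-1, 1]\<close> only.\<close>

lemma cover_metric_conformal:
  assumes z: "z \<in> U"
  shows "G z v w = conf_factor z * inner v w"
proof -
  define B where "B = G z"
  have bl: "bilinear B" and sym: "\<And>v w. B v w = B w v" and pos: "\<And>v. v \<noteq> 0 \<Longrightarrow> B v v > 0"
    using cover_metric_inner_product[OF z] by (auto simp: B_def)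
  note bs = bilinear_ladd[OF bl] bilinear_radd[OF bl] bilinear_lmul[OF bl] bilinear_rmul[OF bl]
  have orth: "B v w = 0" if vw: "v \<noteq> 0" "w \<noteq> 0" "inner v w = 0" for v w
  proof -
    define x where "x = B v w / (sqrt (B v v) * sqrt (B w w))"
    have "unoriented_angle B v w = unoriented_angle inner v w"
      using conf z vw unfolding conformally_euclidean_structure_def B_def by blast
    then have "arccos x = arccos 0" using vw by (simp add: unoriented_angle_def x_def)
    moreover have "\<bar>x\<bar> \<le> 1"
    proof -
      have "(B v w)\<^sup>2 \<le> B v v * B w w"
      proof -
        \<comment> \<open>the minimum of the quadratic polynomial \<open>B (v + t w) (v + t w)\<close> in \<open>t\<close>\<close>
        define t where "t = - B v w / B w w"
        have "0 \<le> B (v + t *\<^sub>R w) (v + t *\<^sub>R w)"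
          by (metis pos bilinear_lzero[OF bl] less_eq_real_def)
        also have "\<dots> = B v v + 2 * t * B v w + t\<^sup>2 * B w w"
          by (simp add: bs sym[of w v] power2_eq_square algebra_simps)
        also have "\<dots> = B v v - (B v w)\<^sup>2 / B w w"
          using pos[OF vw(2)] by (simp add: t_def power2_eq_square field_simps)
        finally show ?thesis using pos[OF vw(2)] by (simp add: field_simps)
      qed
      then have "\<bar>B v w\<bar> \<le> sqrt (B v v * B w w)"
        by (metis real_sqrt_abs real_sqrt_le_iff)
      moreover have P: "sqrt (B v v) * sqrt (B w w) > 0" using pos vw by simp
      ultimately show ?thesis
        unfolding x_def abs_divide abs_of_pos[OF P] by (simp only: pos_divide_le_eq[OF P] real_sqrt_mult mult_1_left)
    qed
    ultimately have "x = 0" using arccos_eq_iff[of x 0] by (simp add: abs_le_iff)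
    then show ?thesis using pos[OF vw(1)] pos[OF vw(2)] by (simp add: x_def)
  qed
  have 1: "B 1 \<i> = 0" by (rule orth) (auto simp: inner_complex_def)
  have "B (1 + \<i>) (1 - \<i>) = 0" by (rule orth) (auto simp: inner_complex_def complex_eq_iff)
  then have "B 1 1 = B \<i> \<i>"
    using bilinear_rsub[OF bl] 1 sym[of \<i> 1] by (simp add: bs)
  moreover have "B v w = Re v * Re w * B 1 1 + Re v * Im w * B 1 \<i> + Im v * Re w * B \<i> 1 + Im v * Im w * B \<i> \<i>"
  proof -
    have "v = Re v *\<^sub>R 1 + Im v *\<^sub>R \<i>" "w = Re w *\<^sub>R 1 + Im w *\<^sub>R \<i>" by (simp_all add: complex_eq_iff)
    then have "B v w = B (Re v *\<^sub>R 1 + Im v *\<^sub>R \<i>) (Re w *\<^sub>R 1 + Im w *\<^sub>R \<i>)" by simp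
    then show ?thesis unfolding bs by (simp add: algebra_simps)
  qed
  ultimately show ?thesis using 1 sym[of \<i> 1] by (simp add: conf_factor_def inner_complex_def algebra_simps flip: B_def)
qed

lemma conf_factor_differentiable:
  assumes z: "z \<in> U"
  shows "conf_factor differentiable (at z)"
proof -
  obtain c where c: "c \<in> atlas S" "z \<in> chart_dom c" using chart_at z by blast
  define R where "R = riem_metric S c"
  define A where "A = (\<lambda>y. DF c y 1)"
  have FO: "F c y \<in> snd c ` fst c" if "y \<in> chart_dom c" for y using that by auto
  have bl: "bilinear (R (F c y))" if "y \<in> chart_dom c" for y using riem_metric_at(1)[OF c(1) that] by (simp add: R_def)
  have Rd: "(\<lambda>y. R y v w) differentiable (at (F c z))" for v w
  proof -
    have "smooth_on (snd c ` fst c) (\<lambda>z. R z v w)"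
      using riem c unfolding riemannian_surface_def R_def by blast
    then have "Ck_on (Suc 0) (snd c ` fst c) (\<lambda>z. R z v w)" unfolding smooth_on_def by blast
    then have "\<forall>x\<in>snd c ` fst c. (\<lambda>y. R y v w) differentiable (at x)" unfolding Ck_on.simps by blast
    then show ?thesis using FO[OF c(2)] by blast
  qed
  have Fd: "F c differentiable (at z)" using DF(1)[OF c] by (auto simp: differentiable_def)
  have RF: "(\<lambda>y. R (F c y) v w) differentiable (at z)" for v w
    using differentiable_chain_at[OF Fd Rd] by (simp add: o_def)
  have Ad: "A differentiable (at z)" unfolding A_def by (rule DF_diff[OF c])
  obtain A' where A': "(A has_derivative A') (at z)" using Ad by (auto simp: differentiable_def)
  have Re: "(\<lambda>y. Re (A y)) differentiable (at z)" "(\<lambda>y. Im (A y)) differentiable (at z)"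
    using bounded_linear.has_derivative[OF bounded_linear_Re A'] bounded_linear.has_derivative[OF bounded_linear_Im A']
    by (auto simp: differentiable_def)
  have exp: "conf_factor y = Re (A y) * Re (A y) * R (F c y) 1 1 + Re (A y) * Im (A y) * R (F c y) 1 \<i>
      + Im (A y) * Re (A y) * R (F c y) \<i> 1 + Im (A y) * Im (A y) * R (F c y) \<i> \<i>" if y: "y \<in> chart_dom c" for y
  proof -
    have "A y = Re (A y) *\<^sub>R 1 + Im (A y) *\<^sub>R \<i>" by (simp add: complex_eq_iff)
    then have "conf_factor y = R (F c y) (Re (A y) *\<^sub>R 1 + Im (A y) *\<^sub>R \<i>) (Re (A y) *\<^sub>R 1 + Im (A y) *\<^sub>R \<i>)"
      unfolding conf_factor_def cover_metric_chart[OF c(1) y] A_def R_def by simp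
    then show ?thesis
      unfolding bilinear_ladd[OF bl[OF y]] bilinear_radd[OF bl[OF y]] bilinear_lmul[OF bl[OF y]] bilinear_rmul[OF bl[OF y]]
      by (simp add: algebra_simps)
  qed
  have "(\<lambda>y. Re (A y) * Re (A y) * R (F c y) 1 1 + Re (A y) * Im (A y) * R (F c y) 1 \<i>
      + Im (A y) * Re (A y) * R (F c y) \<i> 1 + Im (A y) * Im (A y) * R (F c y) \<i> \<i>) differentiable (at z)"
    by (intro differentiable_add differentiable_mult RF Re)
  then obtain D where D: "((\<lambda>y. Re (A y) * Re (A y) * R (F c y) 1 1 + Re (A y) * Im (A y) * R (F c y) 1 \<i>
      + Im (A y) * Re (A y) * R (F c y) \<i> 1 + Im (A y) * Im (A y) * R (F c y) \<i> \<i>) has_derivative D) (at z)"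
    by (auto simp: differentiable_def)
  have "(conf_factor has_derivative D) (at z)"
    by (rule has_derivative_transform_within_open[OF D open_chart_dom[OF c(1)] c(2)]) (simp add: exp)
  then show ?thesis by (auto simp: differentiable_def)
qed

end

section \<open>Deck transformations are conformal\<close>

context conformal_cover
begin

abbreviation DT :: "(complex \<Rightarrow> complex) \<Rightarrow> complex \<Rightarrow> complex \<Rightarrow> complex" where
  "DT T z \<equiv> frechet_derivative T (at z)"

lemma deckD:
  assumes "deck_transformation U pr T"
  shows "continuous_on U T" "T ` U \<subseteq> U" "z \<in> U \<Longrightarrow> T z \<in> U" "z \<in> U \<Longrightarrow> pr (T z) = pr z"
  using assms unfolding deck_transformation_def homeomorphism_def by blast+

text \<open>Locally \<open>T\<close> is the composition of \<open>pr\<close> with a local inverse of \<open>pr\<close>.\<close>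

lemma deck_deriv:
  assumes T: "deck_transformation U pr T" and c: "c \<in> atlas S" "z \<in> chart_dom c"
  shows "(T has_derivative DT T z) (at z)" "DF c (T z) (DT T z v) = DF c z v"
proof -
  have Tz: "T z \<in> chart_dom c" using deckD[OF T] c by auto
  define L where "L = DF c (T z)"
  have "((\<lambda>y. F c (T y)) has_derivative DF c z) (at z)"
    by (rule has_derivative_transform_within_open[OF DF(1)[OF c] open_chart_dom[OF c(1)] c(2)])
      (use deckD[OF T] in auto)
  moreover have "continuous (at z) T"
    using deckD(1)[OF T] cover(1) c by (simp add: continuous_on_eq_continuous_at)
  ultimately have "(T has_derivative (\<lambda>v. inv L (DF c z v))) (at z)"
    unfolding L_def using has_derivative_cancel_left[where l = T and x = z, OF DF(1)[OF c(1) Tz] DF(3)[OF c(1) Tz]] by blast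
  moreover from this have eq: "DT T z = (\<lambda>v. inv L (DF c z v))" by (simp add: frechet_derivative_at[symmetric])
  ultimately show "(T has_derivative DT T z) (at z)" by simp
  show "DF c (T z) (DT T z v) = DF c z v"
    using DF(3)[OF c(1) Tz] unfolding eq by (simp add: L_def bij_is_surj surj_f_inv_f)
qed

lemma deck_linear:
  assumes T: "deck_transformation U pr T" and z: "z \<in> U"
  shows "linear (DT T z)"
  using chart_at[OF z] deck_deriv(1)[OF T] has_derivative_linear by metis

text \<open>A deck transformation is an isometry of the induced metric, which is conformal to the euclidean one.\<close>

lemma deck_similarity:
  assumes T: "deck_transformation U pr T" and z: "z \<in> U"
  obtains k where "k > 0" "\<And>v. norm (DT T z v) = k * norm v"
proof -
  obtain c where c: "c \<in> atlas S" "z \<in> chart_dom c" using chart_at z by blast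
  have Tz: "T z \<in> chart_dom c" "T z \<in> U" using deckD[OF T] c by auto
  define k where "k = sqrt (conf_factor z / conf_factor (T z))"
  have k: "k > 0" using conf_factor_pos z Tz by (simp add: k_def)
  have "norm (DT T z v) = k * norm v" for v
  proof -
    have "conf_factor (T z) * inner (DT T z v) (DT T z v) = G (T z) (DT T z v) (DT T z v)"
      by (rule cover_metric_conformal[OF Tz(2), symmetric])
    also have "\<dots> = G z v v"
      unfolding cover_metric_chart[OF c] cover_metric_chart[OF c(1) Tz(1)] deck_deriv(2)[OF T c]
      using deckD(4)[OF T z] by simp
    also have "\<dots> = conf_factor z * inner v v" by (rule cover_metric_conformal[OF z])
    finally have "conf_factor (T z) * (norm (DT T z v))\<^sup>2 = conf_factor z * (norm v)\<^sup>2" by (simp add: dot_square_norm)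
    then have "(norm (DT T z v))\<^sup>2 = (conf_factor z / conf_factor (T z)) * (norm v)\<^sup>2"
      using conf_factor_pos[OF Tz(2)] by (simp add: field_simps)
    also have "\<dots> = (k * norm v)\<^sup>2"
      using conf_factor_pos[OF Tz(2)] conf_factor_pos[OF z] by (simp add: k_def power_mult_distrib)
    finally show ?thesis using k by (simp add: power2_eq_iff_nonneg)
  qed
  then show ?thesis using k that by blast
qed

lemma deck_continuous_derivative:
  assumes T: "deck_transformation U pr T"
  shows "continuous_on U (\<lambda>z. DT T z v)"
proof -
  have "continuous_on {y\<in>U. pr (T y) \<in> fst c} (\<lambda>y. DF c (T y) (DT T y v))" if c: "c \<in> atlas S" for c
  proof (rule continuous_on_eq)
    have eq: "{y\<in>U. pr (T y) \<in> fst c} = chart_dom c" using deckD[OF T] by auto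
    show "continuous_on {y\<in>U. pr (T y) \<in> fst c} (\<lambda>y. DF c y v)" unfolding eq by (rule DF_cont[OF c])
    show "DF c y v = DF c (T y) (DT T y v)" if "y \<in> {y\<in>U. pr (T y) \<in> fst c}" for y
      using that deck_deriv(2)[OF T c] unfolding eq by simp
  qed
  then show ?thesis using DF_continuous_iff[OF deckD(1,2)[OF T]] by blast
qed

text \<open>The determinant of the derivative is continuous and nonzero on the connected set \<open>U\<close>.\<close>

lemma deck_orientation_constant:
  assumes T: "deck_transformation U pr T" and z: "z \<in> U"
  shows "(\<forall>x\<in>U. plane_det (DT T x) > 0) \<longleftrightarrow> plane_det (DT T z) > 0"
proof
  assume pos: "plane_det (DT T z) > 0"
  define d where "d = (\<lambda>x. plane_det (DT T x))"
  have "continuous_on U d" unfolding d_def plane_det_def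
    by (intro continuous_intros deck_continuous_derivative[OF T])
  then have "connected (d ` U)" using connU by (rule connected_continuous_image)
  moreover have "d x \<noteq> 0" if x: "x \<in> U" for x
  proof -
    obtain k where k: "k > 0" "\<And>v. norm (DT T x v) = k * norm v" using deck_similarity[OF T x] by blast
    show ?thesis unfolding d_def by (rule similarity_cases[OF deck_linear[OF T x] k]) linarith+
  qed
  ultimately have no: "0 \<notin> d ` U" "connected (d ` U)" by (metis imageE, blast)
  show "\<forall>x\<in>U. plane_det (DT T x) > 0"
  proof (rule ccontr)
    assume "\<not> ?thesis"
    then obtain x where x: "x \<in> U" "d x \<le> 0" by (auto simp: d_def not_less)
    have "{d x..d z} \<subseteq> d ` U" using no(2) x z by (intro connected_contains_Icc) auto
    moreover have "0 \<in> {d x..d z}" using x pos by (simp add: d_def)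
    ultimately show False using no(1) by blast
  qed
qed (use z in auto)

lemma deck_form:
  assumes T: "deck_transformation U pr T" and z: "z \<in> U"
  obtains (preserving) \<alpha> where "\<forall>x\<in>U. plane_det (DT T x) > 0" "\<alpha> \<noteq> 0" "\<And>v. DT T z v = \<alpha> * v"
    | (reversing) \<alpha> where "\<not> (\<forall>x\<in>U. plane_det (DT T x) > 0)" "\<alpha> \<noteq> 0" "\<And>v. DT T z v = \<alpha> * cnj v"
proof -
  obtain k where k: "k > 0" "\<And>v. norm (DT T z v) = k * norm v" using deck_similarity[OF T z] by blast
  show ?thesis
  proof (rule similarity_cases[OF deck_linear[OF T z] k])
    fix \<alpha> assume "\<alpha> \<noteq> 0" "\<And>v. DT T z v = \<alpha> * v" "plane_det (DT T z) > 0"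
    then show ?thesis using preserving deck_orientation_constant[OF T z] by blast
  next
    fix \<alpha> assume "\<alpha> \<noteq> 0" "\<And>v. DT T z v = \<alpha> * cnj v" "plane_det (DT T z) < 0"
    then show ?thesis using reversing[of \<alpha>] deck_orientation_constant[OF T z] by auto
  qed
qed

section \<open>Curves and their lifts\<close>

lemma chart_velocity_lift:
  assumes ab: "a < b" and \<gamma>: "\<And>u. u \<in> {a..b} \<Longrightarrow> \<gamma> u = pr (l u)"
    and u: "u \<in> {a..b}" and c: "c \<in> atlas S" "l u \<in> chart_dom c"
    and l: "l differentiable (at u within {a..b})"
  shows "(snd c \<circ> \<gamma>) differentiable (at u within {a..b})"
    "chart_velocity c a b \<gamma> u = DF c (l u) (velocity a b l u)"
proof -
  have "((F c \<circ> l) has_vector_derivative DF c (l u) (velocity a b l u)) (at u within {a..b})"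
    using vector_derivative_diff_chain_within[OF velocity_works[OF l]]
      has_derivative_at_withinI[OF DF(1)[OF c]] by blast
  then have d: "((snd c \<circ> \<gamma>) has_vector_derivative DF c (l u) (velocity a b l u)) (at u within {a..b})"
    by (rule has_vector_derivative_transform[rotated -1]) (use u \<gamma> in auto)
  then show "(snd c \<circ> \<gamma>) differentiable (at u within {a..b})"
    by (rule differentiableI_vector)
  show "chart_velocity c a b \<gamma> u = DF c (l u) (velocity a b l u)"
    unfolding chart_velocity_def by (rule velocity_eqI[OF ab u d])
qed

lemma lift_differentiable:
  assumes \<gamma>: "\<And>u. u \<in> {a..b} \<Longrightarrow> \<gamma> u = pr (l u)"
    and u: "u \<in> {a..b}" and c: "c \<in> atlas S" "l u \<in> chart_dom c" and l: "continuous_on {a..b} l"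
    and d: "(snd c \<circ> \<gamma>) differentiable (at u within {a..b})"
  shows "l differentiable (at u within {a..b})"
proof -
  obtain M where "((snd c \<circ> \<gamma>) has_derivative M) (at u within {a..b})" using d by (auto simp: differentiable_def)
  then have "((\<lambda>u. F c (l u)) has_derivative M) (at u within {a..b})"
    by (rule has_derivative_transform[rotated -1]) (use u \<gamma> in auto)
  moreover have "continuous (at u within {a..b}) l"
    using l u by (simp add: continuous_on_eq_continuous_within)
  ultimately show ?thesis
    using has_derivative_cancel_left[where l = l and x = u, OF DF(1)[OF c] DF(3)[OF c]] by (auto simp: differentiable_def)
qed

lemma regular_curve_iff:
  assumes ab: "a < b" and l: "continuous_on {a..b} l" "l ` {a..b} \<subseteq> U"
    and \<gamma>: "\<And>u. u \<in> {a..b} \<Longrightarrow> \<gamma> u = pr (l u)"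
  shows "regular_curve S a b \<gamma> \<longleftrightarrow> C1_curve a b l \<and> (\<forall>u\<in>{a..b}. velocity a b l u \<noteq> 0)"
proof -
  have lU: "l u \<in> U" if "u \<in> {a..b}" for u using l that by auto
  have c\<gamma>: "continuous_on {a..b} \<gamma>"
    by (rule continuous_on_eq[OF continuous_on_compose2[OF contpr l(1)]]) (use l \<gamma> in auto)
  have p\<gamma>: "\<gamma> ` {a..b} \<subseteq> points S" using \<gamma> lU pr_points by auto
  have dset: "{u \<in> {a..b}. \<gamma> u \<in> fst c} = {u \<in> {a..b}. pr (l u) \<in> fst c}" for c using \<gamma> by auto
  have diff: "(\<forall>c\<in>atlas S. \<forall>u\<in>{a..b}. \<gamma> u \<in> fst c \<longrightarrow> (snd c \<circ> \<gamma>) differentiable (at u within {a..b})) \<longleftrightarrow>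
    (\<forall>u\<in>{a..b}. l differentiable (at u within {a..b}))"
  proof safe
    fix u assume "u \<in> {a..b}" and d: "\<forall>c\<in>atlas S. \<forall>u\<in>{a..b}. \<gamma> u \<in> fst c \<longrightarrow> (snd c \<circ> \<gamma>) differentiable (at u within {a..b})"
    then obtain c where c: "c \<in> atlas S" "l u \<in> chart_dom c" using chart_at[OF lU] by blast
    then have "(snd c \<circ> \<gamma>) differentiable (at u within {a..b})" using d \<gamma> \<open>u \<in> {a..b}\<close> by auto
    then show "l differentiable (at u within {a..b})"
      using lift_differentiable[OF \<gamma> _ c l(1)] \<open>u \<in> {a..b}\<close> by blast
  next
    fix f d u assume "\<forall>u\<in>{a..b}. l differentiable (at u within {a..b})" "(f, d) \<in> atlas S" "u \<in> {a..b}"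
      "\<gamma> u \<in> fst (f, d)"
    then show "(snd (f, d) \<circ> \<gamma>) differentiable (at u within {a..b})"
      using chart_velocity_lift(1)[OF ab \<gamma>, where c = "(f, d)" and u = u] lU \<gamma> by auto
  qed
  show ?thesis
  proof (cases "\<forall>u\<in>{a..b}. l differentiable (at u within {a..b})")
    case True
    have vel: "chart_velocity c a b \<gamma> u = DF c (l u) (velocity a b l u)"
      if "c \<in> atlas S" "u \<in> {a..b}" "\<gamma> u \<in> fst c" for c u
      using chart_velocity_lift(2)[OF ab \<gamma>, where c = c and u = u] that lU \<gamma> True by auto
    have nz: "DF c (l u) v \<noteq> 0 \<longleftrightarrow> v \<noteq> 0" if "c \<in> atlas S" "u \<in> {a..b}" "\<gamma> u \<in> fst c" for c u v
    proof -
      have "l u \<in> chart_dom c" using lU \<gamma> that by auto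
      then show ?thesis using DF(2,3)[OF that(1)] by (metis bij_is_inj linear_0 linear_injective_0)
    qed
    have nz': "(\<forall>c\<in>atlas S. \<forall>u\<in>{a..b}. \<gamma> u \<in> fst c \<longrightarrow> chart_velocity c a b \<gamma> u \<noteq> 0) \<longleftrightarrow>
        (\<forall>u\<in>{a..b}. velocity a b l u \<noteq> 0)"
    proof
      assume L: "\<forall>c\<in>atlas S. \<forall>u\<in>{a..b}. \<gamma> u \<in> fst c \<longrightarrow> chart_velocity c a b \<gamma> u \<noteq> 0"
      show "\<forall>u\<in>{a..b}. velocity a b l u \<noteq> 0"
      proof
        fix u assume u: "u \<in> {a..b}"
        then obtain c where c: "c \<in> atlas S" "l u \<in> chart_dom c" using chart_at[OF lU] by blast
        then have "\<gamma> u \<in> fst c" using \<gamma> u by auto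
        then show "velocity a b l u \<noteq> 0" using L c u vel nz by metis
      qed
    qed (use vel nz in auto)
    have "(\<forall>c\<in>atlas S. continuous_on {u\<in>{a..b}. \<gamma> u \<in> fst c} (chart_velocity c a b \<gamma>)) \<longleftrightarrow>
       (\<forall>c\<in>atlas S. continuous_on {u\<in>{a..b}. pr (l u) \<in> fst c} (\<lambda>u. DF c (l u) (velocity a b l u)))"
      unfolding dset by (intro ball_cong refl continuous_on_cong) (use vel \<gamma> in auto)
    also have "\<dots> \<longleftrightarrow> continuous_on {a..b} (velocity a b l)"
      by (rule DF_continuous_iff[OF l])
    finally show ?thesis
      using True diff nz' ab c\<gamma> p\<gamma> unfolding regular_curve_def C1_curve_def by blast
  next
    case False
    then show ?thesis using diff unfolding regular_curve_def C1_curve_def by blast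
  qed
qed

text \<open>As \<open>pr \<circ> T = pr\<close>, the tangent vector at \<open>l a\<close> is seen in a chart like its image under the derivative of \<open>T\<close>,
which is attached to \<open>l b\<close>. Unit vectors in a chart agree exactly if one velocity is a positive multiple of the
other one.\<close>

lemma regular_closed_curve_iff:
  assumes ab: "a < b" and l: "continuous_on {a..b} l" "l ` {a..b} \<subseteq> U"
    and \<gamma>: "\<And>u. u \<in> {a..b} \<Longrightarrow> \<gamma> u = pr (l u)"
    and T: "deck_transformation U pr T" "T (l a) = l b"
  shows "regular_closed_curve S a b \<gamma> \<longleftrightarrow> C1_curve a b l \<and> (\<forall>u\<in>{a..b}. velocity a b l u \<noteq> 0) \<and>
     (\<exists>k>0. velocity a b l b = k *\<^sub>R DT T (l a) (velocity a b l a))"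
proof (cases "C1_curve a b l \<and> (\<forall>u\<in>{a..b}. velocity a b l u \<noteq> 0)")
  case False
  then show ?thesis using regular_curve_iff[OF ab l \<gamma>] by (auto simp: regular_closed_curve_def)
next
  case True
  define va vb where "va = velocity a b l a" and "vb = velocity a b l b"
  have aU: "l a \<in> U" "l b \<in> U" using l ab by auto
  have ends: "\<gamma> a = pr (l a)" "\<gamma> b = pr (l b)" using \<gamma> ab by auto
  have closed: "\<gamma> a = \<gamma> b" using ends deckD(4)[OF T(1) aU(1)] T(2) by simp
  have v0: "va \<noteq> 0" "vb \<noteq> 0" using True ab by (auto simp: va_def vb_def)
  have dl: "l differentiable (at u within {a..b})" if "u \<in> {a..b}" for u
    using True that by (auto simp: C1_curve_def)
  have key: "chart_direction S c a b \<gamma> a = chart_direction S c a b \<gamma> b \<longleftrightarrow>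
      (\<exists>k>0. vb = k *\<^sub>R DT T (l a) va)" if c: "c \<in> atlas S" "\<gamma> a \<in> fst c" for c
  proof -
    have la: "l a \<in> chart_dom c" "l b \<in> chart_dom c" using c closed ends aU by auto
    define L where "L = DF c (l b)"
    have L: "linear L" "bij L" using DF[OF c(1) la(2)] by (auto simp: L_def)
    have Linj: "L x = L y \<longleftrightarrow> x = y" for x y using L(2) by (simp add: bij_is_inj inj_eq)
    define wa where "wa = DT T (l a) va"
    have cva: "chart_velocity c a b \<gamma> a = L wa"
      using chart_velocity_lift(2)[OF ab \<gamma> _ c(1) la(1) dl] deck_deriv(2)[OF T(1) c(1) la(1)] ab T(2)
      by (simp add: L_def wa_def va_def)
    have cvb: "chart_velocity c a b \<gamma> b = L vb"
      using chart_velocity_lift(2)[OF ab \<gamma> _ c(1) la(2) dl] ab by (simp add: L_def vb_def)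
    have wa0: "wa \<noteq> 0"
    proof -
      have "L wa = DF c (l a) va" using deck_deriv(2)[OF T(1) c(1) la(1)] T(2) by (simp add: L_def wa_def)
      moreover have "DF c (l a) va \<noteq> 0"
        using v0 DF(2,3)[OF c(1) la(1)] by (metis bij_is_inj linear_injective_0)
      ultimately show ?thesis using L by (metis linear_0)
    qed
    define N where "N = (\<lambda>v. sqrt (riem_metric S c (F c (l b)) v v))"
    have Npos: "N (L v) > 0" if "v \<noteq> 0" for v
    proof -
      have "L v \<noteq> 0" using that L by (metis bij_is_inj linear_injective_0)
      then show ?thesis using riem_metric_at(3)[OF c(1) la(2)] by (simp add: N_def)
    qed
    have Nscale: "N (k *\<^sub>R v) = k * N v" if "k > 0" for k v
    proof -
      note bl = riem_metric_at(1)[OF c(1) la(2)]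
      have "riem_metric S c (F c (l b)) (k *\<^sub>R v) (k *\<^sub>R v) = k\<^sup>2 * riem_metric S c (F c (l b)) v v"
        unfolding bilinear_lmul[OF bl] bilinear_rmul[OF bl] by (simp add: power2_eq_square)
      then show ?thesis using that by (simp add: N_def real_sqrt_mult)
    qed
    have dir: "chart_direction S c a b \<gamma> a = chart_direction S c a b \<gamma> b \<longleftrightarrow>
        L wa /\<^sub>R N (L wa) = L vb /\<^sub>R N (L vb)"
      unfolding chart_direction_def Let_def cva cvb N_def using closed ends by simp
    show ?thesis unfolding dir wa_def[symmetric]
    proof
      assume eq: "L wa /\<^sub>R N (L wa) = L vb /\<^sub>R N (L vb)"
      define k where "k = N (L vb) / N (L wa)"
      have k: "k > 0" using Npos v0 wa0 by (simp add: k_def)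
      have "L vb = N (L vb) *\<^sub>R (L vb /\<^sub>R N (L vb))" using Npos[OF v0(2)] by simp
      also have "\<dots> = k *\<^sub>R L wa" unfolding eq[symmetric] by (simp add: k_def divide_inverse)
      also have "\<dots> = L (k *\<^sub>R wa)" using L(1) by (simp add: linear_cmul)
      finally show "\<exists>k>0. vb = k *\<^sub>R wa" using k Linj by blast
    next
      assume "\<exists>k>0. vb = k *\<^sub>R wa"
      then obtain k where k: "k > 0" "vb = k *\<^sub>R wa" by blast
      then have "L vb = k *\<^sub>R L wa" using L(1) by (simp add: linear_cmul)
      then show "L wa /\<^sub>R N (L wa) = L vb /\<^sub>R N (L vb)" using k Nscale[OF k(1)] by simp
    qed
  qed
  obtain c where "c \<in> atlas S" "l a \<in> chart_dom c" using chart_at[OF aU(1)] by blast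
  then have "\<exists>c\<in>atlas S. \<gamma> a \<in> fst c" using ends by auto
  then have "(\<forall>c\<in>atlas S. \<gamma> a \<in> fst c \<longrightarrow> chart_direction S c a b \<gamma> a = chart_direction S c a b \<gamma> b) \<longleftrightarrow>
      (\<exists>k>0. vb = k *\<^sub>R DT T (l a) va)" using key by blast
  then show ?thesis
    using regular_curve_iff[OF ab l \<gamma>] True closed unfolding regular_closed_curve_def va_def vb_def by blast
qed

end

section \<open>Angle functions\<close>

lemma cis_eq_imp:
  assumes "cis x = cis y"
  shows "\<exists>k::int. x = y + 2 * pi * k"
proof -
  have "sin x = sin y \<and> cos x = cos y" using assms by (simp add: complex_eq_iff)
  then show ?thesis using sin_cos_eq_iff[of x y] by (auto simp: mult_ac)
qed

lemma cis_add_period: "cis (x + 2 * pi * of_int k) = cis x"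
  using sin_cos_eq_iff[of "x + 2 * pi * of_int k" x] by (simp add: complex_eq_iff)

text \<open>The difference of the two functions, divided by \<open>2\<pi>\<close>, is continuous with integral values.\<close>

lemma cis_lifts_differ:
  fixes f g :: "'a::topological_space \<Rightarrow> real"
  assumes X: "connected X" and f: "continuous_on X f" and g: "continuous_on X g"
    and eq: "\<And>x. x \<in> X \<Longrightarrow> cis (f x) = cis (g x)"
  obtains k :: int where "\<And>x. x \<in> X \<Longrightarrow> f x = g x + 2 * pi * k"
proof (cases "X = {}")
  case True
  then show ?thesis using that by auto
next
  case False
  then obtain x0 where x0: "x0 \<in> X" by auto
  define h where "h = (\<lambda>x. (f x - g x) / (2 * pi))"
  have hint: "h x \<in> \<int>" if x: "x \<in> X" for x
  proof -
    obtain k :: int where "f x = g x + 2 * pi * k" using cis_eq_imp[OF eq[OF x]] by blast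
    then show ?thesis by (simp add: h_def)
  qed
  have "continuous_on X h" unfolding h_def by (intro continuous_intros f g) auto
  then have conn: "connected (h ` X)" using X by (rule connected_continuous_image)
  have const: "h x = h y" if xy: "x \<in> X" "y \<in> X" for x y
  proof (rule ccontr)
    assume ne: "h x \<noteq> h y"
    have False if that': "x \<in> X" "y \<in> X" "h x < h y" for x y
    proof -
      have "{h x..h y} \<subseteq> h ` X" using conn that' by (intro connected_contains_Icc) auto
      moreover obtain m n :: int where mn: "h x = m" "h y = n" using hint[OF that'(1)] hint[OF that'(2)] by (metis Ints_cases)
      then have "of_int m + 1/2 \<in> {h x..h y}" using that'(3) by auto
      ultimately have "of_int m + 1/2 \<in> h ` X" by blast
      then have "of_int m + 1/2 \<in> (\<int> :: real set)" using hint by (metis imageE)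
      then obtain k :: int where "of_int m + 1/2 = (of_int k :: real)" by (auto elim: Ints_cases)
      then have "(of_int (2 * m + 1) :: real) = of_int (2 * k)" by simp
      then have "2 * m + 1 = 2 * k" by (simp only: of_int_eq_iff)
      then show False by presburger
    qed
    then show False using xy ne by (metis linorder_neqE_linordered_idom)
  qed
  obtain k :: int where "h x0 = k" using hint[OF x0] by (auto elim: Ints_cases)
  then have "f x = g x + 2 * pi * k" if "x \<in> X" for x
    using const[OF that x0] by (simp add: h_def field_simps)
  then show ?thesis using that by blast
qed

text \<open>A regular curve in the plane, that is, a \<open>C\<^sup>1\<close> curve with nonvanishing velocity.\<close>

definition regular_on :: "real \<Rightarrow> real \<Rightarrow> (real \<Rightarrow> complex) \<Rightarrow> bool" where
  "regular_on a b c \<longleftrightarrow> C1_curve a b c \<and> (\<forall>u\<in>{a..b}. velocity a b c u \<noteq> 0)"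

lemma regular_onD:
  assumes "regular_on a b c"
  shows "a < b" "u \<in> {a..b} \<Longrightarrow> (c has_vector_derivative velocity a b c u) (at u within {a..b})"
    "continuous_on {a..b} (velocity a b c)" "u \<in> {a..b} \<Longrightarrow> velocity a b c u \<noteq> 0"
    "continuous_on {a..b} c"
proof -
  show "a < b" "continuous_on {a..b} (velocity a b c)" "u \<in> {a..b} \<Longrightarrow> velocity a b c u \<noteq> 0"
    using assms by (auto simp: regular_on_def C1_curve_def)
  have d: "c differentiable (at u within {a..b})" if "u \<in> {a..b}" for u
    using assms that by (auto simp: regular_on_def C1_curve_def)
  then show "u \<in> {a..b} \<Longrightarrow> (c has_vector_derivative velocity a b c u) (at u within {a..b})"
    by (simp add: velocity_works)
  show "continuous_on {a..b} c"
    using d by (simp add: continuous_on_eq_continuous_within differentiable_imp_continuous_within)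
qed

lemma regular_onI:
  assumes "a < b" "\<And>u. u \<in> {a..b} \<Longrightarrow> (c has_vector_derivative v u) (at u within {a..b})"
    and "continuous_on {a..b} v" "\<And>u. u \<in> {a..b} \<Longrightarrow> v u \<noteq> 0"
  shows "regular_on a b c"
proof -
  have v: "velocity a b c u = v u" if "u \<in> {a..b}" for u
    using velocity_eqI[OF assms(1) that assms(2)[OF that]] .
  have "continuous_on {a..b} (velocity a b c)"
    by (rule continuous_on_eq[OF assms(3)]) (simp add: v)
  moreover have "c differentiable (at u within {a..b})" if "u \<in> {a..b}" for u
    using assms(2)[OF that] by (rule differentiableI_vector)
  ultimately show ?thesis unfolding regular_on_def C1_curve_def
    using assms(1,4) v by simp
qed

lemma angle_function_sgn:
  "angle_function a b c \<theta> \<longleftrightarrow> continuous_on {a..b} \<theta> \<and> (\<forall>u\<in>{a..b}. sgn (velocity a b c u) = cis (\<theta> u))"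
  by (simp add: angle_function_def sgn_div_norm)

lemma sgn_exp_complex: "sgn (exp z) = cis (Im z)" for z :: complex
  using exp_eq_polar[of z] by (simp add: sgn_eq norm_mult)

lemma angle_function_of_log:
  assumes "continuous_on {a..b} Z" "\<And>u. u \<in> {a..b} \<Longrightarrow> velocity a b c u = exp (Z u)"
  shows "angle_function a b c (\<lambda>u. Im (Z u))"
  unfolding angle_function_sgn using assms by (auto intro!: continuous_intros simp: sgn_exp_complex)

lemma log_velocity_exists:
  assumes "regular_on a b c"
  obtains Z where "continuous_on {a..b} Z" "\<And>u. u \<in> {a..b} \<Longrightarrow> velocity a b c u = exp (Z u)"
proof -
  have "contractible {a..b}" by (intro convex_imp_contractible) simp
  then show ?thesis
    using continuous_logarithm_on_contractible[of "{a..b}" "velocity a b c"] regular_onD[OF assms] that by metis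
qed

lemma angle_function_exists: "regular_on a b c \<Longrightarrow> \<exists>\<theta>. angle_function a b c \<theta>"
  using log_velocity_exists angle_function_of_log by metis

lemma angle_functions_differ:
  assumes "angle_function a b c \<theta>" "angle_function a b c \<theta>'"
  obtains k :: int where "\<And>u. u \<in> {a..b} \<Longrightarrow> \<theta>' u = \<theta> u + 2 * pi * k"
proof (rule cis_lifts_differ[of "{a..b}" \<theta>' \<theta>])
  show "continuous_on {a..b} \<theta>'" "continuous_on {a..b} \<theta>"
    "\<And>u. u \<in> {a..b} \<Longrightarrow> cis (\<theta>' u) = cis (\<theta> u)"
    using assms unfolding angle_function_def by metis+
qed (use that in auto)

lemma i_index_eq:
  assumes "angle_function a b c \<theta>" "a \<le> b"
  shows "i_index a b c = (\<theta> b - \<theta> a) / (2 * pi)"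
proof -
  define \<theta>' where "\<theta>' = (SOME \<theta>. angle_function a b c \<theta>)"
  have "angle_function a b c \<theta>'" unfolding \<theta>'_def by (rule someI[of "angle_function a b c" \<theta>]) (rule assms)
  then obtain k :: int where "\<And>u. u \<in> {a..b} \<Longrightarrow> \<theta>' u = \<theta> u + 2 * pi * k"
    using angle_functions_differ[OF assms(1)] by blast
  then show ?thesis using assms(2) by (simp add: i_index_def Let_def flip: \<theta>'_def)
qed

lemma j_index_eq:
  assumes "angle_function a b c \<theta>" "a \<le> b"
  shows "\<exists>k::int. j_index a b c = (\<theta> b + \<theta> a) / (2 * pi) + 2 * k"
proof -
  define \<theta>' where "\<theta>' = (SOME \<theta>. angle_function a b c \<theta>)"
  have "angle_function a b c \<theta>'" unfolding \<theta>'_def by (rule someI[of "angle_function a b c" \<theta>]) (rule assms)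
  then obtain k :: int where k: "\<And>u. u \<in> {a..b} \<Longrightarrow> \<theta>' u = \<theta> u + 2 * pi * k"
    using angle_functions_differ[OF assms(1)] by blast
  have "j_index a b c = (\<theta> b + \<theta> a) / (2 * pi) + 2 * of_int k"
    using k[of a] k[of b] assms(2) by (simp add: j_index_def Let_def field_simps flip: \<theta>'_def)
  then show ?thesis by blast
qed

section \<open>Reparametrization\<close>

text \<open>The reparametrization has positive derivative, so it is increasing and maps into \<open>[a', b']\<close>.\<close>

lemma same_curveD:
  fixes c c' :: "real \<Rightarrow> 'a"
  assumes "same_curve a b c a' b' c'"
  obtains h where "a < b" "continuous_on {a..b} h" "h ` {a..b} \<subseteq> {a'..b'}" "h a = a'" "h b = b'" "a' < b'"
    "\<And>u. u \<in> {a..b} \<Longrightarrow> c u = c' (h u)" "continuous_on {a..b} (velocity a b h)"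
    "\<And>u. u \<in> {a..b} \<Longrightarrow> (h has_vector_derivative velocity a b h u) (at u within {a..b})"
    "\<And>u. u \<in> {a..b} \<Longrightarrow> velocity a b h u > 0"
proof -
  obtain h where h: "C1_curve a b h" "\<And>u. u \<in> {a..b} \<Longrightarrow> velocity a b h u > 0" "h a = a'" "h b = b'"
    "\<And>u. u \<in> {a..b} \<Longrightarrow> c u = c' (h u)"
    using assms unfolding same_curve_def by blast
  have ab: "a < b" using h(1) by (simp add: C1_curve_def)
  have hd: "(h has_vector_derivative velocity a b h u) (at u within {a..b})" if "u \<in> {a..b}" for u
    using h(1) that by (simp add: C1_curve_def velocity_works)
  have ch: "continuous_on {a..b} h"
    using hd by (meson continuous_on_eq_continuous_within has_vector_derivative_continuous)
  have strict: "h x < h y" if xy: "a \<le> x" "x < y" "y \<le> b" for x y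
  proof -
    have "continuous_on {x..y} h" using ch by (rule continuous_on_subset) (use xy in auto)
    moreover have "(h has_derivative (\<lambda>t. t * velocity a b h u)) (at u)" if "x < u" "u < y" for u
    proof -
      have "at u within {a..b} = at u" using that xy by (intro at_within_interior) auto
      then show ?thesis using hd[of u] that xy by (simp add: has_vector_derivative_def)
    qed
    ultimately obtain u where u: "x < u" "u < y" "h y - h x = (y - x) * velocity a b h u"
      using mvt[of x y h "\<lambda>u t. t * velocity a b h u"] xy by auto
    then have "h y - h x > 0" using h(2)[of u] xy by simp
    then show ?thesis by simp
  qed
  have mono: "h x \<le> h y" if "a \<le> x" "x \<le> y" "y \<le> b" for x y
    using strict[of x y] that by (cases "x = y") auto
  have "h ` {a..b} \<subseteq> {a'..b'}" using mono h(3,4) ab by (force simp: image_subset_iff)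
  moreover have "a' < b'" using strict[of a b] ab h(3,4) by simp
  ultimately show ?thesis using that[OF ab ch _ h(3,4) _ h(5) _ hd h(2)] h(1) by (simp add: C1_curve_def)
qed

lemma same_curve_velocity:
  assumes sc: "same_curve a b c a' b' c'" and reg: "regular_on a' b' c'"
  obtains h where "regular_on a b c" "continuous_on {a..b} h" "h ` {a..b} \<subseteq> {a'..b'}" "h a = a'" "h b = b'"
    "\<And>u. u \<in> {a..b} \<Longrightarrow> sgn (velocity a b c u) = sgn (velocity a' b' c' (h u))"
    "\<And>u. u \<in> {a..b} \<Longrightarrow> \<exists>k>0. velocity a b c u = k *\<^sub>R velocity a' b' c' (h u)"
proof -
  obtain h where h: "a < b" "continuous_on {a..b} h" "h ` {a..b} \<subseteq> {a'..b'}" "h a = a'" "h b = b'" "a' < b'"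
    "\<And>u. u \<in> {a..b} \<Longrightarrow> c u = c' (h u)" "continuous_on {a..b} (velocity a b h)"
    "\<And>u. u \<in> {a..b} \<Longrightarrow> (h has_vector_derivative velocity a b h u) (at u within {a..b})"
    "\<And>u. u \<in> {a..b} \<Longrightarrow> velocity a b h u > 0"
    using same_curveD[OF sc] by blast
  note R = regular_onD[OF reg]
  have d: "(c has_vector_derivative velocity a b h u *\<^sub>R velocity a' b' c' (h u)) (at u within {a..b})"
    if u: "u \<in> {a..b}" for u
  proof -
    have "h u \<in> {a'..b'}" using h(3) u by blast
    then have "(c' has_vector_derivative velocity a' b' c' (h u)) (at (h u) within h ` {a..b})"
      using R(2) h(3) has_vector_derivative_within_subset by blast
    then have "((c' \<circ> h) has_vector_derivative velocity a b h u *\<^sub>R velocity a' b' c' (h u)) (at u within {a..b})"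
      by (rule vector_diff_chain_within[OF h(9)[OF u]])
    then show ?thesis
      by (rule has_vector_derivative_transform[rotated -1]) (use u h(7) in auto)
  qed
  have v: "velocity a b c u = velocity a b h u *\<^sub>R velocity a' b' c' (h u)" if "u \<in> {a..b}" for u
    using velocity_eqI[OF h(1) that d[OF that]] .
  have nz: "velocity a b h u *\<^sub>R velocity a' b' c' (h u) \<noteq> 0" if u: "u \<in> {a..b}" for u
  proof -
    have "h u \<in> {a'..b'}" using h(3) u by blast
    then show ?thesis using h(10)[OF u] R(4)[of "h u"] by simp
  qed
  have cont: "continuous_on {a..b} (\<lambda>u. velocity a b h u *\<^sub>R velocity a' b' c' (h u))"
    by (intro continuous_intros h(8) continuous_on_compose2[OF R(3) h(2)]) (use h(3) in auto)
  have reg_c: "regular_on a b c"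
    by (rule regular_onI[OF h(1) d cont nz])
  show ?thesis
    using that[OF reg_c h(2-5)] v h(10) by (auto simp: sgn_scaleR)
qed

lemma angle_function_reparam:
  assumes sc: "same_curve a b c a' b' c'" and reg: "regular_on a' b' c'"
    and \<theta>: "angle_function a' b' c' \<theta>"
  obtains h where "h a = a'" "h b = b'" "angle_function a b c (\<theta> \<circ> h)"
proof -
  obtain h where h: "regular_on a b c" "continuous_on {a..b} h" "h ` {a..b} \<subseteq> {a'..b'}" "h a = a'" "h b = b'"
    "\<And>u. u \<in> {a..b} \<Longrightarrow> sgn (velocity a b c u) = sgn (velocity a' b' c' (h u))"
    using same_curve_velocity[OF sc reg] by metis
  have "angle_function a b c (\<theta> \<circ> h)"
    unfolding angle_function_sgn
  proof (intro conjI ballI)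
    show "continuous_on {a..b} (\<theta> \<circ> h)"
      unfolding o_def by (rule continuous_on_compose2[OF _ h(2,3)]) (use \<theta> in \<open>simp add: angle_function_def\<close>)
    show "sgn (velocity a b c u) = cis ((\<theta> \<circ> h) u)" if "u \<in> {a..b}" for u
    proof -
      have "h u \<in> {a'..b'}" using h(3) that by blast
      then show ?thesis using \<theta> h(6)[OF that] by (simp add: angle_function_sgn)
    qed
  qed
  then show ?thesis using that h by blast
qed

lemma indices_reparam:
  assumes sc: "same_curve a b c a' b' c'" and reg: "regular_on a' b' c'"
  shows "i_index a b c = i_index a' b' c'" "\<exists>k::int. j_index a b c = j_index a' b' c' + 2 * k"
proof -
  obtain \<theta> where \<theta>: "angle_function a' b' c' \<theta>" using angle_function_exists[OF reg] by blast
  obtain h where h: "h a = a'" "h b = b'" "angle_function a b c (\<theta> \<circ> h)"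
    using angle_function_reparam[OF sc reg \<theta>] by blast
  have le: "a' \<le> b'" "a \<le> b" using regular_onD(1)[OF reg] sc by (auto simp: same_curve_def C1_curve_def)
  show "i_index a b c = i_index a' b' c'"
    using i_index_eq[OF \<theta> le(1)] i_index_eq[OF h(3) le(2)] h by simp
  obtain k1 k2 :: int where "j_index a b c = (\<theta> b' + \<theta> a') / (2 * pi) + 2 * k1"
    "j_index a' b' c' = (\<theta> b' + \<theta> a') / (2 * pi) + 2 * k2"
    using j_index_eq[OF \<theta> le(1)] j_index_eq[OF h(3) le(2)] h by auto
  then have "j_index a b c = j_index a' b' c' + 2 * of_int (k1 - k2)" by simp
  then show "\<exists>k::int. j_index a b c = j_index a' b' c' + 2 * k" by blast
qed

text \<open>This form depends on the directions of the two curves at the common point only, not on angle functions or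
on the parameter interval.\<close>

lemma external_angle_eq:
  assumes t: "regular_on a b dt" and h: "regular_on a b dh"
  shows "external_angle a b dt dh =
    (THE x. - pi < x \<and> x < pi \<and> cis x * sgn (velocity a b dt b) = sgn (velocity a b dh a))"
proof -
  obtain \<theta>t where \<theta>t: "angle_function a b dt \<theta>t" using angle_function_exists[OF t] by blast
  obtain \<theta>h where \<theta>h: "angle_function a b dh \<theta>h" using angle_function_exists[OF h] by blast
  have ab: "a \<in> {a..b}" "b \<in> {a..b}" using regular_onD(1)[OF t] by auto
  have "(\<exists>\<theta>t \<theta>h. \<exists>k::int. angle_function a b dt \<theta>t \<and> angle_function a b dh \<theta>h \<and>
           x = \<theta>h a - \<theta>t b + 2 * pi * of_int k) \<longleftrightarrow>
        cis x * sgn (velocity a b dt b) = sgn (velocity a b dh a)" for x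
  proof
    assume "\<exists>\<theta>t \<theta>h. \<exists>k::int. angle_function a b dt \<theta>t \<and> angle_function a b dh \<theta>h \<and>
           x = \<theta>h a - \<theta>t b + 2 * pi * of_int k"
    then obtain \<theta>t \<theta>h and k :: int where *: "angle_function a b dt \<theta>t" "angle_function a b dh \<theta>h"
       "x = \<theta>h a - \<theta>t b + 2 * pi * of_int k" by blast
    then have "cis x = cis (\<theta>h a - \<theta>t b)" by (simp only: cis_add_period)
    then show "cis x * sgn (velocity a b dt b) = sgn (velocity a b dh a)"
      using * ab by (simp add: angle_function_sgn cis_mult)
  next
    assume "cis x * sgn (velocity a b dt b) = sgn (velocity a b dh a)"
    then have "cis (x + \<theta>t b) = cis (\<theta>h a)" using \<theta>t \<theta>h ab by (simp add: angle_function_sgn cis_mult)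
    then obtain k :: int where "x + \<theta>t b = \<theta>h a + 2 * pi * k" using cis_eq_imp by blast
    then have "x = \<theta>h a - \<theta>t b + 2 * pi * of_int k" by simp
    then show "\<exists>\<theta>t \<theta>h. \<exists>k::int. angle_function a b dt \<theta>t \<and> angle_function a b dh \<theta>h \<and>
           x = \<theta>h a - \<theta>t b + 2 * pi * of_int k" using \<theta>t \<theta>h by blast
  qed
  then show ?thesis unfolding external_angle_def by simp
qed

section \<open>Geodesics\<close>

context conformal_cover
begin

text \<open>Inserting the velocity for the test vector in the geodesic equation shows that the square of the speed has
derivative 0.\<close>

lemma geodesic_speed:
  assumes geo: "geodesic G U a b c"
  shows "C1_curve a b c"
    "\<And>u. u \<in> {a..b} \<Longrightarrow> G (c u) (velocity a b c u) (velocity a b c u) = G (c a) (velocity a b c a) (velocity a b c a)"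
proof -
  obtain c' c'' where ab: "a < b" and cU: "c ` {a..b} \<subseteq> U" and
    c': "\<And>u. u \<in> {a..b} \<Longrightarrow> (c has_vector_derivative c' u) (at u within {a..b})" and
    c'': "\<And>u. u \<in> {a..b} \<Longrightarrow> (c' has_vector_derivative c'' u) (at u within {a..b})" and
    eq: "\<And>u w. u \<in> {a..b} \<Longrightarrow> G (c u) (c'' u) w
             + frechet_derivative (\<lambda>x. G x (c' u) w) (at (c u)) (c' u)
             - frechet_derivative (\<lambda>x. G x (c' u) (c' u)) (at (c u)) w / 2 = 0"
    using geo unfolding geodesic_def by blast
  have v: "velocity a b c u = c' u" if "u \<in> {a..b}" for u
    using velocity_eqI[OF ab that c'[OF that]] .
  have cc': "continuous_on {a..b} c'"
    using c'' by (meson continuous_on_eq_continuous_within has_vector_derivative_continuous)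
  have "continuous_on {a..b} (velocity a b c)"
    by (rule continuous_on_eq[OF cc']) (simp add: v)
  moreover have "c differentiable (at u within {a..b})" if "u \<in> {a..b}" for u
    using c'[OF that] by (rule differentiableI_vector)
  ultimately show "C1_curve a b c" unfolding C1_curve_def using ab by blast
  define f where "f = (\<lambda>u. conf_factor (c u) * inner (c' u) (c' u))"
  have "(f has_vector_derivative 0) (at u within {a..b})" if u: "u \<in> {a..b}" for u
  proof -
    have z: "c u \<in> U" using cU u by auto
    define D where "D = frechet_derivative conf_factor (at (c u))"
    have D: "(conf_factor has_derivative D) (at (c u))"
      using conf_factor_differentiable[OF z] unfolding D_def by (simp add: frechet_derivative_works)
    have fr: "frechet_derivative (\<lambda>x. G x x1 x1) (at (c u)) = (\<lambda>h. D h * inner x1 x1)" for x1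
    proof -
      have "((\<lambda>x. conf_factor x * inner x1 x1) has_derivative (\<lambda>h. D h * inner x1 x1)) (at (c u))"
        by (rule has_derivative_mult_left[OF D])
      then have "((\<lambda>x. G x x1 x1) has_derivative (\<lambda>h. D h * inner x1 x1)) (at (c u))"
        by (rule has_derivative_transform_within_open[OF _ cover(1) z]) (simp add: cover_metric_conformal)
      then show ?thesis by (rule frechet_derivative_at[symmetric])
    qed
    \<comment> \<open>the geodesic equation tested with the velocity\<close>
    have e: "conf_factor (c u) * inner (c'' u) (c' u) + D (c' u) * inner (c' u) (c' u) / 2 = 0"
      using eq[OF u, of "c' u"] unfolding fr cover_metric_conformal[OF z] by simp
    have "((conf_factor \<circ> c) has_vector_derivative D (c' u)) (at u within {a..b})"
      using vector_derivative_diff_chain_within[OF c'[OF u]] has_derivative_at_withinI[OF D] by blast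
    then have 1: "((\<lambda>u. conf_factor (c u)) has_vector_derivative D (c' u)) (at u within {a..b})" by (simp add: o_def)
    have 2: "((\<lambda>u. inner (c' u) (c' u)) has_vector_derivative (inner (c' u) (c'' u) + inner (c'' u) (c' u))) (at u within {a..b})"
      by (rule bounded_bilinear.has_vector_derivative[OF bounded_bilinear_inner c''[OF u] c''[OF u]])
    have "(f has_vector_derivative
        (conf_factor (c u) * (inner (c' u) (c'' u) + inner (c'' u) (c' u)) + D (c' u) * inner (c' u) (c' u))) (at u within {a..b})"
      unfolding f_def by (rule bounded_bilinear.has_vector_derivative[OF bounded_bilinear_mult 1 2])
    moreover have "conf_factor (c u) * (inner (c' u) (c'' u) + inner (c'' u) (c' u)) + D (c' u) * inner (c' u) (c' u) = 0"
      using e by (simp add: inner_commute[of "c' u" "c'' u"] algebra_simps)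
    ultimately show ?thesis by simp
  qed
  then obtain r where r: "\<And>u. u \<in> {a..b} \<Longrightarrow> f u = r"
    using has_vector_derivative_zero_constant[OF convex_real_interval(5)] by blast
  then have fc: "f u = f a" if "u \<in> {a..b}" for u
    using r[OF that] r[of a] ab by simp
  fix u assume u: "u \<in> {a..b}"
  have "a \<in> {a..b}" using ab by simp
  then show "G (c u) (velocity a b c u) (velocity a b c u) = G (c a) (velocity a b c a) (velocity a b c a)"
    using fc[OF u] v u cU by (auto simp: cover_metric_conformal f_def image_subset_iff)
qed

text \<open>Without regularity a geodesic would have no angle function, and its indices would be meaningless.\<close>

lemma geodesic_regular:
  assumes geo: "geodesic G U a b c" and ne: "c a \<noteq> c b"
  shows "regular_on a b c"
proof (rule ccontr)
  note s = geodesic_speed[OF geo]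
  have ab: "a < b" and cU: "\<And>u. u \<in> {a..b} \<Longrightarrow> c u \<in> U" using geo by (auto simp: geodesic_def)
  assume "\<not> regular_on a b c"
  then obtain u0 where u0: "u0 \<in> {a..b}" "velocity a b c u0 = 0"
    using s(1) by (auto simp: regular_on_def)
  have "G (c a) (velocity a b c a) (velocity a b c a) = 0"
    using s(2)[OF u0(1)] u0 cover_metric_conformal[OF cU[OF u0(1)]] by simp
  then have "velocity a b c u = 0" if "u \<in> {a..b}" for u
    using s(2)[OF that] cover_metric_inner_product(3)[OF cU[OF that]] by (metis less_irrefl)
  then have "(c has_vector_derivative 0) (at u within {a..b})" if "u \<in> {a..b}" for u
    using s(1) that velocity_works unfolding C1_curve_def by metis
  then obtain r where r: "\<And>u. u \<in> {a..b} \<Longrightarrow> c u = r"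
    using has_vector_derivative_zero_constant[OF convex_real_interval(5)] by blast
  then have "c b = c a" using r[of a] r[of b] ab by simp
  then show False using ne by simp
qed

lemma geodesic_length:
  assumes geo: "geodesic G U a b c"
  shows "curve_length G a b c = (b - a) * sqrt (G (c a) (velocity a b c a) (velocity a b c a))"
proof -
  have "curve_length G a b c = integral {a..b} (\<lambda>u. sqrt (G (c a) (velocity a b c a) (velocity a b c a)))"
    unfolding curve_length_def by (intro integral_cong arg_cong[of _ _ sqrt] geodesic_speed(2)[OF geo])
  moreover have "a < b" using geo unfolding geodesic_def by (elim conjE)
  ultimately show ?thesis by simp
qed

text \<open>The winding number uses a shortest geodesic on the parameter interval of the given curve. It is obtained
from an arbitrary one by an affine change of parameter, which multiplies both sides of the geodesic
equation by the square of the factor \<open>k\<close>.\<close>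

lemma shortest_geodesic_reparam:
  assumes sg: "shortest_geodesic G U x y a b c" and ab': "a' < b'"
  obtains d where "shortest_geodesic G U x y a' b' d"
proof -
  have geo: "geodesic G U a b c" and ends: "c a = x" "c b = y" and
    min: "\<And>a' b' d. C1_curve a' b' d \<and> d ` {a'..b'} \<subseteq> U \<and> d a' = x \<and> d b' = y \<Longrightarrow>
        curve_length G a b c \<le> curve_length G a' b' d"
    using sg unfolding shortest_geodesic_def by blast+
  have ab: "a < b" and cU: "c ` {a..b} \<subseteq> U" using geo by (auto simp: geodesic_def)
  obtain c' c'' where
    c': "\<And>u. u \<in> {a..b} \<Longrightarrow> (c has_vector_derivative c' u) (at u within {a..b})" and
    c'': "\<And>u. u \<in> {a..b} \<Longrightarrow> (c' has_vector_derivative c'' u) (at u within {a..b})" and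
    eq: "\<And>u w. u \<in> {a..b} \<Longrightarrow> G (c u) (c'' u) w
             + frechet_derivative (\<lambda>x. G x (c' u) w) (at (c u)) (c' u)
             - frechet_derivative (\<lambda>x. G x (c' u) (c' u)) (at (c u)) w / 2 = 0"
    using geo unfolding geodesic_def by blast
  define k where "k = (b - a) / (b' - a')"
  have k: "k > 0" using ab ab' by (simp add: k_def)
  define s where "s = (\<lambda>u. a + k * (u - a'))"
  have sd: "(s has_vector_derivative k) (at u within X)" for u X
    unfolding s_def by (auto intro!: derivative_eq_intros)
  have s_ends: "s a' = a" "s b' = b" using ab' by (auto simp: s_def k_def)
  have sin: "s u \<in> {a..b}" if "u \<in> {a'..b'}" for u
  proof -
    have "k * (u - a') \<le> k * (b' - a')" using that k by (intro mult_left_mono) auto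
    moreover have "k * (u - a') \<ge> 0" using that k by simp
    ultimately show ?thesis using s_ends by (auto simp: s_def)
  qed
  have sim: "s ` {a'..b'} \<subseteq> {a..b}" using sin by auto
  define d where "d = c \<circ> s"
  have D1: "(d has_vector_derivative k *\<^sub>R c' (s u)) (at u within {a'..b'})" if u: "u \<in> {a'..b'}" for u
    unfolding d_def
    by (rule vector_diff_chain_within[OF sd has_vector_derivative_within_subset[OF c'[OF sin[OF u]] sim]])
  have D2: "((\<lambda>u. k *\<^sub>R c' (s u)) has_vector_derivative k *\<^sub>R k *\<^sub>R c'' (s u)) (at u within {a'..b'})"
    if u: "u \<in> {a'..b'}" for u
  proof -
    have "((c' \<circ> s) has_vector_derivative k *\<^sub>R c'' (s u)) (at u within {a'..b'})"
      by (rule vector_diff_chain_within[OF sd has_vector_derivative_within_subset[OF c''[OF sin[OF u]] sim]])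
    then show ?thesis
      using bounded_linear.has_vector_derivative[OF bounded_linear_scaleR_right, of "c' \<circ> s" _ _ k] by (simp add: o_def del: scaleR_scaleR)
  qed
  have vel: "velocity a' b' d u = k *\<^sub>R velocity a b c (s u)" if u: "u \<in> {a'..b'}" for u
    using velocity_eqI[OF ab' u D1[OF u]] velocity_eqI[OF ab sin[OF u] c'[OF sin[OF u]]] by simp
  have geo': "geodesic G U a' b' d" unfolding geodesic_def
  proof (intro conjI exI ballI allI)
    show "a' < b'" by (rule ab')
    show "d ` {a'..b'} \<subseteq> U" using cU sin by (auto simp: d_def)
    fix u assume u: "u \<in> {a'..b'}"
    show "(d has_vector_derivative k *\<^sub>R c' (s u)) (at u within {a'..b'})" by (rule D1[OF u])
    show "((\<lambda>u. k *\<^sub>R c' (s u)) has_vector_derivative k *\<^sub>R k *\<^sub>R c'' (s u)) (at u within {a'..b'})" by (rule D2[OF u])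
    fix w
    have z: "d u \<in> U" "c (s u) \<in> U" using cU sin[OF u] by (auto simp: d_def)
    define D where "D = frechet_derivative conf_factor (at (d u))"
    have D: "(conf_factor has_derivative D) (at (d u))"
      using conf_factor_differentiable[OF z(1)] unfolding D_def by (simp add: frechet_derivative_works)
    have fr: "frechet_derivative (\<lambda>x. G x x1 x2) (at (d u)) = (\<lambda>h. D h * inner x1 x2)" for x1 x2
    proof -
      have "((\<lambda>x. conf_factor x * inner x1 x2) has_derivative (\<lambda>h. D h * inner x1 x2)) (at (d u))"
        by (rule has_derivative_mult_left[OF D])
      then have "((\<lambda>x. G x x1 x2) has_derivative (\<lambda>h. D h * inner x1 x2)) (at (d u))"
        by (rule has_derivative_transform_within_open[OF _ cover(1) z(1)]) (simp add: cover_metric_conformal)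
      then show ?thesis by (rule frechet_derivative_at[symmetric])
    qed
    have lin: "D (r *\<^sub>R h) = r * D h" for r h
      using D has_derivative_linear linear_cmul by fastforce
    have du: "d u = c (s u)" by (simp add: d_def)
    have "G (d u) (c'' (s u)) w + D (c' (s u)) * inner (c' (s u)) w - D w * inner (c' (s u)) (c' (s u)) / 2 = 0"
      using eq[OF sin[OF u], of w] unfolding du[symmetric] fr .
    then have "conf_factor (d u) * inner (c'' (s u)) w + D (c' (s u)) * inner (c' (s u)) w - D w * inner (c' (s u)) (c' (s u)) / 2 = 0"
      unfolding cover_metric_conformal[OF z(1)] .
    then have "k * k * (conf_factor (d u) * inner (c'' (s u)) w + D (c' (s u)) * inner (c' (s u)) w - D w * inner (c' (s u)) (c' (s u)) / 2) = 0"
      by simp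
    then show "G (d u) (k *\<^sub>R k *\<^sub>R c'' (s u)) w
        + frechet_derivative (\<lambda>x. G x (k *\<^sub>R c' (s u)) w) (at (d u)) (k *\<^sub>R c' (s u))
        - frechet_derivative (\<lambda>x. G x (k *\<^sub>R c' (s u)) (k *\<^sub>R c' (s u))) (at (d u)) w / 2 = 0"
      unfolding fr cover_metric_conformal[OF z(1)] lin by (simp add: algebra_simps)
  qed
  have "curve_length G a' b' d = curve_length G a b c"
  proof -
    have a': "a' \<in> {a'..b'}" using ab' by simp
    have "G (d a') (velocity a' b' d a') (velocity a' b' d a') = k\<^sup>2 * G (c a) (velocity a b c a) (velocity a b c a)"
    proof -
      have "c a \<in> U" using cU ab by auto
      moreover have "d a' = c a" by (simp add: d_def s_ends)
      ultimately show ?thesis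
        unfolding vel[OF a'] s_ends by (simp add: cover_metric_conformal power2_eq_square)
    qed
    then have "curve_length G a' b' d = (b' - a') * (k * sqrt (G (c a) (velocity a b c a) (velocity a b c a)))"
      using k by (simp add: geodesic_length[OF geo'] real_sqrt_mult)
    also have "\<dots> = (b - a) * sqrt (G (c a) (velocity a b c a) (velocity a b c a))"
      using ab' by (simp add: k_def)
    finally show ?thesis by (simp add: geodesic_length[OF geo])
  qed
  then have "shortest_geodesic G U x y a' b' d"
    unfolding shortest_geodesic_def using geo' min s_ends ends by (auto simp: d_def)
  then show ?thesis using that by blast
qed

end

section \<open>Images of regular curves\<close>

lemma continuous_on_linear_family:
  fixes D :: "complex \<Rightarrow> complex \<Rightarrow> complex"
  assumes lin: "\<And>z. z \<in> V \<Longrightarrow> linear (D z)" and cont: "\<And>v. continuous_on V (\<lambda>z. D z v)"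
    and l: "continuous_on X l" "l ` X \<subseteq> V" and w: "continuous_on X w"
  shows "continuous_on X (\<lambda>x. D (l x) (w x))"
proof (rule continuous_on_eq)
  show "continuous_on X (\<lambda>x. Re (w x) *\<^sub>R D (l x) 1 + Im (w x) *\<^sub>R D (l x) \<i>)"
    by (intro continuous_intros w continuous_on_compose2[OF cont l])
  show "Re (w x) *\<^sub>R D (l x) 1 + Im (w x) *\<^sub>R D (l x) \<i> = D (l x) (w x)" if "x \<in> X" for x
    using linear_complex[OF lin, of "l x" "w x"] l that by auto
qed

lemma regular_on_compose:
  fixes f :: "complex \<Rightarrow> complex"
  assumes D: "\<And>z. z \<in> V \<Longrightarrow> (f has_derivative D z) (at z)" "\<And>v. continuous_on V (\<lambda>z. D z v)"
      "\<And>z. z \<in> V \<Longrightarrow> inj (D z)"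
    and c: "regular_on a b c" "c ` {a..b} \<subseteq> V"
  shows "regular_on a b (f \<circ> c)"
    "\<And>u. u \<in> {a..b} \<Longrightarrow> velocity a b (f \<circ> c) u = D (c u) (velocity a b c u)"
proof -
  note R = regular_onD[OF c(1)]
  have lin: "linear (D z)" if "z \<in> V" for z using D(1)[OF that] has_derivative_linear by blast
  have d: "((f \<circ> c) has_vector_derivative D (c u) (velocity a b c u)) (at u within {a..b})"
    if u: "u \<in> {a..b}" for u
  proof -
    have "c u \<in> V" using c(2) u by blast
    then show ?thesis
      using vector_derivative_diff_chain_within[OF R(2)[OF u]] has_derivative_at_withinI[OF D(1)] by blast
  qed
  show "velocity a b (f \<circ> c) u = D (c u) (velocity a b c u)" if "u \<in> {a..b}" for u
    by (rule velocity_eqI[OF R(1) that d[OF that]])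
  show "regular_on a b (f \<circ> c)"
  proof (rule regular_onI[OF R(1) d])
    show "continuous_on {a..b} (\<lambda>u. D (c u) (velocity a b c u))"
      by (rule continuous_on_linear_family[OF lin D(2) R(5) c(2) R(3)])
    show "D (c u) (velocity a b c u) \<noteq> 0" if "u \<in> {a..b}" for u
    proof -
      have "c u \<in> V" using c(2) that by blast
      then show ?thesis using R(4)[OF that] lin D(3) by (metis linear_injective_0)
    qed
  qed
qed

lemma regular_on_cong:
  assumes "\<And>u. u \<in> {a..b} \<Longrightarrow> c u = d u" "regular_on a b c"
  shows "regular_on a b d"
proof (rule regular_onI[where v = "velocity a b c"])
  note R = regular_onD[OF assms(2)]
  show "a < b" "continuous_on {a..b} (velocity a b c)" "\<And>u. u \<in> {a..b} \<Longrightarrow> velocity a b c u \<noteq> 0"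
    using R by auto
  show "(d has_vector_derivative velocity a b c u) (at u within {a..b})" if "u \<in> {a..b}" for u
    by (rule has_vector_derivative_transform[OF that _ R(2)[OF that]]) (simp add: assms(1))
qed

context conformal_cover
begin

section \<open>Lifts and homotopy classes\<close>

lemma lift_curve_props:
  assumes "a \<le> b" "continuous_on {a..b} \<gamma>" "\<gamma> ` {a..b} \<subseteq> points S" "z \<in> U" "pr z = \<gamma> a"
  shows "continuous_on {a..b} (lift_curve U pr a b \<gamma> z)" "lift_curve U pr a b \<gamma> z ` {a..b} \<subseteq> U"
    "\<And>u. u \<in> {a..b} \<Longrightarrow> pr (lift_curve U pr a b \<gamma> z u) = \<gamma> u" "lift_curve U pr a b \<gamma> z a = z"
proof -
  define P where "P = (\<lambda>l. continuous_on {a..b} l \<and> l ` {a..b} \<subseteq> U \<and> (\<forall>u\<in>{a..b}. pr (l u) = \<gamma> u) \<and> l a = z)"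
  obtain l where "continuous_on {a..b} l" "l ` {a..b} \<subseteq> U" "\<And>u. u \<in> {a..b} \<Longrightarrow> pr (l u) = \<gamma> u" "l a = z"
    by (rule covering_lift_interval[OF cover(3) assms(2,3,1,4,5)]) (rule that)
  then have "P l" by (simp add: P_def)
  then have "P (SOME l. P l)" by (rule someI[of P])
  then have "P (lift_curve U pr a b \<gamma> z)" by (simp add: lift_curve_def P_def)
  then show "continuous_on {a..b} (lift_curve U pr a b \<gamma> z)" "lift_curve U pr a b \<gamma> z ` {a..b} \<subseteq> U"
    "\<And>u. u \<in> {a..b} \<Longrightarrow> pr (lift_curve U pr a b \<gamma> z u) = \<gamma> u" "lift_curve U pr a b \<gamma> z a = z"
    by (auto simp: P_def)
qed

lemma lift_unique:
  assumes "continuous_on {a..b::real} g" "g ` {a..b} \<subseteq> U" "continuous_on {a..b} h" "h ` {a..b} \<subseteq> U"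
    "\<And>u. u \<in> {a..b} \<Longrightarrow> pr (g u) = pr (h u)" "g a = h a" "u \<in> {a..b}"
  shows "g u = h u"
  using covering_lift_interval_unique[OF cover(3) assms] .

text \<open>The fibres of \<open>pr\<close> are discrete.\<close>

lemma lift_constant:
  assumes "continuous_on {a..b::real} g" "g ` {a..b} \<subseteq> U" "\<And>u. u \<in> {a..b} \<Longrightarrow> pr (g u) = p" "u \<in> {a..b}"
  shows "g u = g a"
proof -
  have "a \<in> {a..b}" using assms(4) by auto
  then show ?thesis
    by (intro lift_unique[OF assms(1,2) continuous_on_const _ _ _ assms(4)]) (use assms in auto)
qed

lemma deck_unique:
  assumes "deck_transformation U pr T1" "deck_transformation U pr T2" "z \<in> U" "T1 z = T2 z" "x \<in> U"
  shows "T1 x = T2 x"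
  using covering_self_map_unique[OF cover(3) connU deckD(1,2,4)[OF assms(1)] deckD(1,2,4)[OF assms(2)] assms(3-5)] .

text \<open>A homotopy below lifts, and its lift is constant on the two sides where the end points are. Conversely \<open>U\<close>
is simply connected.\<close>

lemma homotopic_projections_iff:
  assumes m1: "continuous_on {0..1} m1" "m1 ` {0..1} \<subseteq> U" and m2: "continuous_on {0..1} m2" "m2 ` {0..1} \<subseteq> U"
    and start: "m1 0 = m2 0"
  shows "homotopic_paths (points S) (pr \<circ> m1) (pr \<circ> m2) \<longleftrightarrow> m1 1 = m2 1"
proof
  assume "m1 1 = m2 1"
  then have "homotopic_paths U m1 m2"
    using cover(2) m1 m2 start unfolding simply_connected_eq_homotopic_paths
    by (auto simp: path_def path_image_def pathstart_def pathfinish_def)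
  then show "homotopic_paths (points S) (pr \<circ> m1) (pr \<circ> m2)"
    by (rule homotopic_paths_continuous_image[OF _ contpr]) (use pr_points in auto)
next
  assume "homotopic_paths (points S) (pr \<circ> m1) (pr \<circ> m2)"
  then obtain h where h: "continuous_on ({0..1::real} \<times> {0..1}) h" "h ` ({0..1} \<times> {0..1}) \<subseteq> points S"
    "\<And>x. x \<in> {0..1} \<Longrightarrow> h (0, x) = pr (m1 x)" "\<And>x. x \<in> {0..1} \<Longrightarrow> h (1, x) = pr (m2 x)"
    "\<And>t. t \<in> {0..1} \<Longrightarrow> h (t, 0) = pr (m1 0)" "\<And>t. t \<in> {0..1} \<Longrightarrow> h (t, 1) = pr (m1 1)"
    unfolding homotopic_paths by (auto simp: pathstart_def pathfinish_def image_subset_iff Pi_iff)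
  have m10: "m1 0 \<in> U" using m1 by auto
  obtain k where k: "continuous_on ({0..1} \<times> {0..1}) k" "k ` ({0..1} \<times> {0..1}) \<subseteq> U"
    "\<And>z. z \<in> {0..1} \<times> {0..1} \<Longrightarrow> pr (k z) = h z" "k (0, 0) = m1 0"
    using covering_lift_box[OF cover(3) h(1,2), of "(0, 0)" "m1 0"] h(3)[of 0] m10 by auto
  have ch: "continuous_on {0..1} (\<lambda>x. k (t, x))" if "t \<in> {0..1}" for t
    by (rule continuous_on_compose2[OF k(1)]) (use that in \<open>auto intro!: continuous_intros\<close>)
  have cv: "continuous_on {0..1} (\<lambda>t. k (t, x))" if "x \<in> {0..1}" for x
    by (rule continuous_on_compose2[OF k(1)]) (use that in \<open>auto intro!: continuous_intros\<close>)
  have im: "k (t, x) \<in> U" if "t \<in> {0..1}" "x \<in> {0..1}" for t x using k(2) that by blast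
  have left: "k (1, 0) = k (0, 0)"
    by (rule lift_constant[of 0 1 "\<lambda>t. k (t, 0)"]) (use cv im k(3) h(5) in auto)
  have right: "k (1, 1) = k (0, 1)"
    by (rule lift_constant[of 0 1 "\<lambda>t. k (t, 1)"]) (use cv im k(3) h(6) in auto)
  have "k (0, 1) = m1 1"
    by (rule lift_unique[of 0 1 "\<lambda>x. k (0, x)" m1]) (use ch im k h(3) m1 in auto)
  moreover have "k (1, 1) = m2 1"
    by (rule lift_unique[of 0 1 "\<lambda>x. k (1, x)" m2]) (use ch im k h(4) m2 left start in auto)
  ultimately show "m1 1 = m2 1" using right by simp
qed

lemma unit_param_in:
  assumes "a < b" "s \<in> {0..1::real}"
  shows "a + s * (b - a) \<in> {a..b}"
proof -
  have "s * (b - a) \<le> 1 * (b - a)" using assms by (intro mult_right_mono) auto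
  moreover have "0 \<le> s * (b - a)" using assms by simp
  ultimately show ?thesis by simp
qed

lemma unit_param_continuous:
  assumes "a < b" "continuous_on {a..b} l"
  shows "continuous_on {0..1} (unit_interval_param a b l)" "unit_interval_param a b l ` {0..1} \<subseteq> l ` {a..b}"
proof -
  have in_ab: "a + s * (b - a) \<in> {a..b}" if "s \<in> {0..1}" for s
    using unit_param_in[OF assms(1) that] .
  show "continuous_on {0..1} (unit_interval_param a b l)"
    unfolding unit_interval_param_def
    by (rule continuous_on_compose2[OF assms(2)]) (use in_ab in \<open>auto intro!: continuous_intros\<close>)
  show "unit_interval_param a b l ` {0..1} \<subseteq> l ` {a..b}"
    unfolding unit_interval_param_def using in_ab by blast
qed

lemma homotopic_params_iff:
  assumes l1: "a1 < b1" "continuous_on {a1..b1} l1" "l1 ` {a1..b1} \<subseteq> U" "\<And>u. u \<in> {a1..b1} \<Longrightarrow> pr (l1 u) = \<gamma>1 u"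
    and l2: "a2 < b2" "continuous_on {a2..b2} l2" "l2 ` {a2..b2} \<subseteq> U" "\<And>u. u \<in> {a2..b2} \<Longrightarrow> pr (l2 u) = \<gamma>2 u"
    and start: "l1 a1 = l2 a2"
  shows "same_pi1_class S a1 b1 \<gamma>1 a2 b2 \<gamma>2 \<longleftrightarrow> l1 b1 = l2 b2"
proof -
  have hom: "homotopic_paths (points S) (pr \<circ> unit_interval_param a b l) (unit_interval_param a b \<gamma>)"
    if l: "a < b" "continuous_on {a..b} l" "l ` {a..b} \<subseteq> U" "\<And>u. u \<in> {a..b} \<Longrightarrow> pr (l u) = \<gamma> u"
    for a b l and \<gamma> :: "real \<Rightarrow> 'm"
  proof (rule homotopic_paths_eq)
    note c = unit_param_continuous[OF l(1,2)]
    have in_ab: "a + s * (b - a) \<in> {a..b}" if "s \<in> {0..1}" for s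
      using unit_param_in[OF l(1) that] .
    show "path (pr \<circ> unit_interval_param a b l)"
      unfolding path_def by (rule continuous_on_compose[OF c(1) continuous_on_subset[OF contpr]]) (use c(2) l(3) in blast)
    show "path_image (pr \<circ> unit_interval_param a b l) \<subseteq> points S"
      unfolding path_image_def image_comp[symmetric] pr_points[symmetric]
      by (intro image_mono order_trans[OF c(2) l(3)])
    show "(pr \<circ> unit_interval_param a b l) t = unit_interval_param a b \<gamma> t" if "t \<in> {0..1}" for t
      using l(4) in_ab[OF that] by (simp add: unit_interval_param_def)
  qed
  have "homotopic_paths (points S) (pr \<circ> unit_interval_param a1 b1 l1) (pr \<circ> unit_interval_param a2 b2 l2) \<longleftrightarrow>
      unit_interval_param a1 b1 l1 1 = unit_interval_param a2 b2 l2 1"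
    by (rule homotopic_projections_iff)
      (use unit_param_continuous[OF l1(1,2)] unit_param_continuous[OF l2(1,2)] l1(3) l2(3) start in
        \<open>auto simp: unit_interval_param_def\<close>)
  moreover have "unit_interval_param a b l 1 = l b" for a b and l :: "real \<Rightarrow> complex"
    by (simp add: unit_interval_param_def)
  ultimately show ?thesis
    unfolding same_pi1_class_def using hom[OF l1] hom[OF l2]
    by (metis homotopic_paths_trans homotopic_paths_sym)
qed

lemma null_homotopic_iff:
  assumes l: "a < b" "continuous_on {a..b} l" "l ` {a..b} \<subseteq> U" "\<And>u. u \<in> {a..b} \<Longrightarrow> pr (l u) = \<gamma> u"
  shows "null_homotopic S a b \<gamma> \<longleftrightarrow> l b = l a"
proof -
  have a: "l a \<in> U" "pr (l a) = \<gamma> a" using l by auto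
  have "same_pi1_class S a b \<gamma> a b (\<lambda>_. \<gamma> a) \<longleftrightarrow> l b = l a"
    by (rule homotopic_params_iff[OF l, where ?l2.0 = "\<lambda>_. l a"]) (use a l(1) in auto)
  then show ?thesis by (simp add: same_pi1_class_def null_homotopic_def unit_interval_param_def)
qed

section \<open>The winding number\<close>

lemma deck_regular:
  assumes T: "deck_transformation U pr T" and c: "regular_on a b c" "c ` {a..b} \<subseteq> U"
  shows "regular_on a b (T \<circ> c)"
    "\<And>u. u \<in> {a..b} \<Longrightarrow> velocity a b (T \<circ> c) u = DT T (c u) (velocity a b c u)"
proof -
  have D: "(T has_derivative DT T z) (at z)" if z: "z \<in> U" for z
  proof -
    obtain c where "c \<in> atlas S" "z \<in> chart_dom c" by (rule chart_at[OF z])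
    then show ?thesis by (rule deck_deriv(1)[OF T])
  qed
  have inj: "inj (DT T z)" if z: "z \<in> U" for z
  proof -
    obtain k where k: "k > 0" "\<And>v. norm (DT T z v) = k * norm v" using deck_similarity[OF T z] by blast
    have "v = 0" if "DT T z v = 0" for v
    proof -
      have "k * norm v = 0" using k(2)[of v] that by simp
      then show ?thesis using k(1) by simp
    qed
    then show ?thesis using deck_linear[OF T z] linear_injective_0 by blast
  qed
  show "regular_on a b (T \<circ> c)"
    "\<And>u. u \<in> {a..b} \<Longrightarrow> velocity a b (T \<circ> c) u = DT T (c u) (velocity a b c u)"
    by (rule regular_on_compose[OF D deck_continuous_derivative[OF T] inj c]; assumption)+
qed

text \<open>All shortest geodesics from \<open>x\<close> to \<open>y\<close> are reparametrizations of one of them. The second lift of the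
closed geodesic is \<open>T \<circ> dt\<close>, so that its initial direction is determined by \<open>T\<close> and by the initial direction of
\<open>dt\<close>. Hence the terms that the geodesic contributes to the winding number do not depend on \<open>[a, b]\<close>.\<close>

lemma geodesic_terms:
  assumes tame: "tame_conformally_euclidean_structure S U pr"
    and xy: "x \<in> U" "y \<in> U" "x \<noteq> y" and T: "deck_transformation U pr T" "T x = y"
  obtains i j e where "\<And>a b dt dh. a < b \<Longrightarrow> dt = (SOME d. shortest_geodesic G U x y a b d) \<Longrightarrow>
      dh = lift_curve U pr a b (pr \<circ> dt) (dt b) \<Longrightarrow>
      i_index a b dt = i \<and> (\<exists>k::int. j_index a b dt = j + 2 * k) \<and> external_angle a b dt dh = e"
proof -
  have "\<forall>x\<in>U. \<forall>y\<in>U. x \<noteq> y \<longrightarrow> (\<exists>a b c. shortest_geodesic G U x y a b c \<and>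
      (\<forall>a' b' c'. shortest_geodesic G U x y a' b' c' \<longrightarrow> same_curve a b c a' b' c'))"
    using tame unfolding tame_conformally_euclidean_structure_def by (elim conjE)
  then have "\<exists>a b c. shortest_geodesic G U x y a b c \<and>
      (\<forall>a' b' c'. shortest_geodesic G U x y a' b' c' \<longrightarrow> same_curve a b c a' b' c')"
    using xy by simp
  then obtain a0 b0 c0 where c0: "shortest_geodesic G U x y a0 b0 c0"
    "\<And>a' b' c'. shortest_geodesic G U x y a' b' c' \<Longrightarrow> same_curve a0 b0 c0 a' b' c'"
    by (elim exE conjE) (rule that, assumption, elim allE impE, assumption+)
  have lin: "linear (DT T x)" by (rule deck_linear[OF T(1) xy(1)])
  have "i_index a b dt = i_index a0 b0 c0 \<and> (\<exists>k::int. j_index a b dt = j_index a0 b0 c0 + 2 * k) \<and>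
      external_angle a b dt dh = (THE s. - pi < s \<and> s < pi \<and>
         cis s * sgn (velocity a0 b0 c0 b0) = sgn (DT T x (velocity a0 b0 c0 a0)))"
    if ab: "a < b" and dt: "dt = (SOME d. shortest_geodesic G U x y a b d)"
      and dh: "dh = lift_curve U pr a b (pr \<circ> dt) (dt b)" for a b dt dh
  proof -
    have "\<exists>d. shortest_geodesic G U x y a b d" using shortest_geodesic_reparam[OF c0(1) ab] by blast
    then have sg: "shortest_geodesic G U x y a b dt" unfolding dt by (rule someI_ex)
    then have geo: "geodesic G U a b dt" "dt a = x" "dt b = y" by (simp_all add: shortest_geodesic_def)
    have reg: "regular_on a b dt" using geodesic_regular[OF geo(1)] geo xy by simp
    have im: "dt ` {a..b} \<subseteq> U" using geo(1) by (simp add: geodesic_def)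
    have sc: "same_curve a0 b0 c0 a b dt" by (rule c0(2)[OF sg])
    obtain h where h: "regular_on a0 b0 c0" "continuous_on {a0..b0} h" "h a0 = a" "h b0 = b"
      "\<And>u. u \<in> {a0..b0} \<Longrightarrow> \<exists>k>0. velocity a0 b0 c0 u = k *\<^sub>R velocity a b dt (h u)"
      using same_curve_velocity[OF sc reg] by metis
    have a0b0: "a0 \<in> {a0..b0}" "b0 \<in> {a0..b0}" using regular_onD(1)[OF h(1)] by auto
    obtain k1 where k1: "k1 > 0" "velocity a0 b0 c0 a0 = k1 *\<^sub>R velocity a b dt a"
      using h(5)[OF a0b0(1)] h(3) by auto
    obtain k2 where k2: "k2 > 0" "velocity a0 b0 c0 b0 = k2 *\<^sub>R velocity a b dt b"
      using h(5)[OF a0b0(2)] h(4) by auto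
    note R = regular_onD[OF reg] and TR = deck_regular[OF T(1) reg im]
    have pc: "continuous_on {a..b} (pr \<circ> dt)"
      by (rule continuous_on_compose[OF R(5) continuous_on_subset[OF contpr im]])
    have pim: "(pr \<circ> dt) ` {a..b} \<subseteq> points S" using im pr_points by auto
    have pst: "pr (dt b) = (pr \<circ> dt) a" using geo deckD(4)[OF T(1) xy(1)] T(2) by simp
    have dbU: "dt b \<in> U" using geo xy by simp
    note L = lift_curve_props[OF less_imp_le[OF ab] pc pim dbU pst, folded dh]
    have dhT: "(T \<circ> dt) u = dh u" if u: "u \<in> {a..b}" for u
    proof (rule lift_unique[OF _ _ L(1,2) _ _ u])
      show "continuous_on {a..b} (T \<circ> dt)"
        by (rule continuous_on_compose[OF R(5) continuous_on_subset[OF deckD(1)[OF T(1)] im]])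
      show "(T \<circ> dt) ` {a..b} \<subseteq> U" using im deckD(2)[OF T(1)] by auto
      show "pr ((T \<circ> dt) u) = pr (dh u)" if "u \<in> {a..b}" for u
      proof -
        have "dt u \<in> U" using im that by blast
        then show ?thesis using L(3)[OF that] deckD(4)[OF T(1)] by simp
      qed
      show "(T \<circ> dt) a = dh a" using L(4) geo T(2) by simp
    qed
    have regh: "regular_on a b dh" using regular_on_cong[OF dhT TR(1)] by simp
    have aab: "a \<in> {a..b}" using ab by simp
    have "velocity a b dh a = velocity a b (T \<circ> dt) a"
      by (rule velocity_cong) (use dhT aab in auto)
    then have va: "velocity a b dh a = DT T x (velocity a b dt a)" using TR(2)[OF aab] geo by simp
    have "sgn (velocity a b dh a) = sgn (DT T x (velocity a0 b0 c0 a0))"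
      unfolding va k1(2) using k1(1) by (simp add: linear_cmul[OF lin] sgn_scaleR)
    moreover have "sgn (velocity a b dt b) = sgn (velocity a0 b0 c0 b0)"
      unfolding k2(2) using k2(1) by (simp add: sgn_scaleR)
    ultimately have "external_angle a b dt dh = (THE s. - pi < s \<and> s < pi \<and>
         cis s * sgn (velocity a0 b0 c0 b0) = sgn (DT T x (velocity a0 b0 c0 a0)))"
      unfolding external_angle_eq[OF reg regh] by simp
    moreover obtain k :: int where "j_index a0 b0 c0 = j_index a b dt + 2 * of_int k"
      using indices_reparam(2)[OF sc reg] by blast
    then have "j_index a b dt = j_index a0 b0 c0 + 2 * of_int (- k)" by simp
    ultimately show ?thesis using indices_reparam(1)[OF sc reg] by metis
  qed
  then show ?thesis using that by blast
qed

lemma curve_sign_eq: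
  assumes T: "deck_transformation U pr T" "T (l a) = l b" "l a \<in> U" and l: "l = lift_curve U pr a b \<gamma> z"
  shows "curve_sign U pr a b \<gamma> z = (if \<forall>x\<in>U. plane_det (DT T x) > 0 then 1 else - 1)"
proof -
  define T' where "T' = (SOME T. deck_transformation U pr T \<and> T (l a) = l b)"
  have T': "deck_transformation U pr T' \<and> T' (l a) = l b" unfolding T'_def by (rule someI[of _ T]) (use T in auto)
  have eq: "T' x = T x" if "x \<in> U" for x using deck_unique[of T' T "l a" x] T T' that by simp
  have "DT T' x = DT T x" if x: "x \<in> U" for x
  proof -
    obtain c where "c \<in> atlas S" "x \<in> chart_dom c" using chart_at[OF x] .
    then have "(T' has_derivative DT T' x) (at x)" by (rule deck_deriv(1)[OF conjunct1[OF T']])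
    then have "T' differentiable (at x)" by (auto simp: differentiable_def)
    then show ?thesis by (rule frechet_derivative_transform_within_open[OF _ cover(1) x]) (rule eq)
  qed
  then show ?thesis unfolding curve_sign_def Let_def l[symmetric] T'_def[symmetric] by simp
qed

text \<open>A deck transformation with a fixed point is the identity.\<close>

lemma deck_identity:
  assumes T: "deck_transformation U pr T" "z \<in> U" "T z = z" and x: "x \<in> U"
  shows "plane_det (DT T x) > 0"
proof -
  have id: "deck_transformation U pr (\<lambda>x. x)"
    unfolding deck_transformation_def by (auto intro!: exI[of _ "\<lambda>x. x"] homeomorphism_ident)
  have eq: "x = T x" if "x \<in> U" for x using deck_unique[OF id T(1,2)] T(3) that by simp
  have "(T has_derivative (\<lambda>h. h)) (at x)"
    by (rule has_derivative_transform_within_open[OF has_derivative_ident cover(1) x]) (rule eq)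
  then have "DT T x = (\<lambda>h. h)" by (rule frechet_derivative_at[symmetric])
  then show ?thesis by (simp add: plane_det_def)
qed

text \<open>For lifts with the same end the contributions of the geodesic agree, and what remains is a comparison of
the lifts alone.\<close>

theorem based_winding_number_eq_iff:
  assumes tame: "tame_conformally_euclidean_structure S U pr"
    and ab: "a1 < b1" "a2 < b2"
    and l1: "l1 = lift_curve U pr a1 b1 \<gamma>1 z" "continuous_on {a1..b1} l1" "l1 ` {a1..b1} \<subseteq> U"
      "\<And>u. u \<in> {a1..b1} \<Longrightarrow> pr (l1 u) = \<gamma>1 u" "l1 a1 = z" "l1 b1 = q"
    and l2: "l2 = lift_curve U pr a2 b2 \<gamma>2 z" "continuous_on {a2..b2} l2" "l2 ` {a2..b2} \<subseteq> U"
      "\<And>u. u \<in> {a2..b2} \<Longrightarrow> pr (l2 u) = \<gamma>2 u" "l2 a2 = z" "l2 b2 = q"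
    and T: "deck_transformation U pr T" "T z = q" and z: "z \<in> U"
  shows "based_winding_number S U pr z a1 b1 \<gamma>1 = based_winding_number S U pr z a2 b2 \<gamma>2 \<longleftrightarrow>
    (if \<forall>x\<in>U. plane_det (DT T x) > 0 then i_index a1 b1 l1 = i_index a2 b2 l2
     else \<exists>k::int. j_index a1 b1 l1 = j_index a2 b2 l2 + 2 * k)"
proof -
  have q: "q \<in> U" using deckD(3)[OF T(1) z] T(2) by simp
  have n1: "null_homotopic S a1 b1 \<gamma>1 \<longleftrightarrow> q = z" using null_homotopic_iff[OF ab(1) l1(2-4)] l1(5,6) by simp
  have n2: "null_homotopic S a2 b2 \<gamma>2 \<longleftrightarrow> q = z" using null_homotopic_iff[OF ab(2) l2(2-4)] l2(5,6) by simp
  have s1: "curve_sign U pr a1 b1 \<gamma>1 z = (if \<forall>x\<in>U. plane_det (DT T x) > 0 then 1 else - 1)"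
    by (rule curve_sign_eq[OF T(1) _ _ l1(1)]) (use l1 T z in auto)
  have s2: "curve_sign U pr a2 b2 \<gamma>2 z = (if \<forall>x\<in>U. plane_det (DT T x) > 0 then 1 else - 1)"
    by (rule curve_sign_eq[OF T(1) _ _ l2(1)]) (use l2 T z in auto)
  show ?thesis
  proof (cases "q = z")
    case True
    then have "\<forall>x\<in>U. plane_det (DT T x) > 0" using deck_identity[OF T(1) z] T(2) by simp
    then show ?thesis
      using True n1 n2 by (simp add: based_winding_number_def Let_def flip: l1(1) l2(1))
  next
    case False
    obtain i j e where ije: "\<And>a b dt dh. a < b \<Longrightarrow> dt = (SOME d. shortest_geodesic G U z q a b d) \<Longrightarrow>
      dh = lift_curve U pr a b (pr \<circ> dt) (dt b) \<Longrightarrow>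
      i_index a b dt = i \<and> (\<exists>k::int. j_index a b dt = j + 2 * k) \<and> external_angle a b dt dh = e"
      using geodesic_terms[OF tame z q _ T] False by metis
    define dt1 where "dt1 = (SOME d. shortest_geodesic G U z q a1 b1 d)"
    define dt2 where "dt2 = (SOME d. shortest_geodesic G U z q a2 b2 d)"
    define dh1 where "dh1 = lift_curve U pr a1 b1 (pr \<circ> dt1) (dt1 b1)"
    define dh2 where "dh2 = lift_curve U pr a2 b2 (pr \<circ> dt2) (dt2 b2)"
    have e1: "i_index a1 b1 dt1 = i" "external_angle a1 b1 dt1 dh1 = e"
      using ije[OF ab(1) dt1_def dh1_def] by auto
    have e2: "i_index a2 b2 dt2 = i" "external_angle a2 b2 dt2 dh2 = e"
      using ije[OF ab(2) dt2_def dh2_def] by auto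
    obtain k1 :: int where k1: "j_index a1 b1 dt1 = j + 2 * of_int k1" using ije[OF ab(1) dt1_def dh1_def] by blast
    obtain k2 :: int where k2: "j_index a2 b2 dt2 = j + 2 * of_int k2" using ije[OF ab(2) dt2_def dh2_def] by blast
    have w1: "based_winding_number S U pr z a1 b1 \<gamma>1 =
      (if \<forall>x\<in>U. plane_det (DT T x) > 0 then Inl (i_index a1 b1 l1 - i - e / (2 * pi))
       else Inr (range (\<lambda>k::int. j_index a1 b1 l1 - (j + 2 * of_int k1) - e / (2 * pi) + 2 * of_int k)))"
      using False n1 s1
      unfolding based_winding_number_def Let_def l1(1)[symmetric] l1(5,6) dt1_def[symmetric] dh1_def[symmetric] e1 k1
      by simp
    have w2: "based_winding_number S U pr z a2 b2 \<gamma>2 =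
      (if \<forall>x\<in>U. plane_det (DT T x) > 0 then Inl (i_index a2 b2 l2 - i - e / (2 * pi))
       else Inr (range (\<lambda>k::int. j_index a2 b2 l2 - (j + 2 * of_int k2) - e / (2 * pi) + 2 * of_int k)))"
      using False n2 s2
      unfolding based_winding_number_def Let_def l2(1)[symmetric] l2(5,6) dt2_def[symmetric] dh2_def[symmetric] e2 k2
      by simp
    have coset: "range (\<lambda>k::int. A - (j + 2 * of_int k1) - r + 2 * of_int k) = range (\<lambda>k::int. B - (j + 2 * of_int k2) - r + 2 * of_int k)
       \<longleftrightarrow> (\<exists>k::int. A = B + 2 * of_int k)" (is "?L \<longleftrightarrow> ?R") for A B r :: real
    proof
      assume ?L
      then have "A - (j + 2 * of_int k1) - r + 2 * of_int 0 \<in> range (\<lambda>k::int. B - (j + 2 * of_int k2) - r + 2 * of_int k)"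
        by blast
      then obtain k :: int where "A - (j + 2 * of_int k1) - r = B - (j + 2 * of_int k2) - r + 2 * of_int k" by auto
      then have "A = B + 2 * of_int (k + k1 - k2)" by simp
      then show ?R by blast
    next
      assume ?R
      then obtain m :: int where m: "A = B + 2 * of_int m" by blast
      have "A - (j + 2 * of_int k1) - r + 2 * of_int k = B - (j + 2 * of_int k2) - r + 2 * of_int (k + m + k2 - k1)" for k
        using m by simp
      moreover have "B - (j + 2 * of_int k2) - r + 2 * of_int k = A - (j + 2 * of_int k1) - r + 2 * of_int (k - m - k2 + k1)" for k
        using m by simp
      ultimately show ?L by (metis (no_types, lifting) image_cong rangeI subsetI subset_antisym image_subset_iff)
    qed
    show ?thesis unfolding w1 w2 by (simp add: coset)
  qed
qed

end

section \<open>The closing condition as a condition on the turning\<close>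

text \<open>The condition of equal directions, in a form that is compatible with angle functions.\<close>

lemma positive_multiple_iff:
  fixes x y :: complex
  assumes "x \<noteq> 0" "y \<noteq> 0"
  shows "(\<exists>k>0. x = k *\<^sub>R y) \<longleftrightarrow> sgn x = sgn y"
proof
  assume "sgn x = sgn y"
  have "x = norm x *\<^sub>R sgn x" using assms by (simp add: sgn_div_norm)
  also have "\<dots> = (norm x * inverse (norm y)) *\<^sub>R y"
    unfolding \<open>sgn x = sgn y\<close> by (simp add: sgn_div_norm)
  finally show "\<exists>k>0. x = k *\<^sub>R y"
    using assms by (intro exI[of _ "norm x * inverse (norm y)"]) simp
qed (auto simp: sgn_scaleR)

lemma regular_on_affine:
  assumes l: "regular_on a b l"
  shows "same_curve 0 1 (unit_interval_param a b l) a b l"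
    and "regular_on 0 1 (unit_interval_param a b l)"
proof -
  have ab: "a < b" using regular_onD(1)[OF l] .
  define h where "h = (\<lambda>u::real. a + u * (b - a))"
  have hd: "(h has_vector_derivative (b - a)) (at u within X)" for u X
    unfolding h_def by (auto intro!: derivative_eq_intros)
  have v: "velocity 0 1 h u = b - a" if "u \<in> {0..1}" for u
    by (rule velocity_eqI[OF zero_less_one that hd])
  have "continuous_on {0..1} (velocity 0 1 h)"
    by (rule continuous_on_eq[OF continuous_on_const[of _ "b - a"]]) (simp add: v)
  moreover have "h differentiable (at u within {0..1})" for u
    using hd by (rule differentiableI_vector)
  ultimately have "C1_curve 0 1 h" unfolding C1_curve_def by simp
  then show sc: "same_curve 0 1 (unit_interval_param a b l) a b l"
    unfolding same_curve_def using v ab by (auto intro!: exI[of _ h] simp: h_def unit_interval_param_def)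
  show "regular_on 0 1 (unit_interval_param a b l)"
    by (rule same_curve_velocity[OF sc l])
qed

lemma same_curve_param:
  fixes c c' :: "real \<Rightarrow> 'a"
  assumes "same_curve a b c a' b' c'"
  obtains h where "C1_curve a b h" "\<forall>u\<in>{a..b}. velocity a b h u > 0" "h a = a'" "h b = b'"
    "\<forall>u\<in>{a..b}. c u = c' (h u)" "\<forall>u\<in>{a..b}. h u \<in> {a'..b'}"
proof -
  obtain h where h: "C1_curve a b h" "\<forall>u\<in>{a..b}. velocity a b h u > 0" "h a = a'" "h b = b'"
    "\<forall>u\<in>{a..b}. c u = c' (h u)"
    using assms unfolding same_curve_def by blast
  have "same_curve a b h a' b' (\<lambda>x. x)" unfolding same_curve_def using h by auto
  then obtain h' where "h' ` {a..b} \<subseteq> {a'..b'}" "\<And>u. u \<in> {a..b} \<Longrightarrow> h u = h' u"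
    by (rule same_curveD) (rule that)
  then have "\<forall>u\<in>{a..b}. h u \<in> {a'..b'}" by auto
  then show ?thesis using that[OF h] by blast
qed

context conformal_cover
begin

text \<open>The sign \<open>\<epsilon>\<close> of a curve in terms of the deck transformation that belongs to it.\<close>

definition orientation_sign :: "(complex \<Rightarrow> complex) \<Rightarrow> real" where
  "orientation_sign T = (if \<forall>x\<in>U. plane_det (DT T x) > 0 then 1 else - 1)"

text \<open>The two cases are \<open>v \<mapsto> \<alpha> v\<close> and \<open>v \<mapsto> \<alpha> (cnj v)\<close>; conjugation reverses the sign of the angle, and \<open>\<beta>\<close> is the argument
of \<open>\<alpha>\<close>.\<close>

lemma deck_turn:
  assumes T: "deck_transformation U pr T" and z: "z \<in> U"
  obtains \<beta> where "\<And>v x \<theta>0 \<theta>1. sgn v = cis \<theta>0 \<Longrightarrow> sgn x = cis \<theta>1 \<Longrightarrow>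
     (\<exists>k>0. x = k *\<^sub>R DT T z v) \<longleftrightarrow> cis (\<theta>1 - orientation_sign T * \<theta>0) = cis \<beta>"
proof -
  have nz: "v \<noteq> 0" if "sgn v = cis \<theta>" for v \<theta> using that by (metis cis_neq_zero sgn_zero)
  show ?thesis
  proof (rule deck_form[OF T z])
    fix \<alpha> assume *: "\<forall>x\<in>U. plane_det (DT T x) > 0" "\<alpha> \<noteq> 0" "\<And>v. DT T z v = \<alpha> * v"
    have al: "sgn \<alpha> = cis (Arg \<alpha>)" using * by (simp add: cis_Arg)
    have o: "orientation_sign T = 1" using *(1) by (simp add: orientation_sign_def)
    show ?thesis
    proof (rule that[of "Arg \<alpha>"])
      fix v x \<theta>0 \<theta>1 assume s: "sgn v = cis \<theta>0" "sgn x = cis \<theta>1"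
      have "(\<exists>k>0. x = k *\<^sub>R DT T z v) \<longleftrightarrow> sgn x = sgn (\<alpha> * v)"
        unfolding *(3) using positive_multiple_iff[of x "\<alpha> * v"] nz[OF s(1)] nz[OF s(2)] *(2) by simp
      also have "\<dots> \<longleftrightarrow> cis \<theta>1 = cis (Arg \<alpha> + \<theta>0)" by (simp add: s sgn_mult al cis_mult)
      also have "\<dots> \<longleftrightarrow> cis (\<theta>1 - \<theta>0) = cis (Arg \<alpha>)"
        by (metis add_diff_cancel_right' cis_divide cis_mult cis_neq_zero diff_add_cancel nonzero_eq_divide_eq)
      finally show "(\<exists>k>0. x = k *\<^sub>R DT T z v) \<longleftrightarrow> cis (\<theta>1 - orientation_sign T * \<theta>0) = cis (Arg \<alpha>)" by (simp add: o)
    qed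
  next
    fix \<alpha> assume *: "\<not> (\<forall>x\<in>U. plane_det (DT T x) > 0)" "\<alpha> \<noteq> 0" "\<And>v. DT T z v = \<alpha> * cnj v"
    have al: "sgn \<alpha> = cis (Arg \<alpha>)" using * by (simp add: cis_Arg)
    have o: "orientation_sign T = - 1" unfolding orientation_sign_def using *(1) by (rule if_not_P)
    have sc: "sgn (cnj v) = cnj (sgn v)" for v by (simp add: sgn_eq)
    show ?thesis
    proof (rule that[of "Arg \<alpha>"])
      fix v x \<theta>0 \<theta>1 assume s: "sgn v = cis \<theta>0" "sgn x = cis \<theta>1"
      have "(\<exists>k>0. x = k *\<^sub>R DT T z v) \<longleftrightarrow> sgn x = sgn (\<alpha> * cnj v)"
        unfolding *(3) using positive_multiple_iff[of x "\<alpha> * cnj v"] nz[OF s(1)] nz[OF s(2)] *(2) by simp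
      also have "\<dots> \<longleftrightarrow> cis \<theta>1 = cis (Arg \<alpha> - \<theta>0)"
        by (simp add: s sgn_mult al cis_mult sc cis_cnj)
      also have "\<dots> \<longleftrightarrow> cis (\<theta>1 + \<theta>0) = cis (Arg \<alpha>)"
        by (metis add_diff_cancel_right' cis_divide cis_mult cis_neq_zero diff_add_cancel nonzero_eq_divide_eq)
      finally show "(\<exists>k>0. x = k *\<^sub>R DT T z v) \<longleftrightarrow> cis (\<theta>1 - orientation_sign T * \<theta>0) = cis (Arg \<alpha>)" by (simp add: o)
    qed
  qed
qed

text \<open>Both cases of the comparison of winding numbers in terms of \<open>\<theta> b - \<epsilon> (\<theta> a)\<close>. If the orientation is
preserved, the factor \<open>1 - \<epsilon>\<close> is 0 and the numbers are equal. If it is reversed, that factor is 2, and a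
difference of \<open>j\<close> by an even integer is a difference of the sums of angles by a multiple of \<open>4\<pi>\<close>.\<close>

lemma index_condition:
  assumes "angle_function a1 b1 l1 \<theta>1" "a1 \<le> b1" "angle_function a2 b2 l2 \<theta>2" "a2 \<le> b2"
  shows "(if \<forall>x\<in>U. plane_det (DT T x) > 0 then i_index a1 b1 l1 = i_index a2 b2 l2
     else \<exists>k::int. j_index a1 b1 l1 = j_index a2 b2 l2 + 2 * k) \<longleftrightarrow>
    (\<exists>k::int. \<theta>1 b1 - orientation_sign T * \<theta>1 a1 = \<theta>2 b2 - orientation_sign T * \<theta>2 a2 + (1 - orientation_sign T) * (2 * pi * of_int k))"
proof -
  define P where "P \<longleftrightarrow> (\<forall>x\<in>U. plane_det (DT T x) > 0)"
  have orientation_sign: "orientation_sign T = (if P then 1 else - 1)" by (simp only: orientation_sign_def P_def)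
  show ?thesis unfolding P_def[symmetric]
  proof (cases P)
    case True
    have "i_index a1 b1 l1 = i_index a2 b2 l2 \<longleftrightarrow> \<theta>1 b1 - \<theta>1 a1 = \<theta>2 b2 - \<theta>2 a2"
      unfolding i_index_eq[OF assms(1,2)] i_index_eq[OF assms(3,4)] by simp
    then show "(if P then i_index a1 b1 l1 = i_index a2 b2 l2
       else \<exists>k::int. j_index a1 b1 l1 = j_index a2 b2 l2 + 2 * k) \<longleftrightarrow>
      (\<exists>k::int. \<theta>1 b1 - orientation_sign T * \<theta>1 a1 = \<theta>2 b2 - orientation_sign T * \<theta>2 a2 + (1 - orientation_sign T) * (2 * pi * of_int k))"
      using True by (simp add: orientation_sign)
  next
    case False
    then have o: "orientation_sign T = - 1" by (simp add: orientation_sign)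
    obtain k1 :: int where k1: "j_index a1 b1 l1 = (\<theta>1 b1 + \<theta>1 a1) / (2 * pi) + 2 * of_int k1"
      using j_index_eq[OF assms(1,2)] by blast
    obtain k2 :: int where k2: "j_index a2 b2 l2 = (\<theta>2 b2 + \<theta>2 a2) / (2 * pi) + 2 * of_int k2"
      using j_index_eq[OF assms(3,4)] by blast
    have scale: "A / (2 * pi) + 2 * of_int k1 = B / (2 * pi) + 2 * of_int k2 + 2 * of_int k \<longleftrightarrow>
        A = B + 4 * pi * of_int (k + k2 - k1)" for A B :: real and k :: int
      by (simp add: field_simps)
    have "(\<exists>k::int. j_index a1 b1 l1 = j_index a2 b2 l2 + 2 * of_int k) \<longleftrightarrow>
        (\<exists>k::int. \<theta>1 b1 + \<theta>1 a1 = \<theta>2 b2 + \<theta>2 a2 + 4 * pi * of_int k)"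
      (is "?L \<longleftrightarrow> ?R")
    proof
      assume ?R
      then obtain k :: int where "\<theta>1 b1 + \<theta>1 a1 = \<theta>2 b2 + \<theta>2 a2 + 4 * pi * of_int ((k + k1 - k2) + k2 - k1)" by auto
      then show ?L unfolding k1 k2 scale by blast
    next
      assume ?L
      then show ?R unfolding k1 k2 scale by blast
    qed
    then show "(if P then i_index a1 b1 l1 = i_index a2 b2 l2
       else \<exists>k::int. j_index a1 b1 l1 = j_index a2 b2 l2 + 2 * k) \<longleftrightarrow>
      (\<exists>k::int. \<theta>1 b1 - orientation_sign T * \<theta>1 a1 = \<theta>2 b2 - orientation_sign T * \<theta>2 a2 + (1 - orientation_sign T) * (2 * pi * of_int k))"
      using False unfolding o by (simp add: mult.assoc)
  qed
qed

lemma closed_lift: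
  assumes \<gamma>: "regular_closed_curve S a b \<gamma>" and z: "z \<in> U" "pr z = \<gamma> a"
    and l: "l = lift_curve U pr a b \<gamma> z"
  shows "regular_on a b l" "l ` {a..b} \<subseteq> U" "\<And>u. u \<in> {a..b} \<Longrightarrow> pr (l u) = \<gamma> u" "l a = z"
    "\<exists>T. deck_transformation U pr T \<and> T z = l b"
    "\<And>T. deck_transformation U pr T \<Longrightarrow> T z = l b \<Longrightarrow>
      \<exists>k>0. velocity a b l b = k *\<^sub>R DT T z (velocity a b l a)"
proof -
  have rc: "regular_curve S a b \<gamma>" "\<gamma> a = \<gamma> b" using \<gamma> by (simp_all add: regular_closed_curve_def)
  then have c: "a < b" "continuous_on {a..b} \<gamma>" "\<gamma> ` {a..b} \<subseteq> points S"
    by (simp_all add: regular_curve_def)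
  note L = lift_curve_props[OF less_imp_le[OF c(1)] c(2,3) z, folded l]
  show "l ` {a..b} \<subseteq> U" "\<And>u. u \<in> {a..b} \<Longrightarrow> pr (l u) = \<gamma> u" "l a = z" using L by auto
  have lb: "l b \<in> U" "pr (l b) = pr z" using L c(1) rc(2) z(2) by (auto simp: image_subset_iff)
  show ex: "\<exists>T. deck_transformation U pr T \<and> T z = l b"
    by (rule deck_transformation_exists[OF cover(3,1,2) z(1) lb])
  show "regular_on a b l"
    using regular_curve_iff[OF c(1) L(1,2) L(3)[symmetric]] rc(1) by (simp add: regular_on_def)
  show "\<exists>k>0. velocity a b l b = k *\<^sub>R DT T z (velocity a b l a)"
    if "deck_transformation U pr T" "T z = l b" for T
    using regular_closed_curve_iff[OF c(1) L(1,2) L(3)[symmetric] that(1)] that(2) \<gamma> L(4) by simp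
qed

lemma same_curve_lift:
  assumes sc: "same_curve a b \<sigma> a' b' \<gamma>"
    and L: "continuous_on {a..b} L" "L ` {a..b} \<subseteq> U" "\<And>u. u \<in> {a..b} \<Longrightarrow> pr (L u) = \<sigma> u"
    and l: "continuous_on {a'..b'} l" "l ` {a'..b'} \<subseteq> U" "\<And>u. u \<in> {a'..b'} \<Longrightarrow> pr (l u) = \<gamma> u"
    and start: "L a = l a'"
  shows "same_curve a b L a' b' l"
proof -
  obtain h where h: "C1_curve a b h" "\<forall>u\<in>{a..b}. velocity a b h u > 0" "h a = a'" "h b = b'"
    "\<forall>u\<in>{a..b}. \<sigma> u = \<gamma> (h u)" "\<forall>u\<in>{a..b}. h u \<in> {a'..b'}"
    by (rule same_curve_param[OF sc]) (rule that)
  have "\<And>u. u \<in> {a..b} \<Longrightarrow> h differentiable (at u within {a..b})" using h(1) by (simp add: C1_curve_def)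
  then have ch: "continuous_on {a..b} h"
    by (simp add: continuous_on_eq_continuous_within differentiable_imp_continuous_within)
  have hin: "h u \<in> {a'..b'}" if "u \<in> {a..b}" for u using h(6) that by blast
  have "L u = l (h u)" if "u \<in> {a..b}" for u
  proof (rule lift_unique[OF L(1,2) _ _ _ _ that])
    show "continuous_on {a..b} (\<lambda>u. l (h u))"
      by (rule continuous_on_compose2[OF l(1) ch]) (use hin in auto)
    show "(\<lambda>u. l (h u)) ` {a..b} \<subseteq> U" using hin l(2) by auto
    show "pr (L u) = pr (l (h u))" if "u \<in> {a..b}" for u
      using L(3)[OF that] l(3)[OF hin[OF that]] h(5) that by simp
    show "L a = l (h a)" using start h(3) by simp
  qed
  then show ?thesis unfolding same_curve_def using h by auto
qed

end

section \<open>Invariance under regular homotopy\<close>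

context conformal_cover
begin

text \<open>The lifted homotopy fixes both end points, since its ends move in fibres. A continuous logarithm of the
velocity on the whole rectangle gives angle functions that depend continuously on the homotopy parameter.\<close>

lemma regular_homotopy_invariants:
  assumes hom: "regularly_homotopic_fixing_base_point S a1 b1 \<gamma>1 a2 b2 \<gamma>2"
    and \<gamma>1: "regular_closed_curve S a1 b1 \<gamma>1" and \<gamma>2: "regular_closed_curve S a2 b2 \<gamma>2"
    and z: "z \<in> U" "pr z = \<gamma>1 a1" "pr z = \<gamma>2 a2"
    and l1: "l1 = lift_curve U pr a1 b1 \<gamma>1 z" and l2: "l2 = lift_curve U pr a2 b2 \<gamma>2 z"
    and T: "deck_transformation U pr T" "T z = l1 b1"
  shows "l1 b1 = l2 b2"
    "if \<forall>x\<in>U. plane_det (DT T x) > 0 then i_index a1 b1 l1 = i_index a2 b2 l2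
     else \<exists>k::int. j_index a1 b1 l1 = j_index a2 b2 l2 + 2 * k"
proof -
  obtain a b \<sigma> where hom':
    "continuous_on ({0..1} \<times> {a..b}) (\<lambda>(t, u). \<sigma> t u)"
    "\<forall>t\<in>{0..1::real}. regular_closed_curve S a b (\<sigma> t)"
    "\<forall>c\<in>atlas S. continuous_on {(t, u). t \<in> {0..1} \<and> u \<in> {a..b} \<and> \<sigma> t u \<in> fst c}
             (\<lambda>(t, u). chart_velocity c a b (\<sigma> t) u)"
    "\<forall>t\<in>{0..1}. \<sigma> t a = \<sigma> 0 a"
    "same_curve a b (\<sigma> 0) a1 b1 \<gamma>1" "same_curve a b (\<sigma> 1) a2 b2 \<gamma>2"
    using hom unfolding regularly_homotopic_fixing_base_point_def by (elim exE conjE) (rule that)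
  note c\<sigma> = hom'(1) and closed = bspec[OF hom'(2)] and cvel = bspec[OF hom'(3)]
    and base = bspec[OF hom'(4)] and sc = hom'(5,6)
  have rc: "regular_curve S a b (\<sigma> t)" "\<sigma> t a = \<sigma> t b" if "t \<in> {0..1}" for t
    using closed[OF that] by (simp_all add: regular_closed_curve_def)
  have ab: "a < b" using rc(1)[of 0] by (simp add: regular_curve_def)
  note C1 = closed_lift[OF \<gamma>1 z(1,2) l1] and C2 = closed_lift[OF \<gamma>2 z(1,3) l2]
  define X where "X = {0..1::real} \<times> {a..b}"
  have \<sigma>a: "\<sigma> 0 a = pr z"
  proof -
    obtain h where "h a = a1" "\<forall>u\<in>{a..b}. \<sigma> 0 u = \<gamma>1 (h u)"
      using sc(1) unfolding same_curve_def by blast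
    then show ?thesis using ab z(2) by simp
  qed
  have \<sigma>S: "\<sigma> t u \<in> points S" if "t \<in> {0..1}" "u \<in> {a..b}" for t u
    using rc(1)[OF that(1)] that(2) by (auto simp: regular_curve_def)
  have "(\<lambda>(t, u). \<sigma> t u) ` ({0..1} \<times> {a..b}) \<subseteq> points S" using \<sigma>S by auto
  moreover have "(0, a) \<in> {0..1::real} \<times> {a..b}" using ab by simp
  moreover have "pr z = (case (0, a) of (t, u) \<Rightarrow> \<sigma> t u)" using \<sigma>a by simp
  ultimately obtain L where L: "continuous_on ({0..1} \<times> {a..b}) L" "L ` ({0..1} \<times> {a..b}) \<subseteq> U"
    "\<And>x. x \<in> {0..1} \<times> {a..b} \<Longrightarrow> pr (L x) = (case x of (t, u) \<Rightarrow> \<sigma> t u)" "L (0, a) = z"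
    using covering_lift_box[OF cover(3) c\<sigma>, of "(0, a)" z] z(1) by metis
  have LU: "L (t, u) \<in> U" and pL: "pr (L (t, u)) = \<sigma> t u" if "t \<in> {0..1}" "u \<in> {a..b}" for t u
    using L(2) L(3)[of "(t, u)"] that by auto
  have cLt: "continuous_on {a..b} (\<lambda>u. L (t, u))" if "t \<in> {0..1}" for t
    by (rule continuous_on_compose2[OF L(1)]) (use that in \<open>auto intro!: continuous_intros\<close>)
  have cLu: "continuous_on {0..1} (\<lambda>t. L (t, u))" if "u \<in> {a..b}" for u
    by (rule continuous_on_compose2[OF L(1)]) (use that in \<open>auto intro!: continuous_intros\<close>)
  have imLt: "(\<lambda>u. L (t, u)) ` {a..b} \<subseteq> U" if "t \<in> {0..1}" for t using LU[OF that] by auto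
  have aa: "a \<in> {a..b}" "b \<in> {a..b}" using ab by auto
  have La: "L (t, a) = z" if t: "t \<in> {0..1}" for t
  proof -
    have "L (t, a) = L (0, a)"
      by (rule lift_constant[of 0 1 "\<lambda>t. L (t, a)" "pr z"]) (use cLu LU pL base \<sigma>a aa t in auto)
    then show ?thesis using L(4) by simp
  qed
  have Lb: "L (t, b) = L (0, b)" if t: "t \<in> {0..1}" for t
    by (rule lift_constant[of 0 1 "\<lambda>t. L (t, b)" "pr z"]) (use cLu LU pL base \<sigma>a aa t rc(2) in auto)
  note R1 = regular_onD[OF C1(1)] and R2 = regular_onD[OF C2(1)]
  have sc1: "same_curve a b (\<lambda>u. L (0, u)) a1 b1 l1"
    by (rule same_curve_lift[OF sc(1) cLt imLt _ R1(5) C1(2,3)]) (use pL La C1(4) in auto)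
  have sc2: "same_curve a b (\<lambda>u. L (1, u)) a2 b2 l2"
    by (rule same_curve_lift[OF sc(2) cLt imLt _ R2(5) C2(2,3)]) (use pL La C2(4) in auto)
  have e1: "L (0, b) = l1 b1" using sc1 ab unfolding same_curve_def by auto
  have e2: "L (1, b) = l2 b2" using sc2 ab unfolding same_curve_def by auto
  show "l1 b1 = l2 b2" using e1 e2 Lb[of 1] by simp
  have closing: "C1_curve a b (\<lambda>u. L (t, u)) \<and> (\<forall>u\<in>{a..b}. velocity a b (\<lambda>u. L (t, u)) u \<noteq> 0) \<and>
     (\<exists>k>0. velocity a b (\<lambda>u. L (t, u)) b = k *\<^sub>R DT T z (velocity a b (\<lambda>u. L (t, u)) a))"
    if t: "t \<in> {0..1}" for t
  proof -
    have "T (L (t, a)) = L (t, b)" using La[OF t] Lb[OF t] e1 T(2) by simp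
    from regular_closed_curve_iff[OF ab cLt[OF t] imLt[OF t] pL[OF t, symmetric] T(1) this]
    show ?thesis using closed[OF t] La[OF t] by simp
  qed
  define H where "H = (\<lambda>x. velocity a b (\<lambda>u. L (fst x, u)) (snd x))"
  have H0: "H x \<noteq> 0" if "x \<in> X" for x
    using closing[of "fst x"] that by (auto simp: H_def X_def)
  have "\<forall>c\<in>atlas S. continuous_on {x\<in>X. pr (L x) \<in> fst c} (\<lambda>x. DF c (L x) (H x))"
  proof
    fix c assume c: "c \<in> atlas S"
    have eq: "{x\<in>X. pr (L x) \<in> fst c} = {(t, u). t \<in> {0..1} \<and> u \<in> {a..b} \<and> \<sigma> t u \<in> fst c}"
      using pL by (auto simp: X_def)
    show "continuous_on {x\<in>X. pr (L x) \<in> fst c} (\<lambda>x. DF c (L x) (H x))"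
      unfolding eq
    proof (rule continuous_on_eq[OF cvel[OF c]])
      fix x assume "x \<in> {(t, u). t \<in> {0..1} \<and> u \<in> {a..b} \<and> \<sigma> t u \<in> fst c}"
      then obtain t u where x: "x = (t, u)" "t \<in> {0..1}" "u \<in> {a..b}" "\<sigma> t u \<in> fst c" by auto
      have "chart_velocity c a b (\<sigma> t) u = DF c (L (t, u)) (velocity a b (\<lambda>u. L (t, u)) u)"
      proof (rule chart_velocity_lift(2)[OF ab _ x(3) c])
        show "\<sigma> t u = pr (L (t, u))" if "u \<in> {a..b}" for u using pL[OF x(2) that] by simp
        show "L (t, u) \<in> chart_dom c" using LU[OF x(2,3)] pL[OF x(2,3)] x(4) by simp
        show "(\<lambda>u. L (t, u)) differentiable (at u within {a..b})"
          using closing[OF x(2)] x(3) by (simp add: C1_curve_def)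
      qed
      then show "(case x of (t, u) \<Rightarrow> chart_velocity c a b (\<sigma> t) u) = DF c (L x) (H x)"
        by (simp add: x(1) H_def)
    qed
  qed
  then have cH: "continuous_on X H"
    using DF_continuous_iff[of X L H] L(1,2) unfolding X_def by blast
  have "contractible X" unfolding X_def by (intro convex_imp_contractible convex_Times) auto
  then obtain Z where Z: "continuous_on X Z" "\<And>x. x \<in> X \<Longrightarrow> H x = exp (Z x)"
    using continuous_logarithm_on_contractible[OF cH _ H0] by blast
  define \<theta> where "\<theta> = (\<lambda>t u. Im (Z (t, u)))"
  have ang: "angle_function a b (\<lambda>u. L (t, u)) (\<theta> t)" if t: "t \<in> {0..1}" for t
    unfolding \<theta>_def
  proof (rule angle_function_of_log)
    show "continuous_on {a..b} (\<lambda>u. Z (t, u))"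
      by (rule continuous_on_compose2[OF Z(1)]) (use t in \<open>auto simp: X_def intro!: continuous_intros\<close>)
    show "velocity a b (\<lambda>u. L (t, u)) u = exp (Z (t, u))" if "u \<in> {a..b}" for u
      using Z(2)[of "(t, u)"] t that by (simp add: X_def H_def)
  qed
  obtain \<beta> where \<beta>: "\<And>v x \<theta>0 \<theta>1. sgn v = cis \<theta>0 \<Longrightarrow> sgn x = cis \<theta>1 \<Longrightarrow>
     (\<exists>k>0. x = k *\<^sub>R DT T z v) \<longleftrightarrow> cis (\<theta>1 - orientation_sign T * \<theta>0) = cis \<beta>"
    by (rule deck_turn[OF T(1) z(1)]) (rule that)
  define f where "f = (\<lambda>t. \<theta> t b - orientation_sign T * \<theta> t a)"
  have cis_f: "cis (f t) = cis \<beta>" if t: "t \<in> {0..1}" for t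
  proof -
    have "sgn (velocity a b (\<lambda>u. L (t, u)) a) = cis (\<theta> t a)" "sgn (velocity a b (\<lambda>u. L (t, u)) b) = cis (\<theta> t b)"
      using ang[OF t] aa by (simp_all add: angle_function_sgn)
    from \<beta>[OF this] show ?thesis using closing[OF t] unfolding f_def by blast
  qed
  have cf: "continuous_on {0..1} f" unfolding f_def \<theta>_def
    by (intro continuous_intros continuous_on_compose2[OF Z(1)]) (use aa in \<open>auto simp: X_def\<close>)
  obtain k :: int where "\<And>t. t \<in> {0..1} \<Longrightarrow> f t = \<beta> + 2 * pi * k"
    by (rule cis_lifts_differ[OF connected_Icc cf continuous_on_const cis_f]) (assumption, rule that)
  then have f01: "f 0 = f 1" by simp
  have reg1: "regular_on a b (\<lambda>u. L (0, u))" "regular_on a b (\<lambda>u. L (1, u))"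
    using closing by (simp_all add: regular_on_def)
  have i: "i_index a b (\<lambda>u. L (0, u)) = i_index a1 b1 l1" "i_index a b (\<lambda>u. L (1, u)) = i_index a2 b2 l2"
    using indices_reparam(1)[OF sc1 C1(1)] indices_reparam(1)[OF sc2 C2(1)] by simp_all
  obtain k1 :: int where k1: "j_index a b (\<lambda>u. L (0, u)) = j_index a1 b1 l1 + 2 * of_int k1"
    using indices_reparam(2)[OF sc1 C1(1)] by blast
  obtain k2 :: int where k2: "j_index a b (\<lambda>u. L (1, u)) = j_index a2 b2 l2 + 2 * of_int k2"
    using indices_reparam(2)[OF sc2 C2(1)] by blast
  define P where "P \<longleftrightarrow> (\<forall>x\<in>U. plane_det (DT T x) > 0)"
  have "if P then i_index a b (\<lambda>u. L (0, u)) = i_index a b (\<lambda>u. L (1, u))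
     else \<exists>k::int. j_index a b (\<lambda>u. L (0, u)) = j_index a b (\<lambda>u. L (1, u)) + 2 * of_int k"
    unfolding P_def index_condition[OF ang less_imp_le[OF ab] ang less_imp_le[OF ab], of 0 1 T, simplified]
    using f01 by (intro exI[of _ 0]) (simp add: f_def)
  then have "if P then i_index a1 b1 l1 = i_index a2 b2 l2
     else \<exists>k::int. j_index a1 b1 l1 = j_index a2 b2 l2 + 2 * of_int k"
    unfolding i k1 k2
  proof (cases P)
    case False
    assume "if P then i_index a1 b1 l1 = i_index a2 b2 l2
     else \<exists>k::int. j_index a1 b1 l1 + 2 * of_int k1 = j_index a2 b2 l2 + 2 * of_int k2 + 2 * of_int k"
    with False obtain k :: int where "j_index a1 b1 l1 + 2 * of_int k1 = j_index a2 b2 l2 + 2 * of_int k2 + 2 * of_int k"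
      by auto
    then have "j_index a1 b1 l1 = j_index a2 b2 l2 + 2 * of_int (k + k2 - k1)" by simp
    then show ?thesis using False by (simp only: if_False) blast
  qed simp
  then show "if \<forall>x\<in>U. plane_det (DT T x) > 0 then i_index a1 b1 l1 = i_index a2 b2 l2
     else \<exists>k::int. j_index a1 b1 l1 = j_index a2 b2 l2 + 2 * k"
    unfolding P_def .
qed

end

section \<open>Construction of a regular homotopy\<close>

text \<open>The substitution \<open>x \<mapsto> u * x\<close> makes the domain of integration independent of \<open>u\<close>.\<close>

lemma continuous_on_primitive:
  fixes g :: "real \<times> real \<Rightarrow> complex"
  assumes g: "continuous_on ({0..1} \<times> {0..1}) g"
  shows "continuous_on ({0..1} \<times> {0..1}) (\<lambda>(t, u). integral {0..u} (\<lambda>x. g (t, x)))"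
proof (rule continuous_on_eq)
  have "continuous_on ({0..1} \<times> {0..1}) (\<lambda>p::real \<times> real. integral (cbox 0 1) (\<lambda>x. g (fst p, snd p * x)))"
  proof (rule integral_continuous_on_param)
    show "continuous_on (({0..1} \<times> {0..1}) \<times> cbox 0 1) (\<lambda>(p, x). g (fst p, snd p * x))"
      unfolding case_prod_unfold
      by (rule continuous_on_compose2[OF g]) (auto intro!: continuous_intros mult_le_one)
  qed
  then show "continuous_on ({0..1} \<times> {0..1}) (\<lambda>p. of_real (snd p) * integral (cbox 0 1) (\<lambda>x. g (fst p, snd p * x)))"
    by (intro continuous_intros)
  fix p :: "real \<times> real" assume "p \<in> {0..1} \<times> {0..1}"
  then obtain t u where p: "p = (t, u)" "t \<in> {0..1}" "u \<in> {0..1}" by auto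
  show "of_real (snd p) * integral (cbox 0 1) (\<lambda>x. g (fst p, snd p * x)) =
      (case p of (t, u) \<Rightarrow> integral {0..u} (\<lambda>x. g (t, x)))"
  proof (cases "u = 0")
    case False
    then have u: "u > 0" using p by simp
    have "continuous_on {0..u} (\<lambda>x. g (t, x))"
      by (rule continuous_on_compose2[OF g]) (use p in \<open>auto intro!: continuous_intros\<close>)
    then have "((\<lambda>x. g (t, x)) has_integral integral {0..u} (\<lambda>x. g (t, x))) (cbox 0 u)"
      by (auto intro: integrable_integral integrable_continuous_real)
    from has_integral_affinity[OF this, of u 0] u
    have "((\<lambda>x. g (t, u * x)) has_integral (1 / u) *\<^sub>R integral {0..u} (\<lambda>x. g (t, x))) {0..1}"
      by (simp add: image_affinity_atLeastAtMost image_divide_atLeastAtMost)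
    then have "integral {0..1} (\<lambda>x. g (t, u * x)) = (1 / u) *\<^sub>R integral {0..u} (\<lambda>x. g (t, x))"
      by (rule integral_unique)
    then show ?thesis using u by (simp add: p scaleR_conv_of_real)
  qed (simp add: p)
qed

context conformal_cover
begin

text \<open>A homotopy of regular curves in \<open>U\<close> from \<open>z\<close> to \<open>T z\<close> which satisfies the closing condition at all times
projects to a regular homotopy of closed curves.\<close>

lemma projected_homotopy:
  fixes H V :: "real \<times> real \<Rightarrow> complex"
  assumes H: "continuous_on ({0..1} \<times> {0..1}) H" "\<And>t u. t \<in> {0..1} \<Longrightarrow> u \<in> {0..1} \<Longrightarrow> H (t, u) \<in> U"
    and V: "continuous_on ({0..1} \<times> {0..1}) V"
      "\<And>t u. t \<in> {0..1} \<Longrightarrow> u \<in> {0..1} \<Longrightarrow> ((\<lambda>u. H (t, u)) has_vector_derivative V (t, u)) (at u within {0..1})"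
      "\<And>t u. t \<in> {0..1} \<Longrightarrow> u \<in> {0..1} \<Longrightarrow> V (t, u) \<noteq> 0"
    and T: "deck_transformation U pr T" "\<And>t. t \<in> {0..1} \<Longrightarrow> H (t, 0) = z" "\<And>t. t \<in> {0..1} \<Longrightarrow> H (t, 1) = T z"
    and closing: "\<And>t. t \<in> {0..1} \<Longrightarrow> \<exists>k>0. V (t, 1) = k *\<^sub>R DT T z (V (t, 0))"
    and sc: "same_curve 0 1 (\<lambda>u. pr (H (0, u))) a1 b1 \<gamma>1" "same_curve 0 1 (\<lambda>u. pr (H (1, u))) a2 b2 \<gamma>2"
  shows "regularly_homotopic_fixing_base_point S a1 b1 \<gamma>1 a2 b2 \<gamma>2"
  unfolding regularly_homotopic_fixing_base_point_def
proof (intro exI conjI ballI)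
  define X where "X = {0..1::real} \<times> {0..1::real}"
  have HX: "H ` X \<subseteq> U" using H(2) by (auto simp: X_def)
  have vel: "velocity 0 1 (\<lambda>u. H (t, u)) u = V (t, u)" if "t \<in> {0..1}" "u \<in> {0..1}" for t u
    by (rule velocity_eqI[OF zero_less_one that(2) V(2)[OF that]])
  have reg: "regular_on 0 1 (\<lambda>u. H (t, u))" if t: "t \<in> {0..1}" for t
  proof (rule regular_onI[OF zero_less_one V(2)[OF t]])
    show "continuous_on {0..1} (\<lambda>u. V (t, u))"
      by (rule continuous_on_compose2[OF V(1)]) (use t in \<open>auto intro!: continuous_intros\<close>)
  qed (use V(3)[OF t] in auto)
  have imt: "(\<lambda>u. H (t, u)) ` {0..1} \<subseteq> U" if t: "t \<in> {0..1}" for t using H(2)[OF t] by auto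
  show "continuous_on ({0..1} \<times> {0..1}) (\<lambda>(t, u). pr (H (t, u)))"
    using continuous_on_compose2[OF contpr H(1)] HX unfolding X_def by (simp add: case_prod_unfold)
  show "regular_closed_curve S 0 1 (\<lambda>u. pr (H (t, u)))" if t: "t \<in> {0..1}" for t
  proof -
    have "T (H (t, 0)) = H (t, 1)" using T t by simp
    note * = regular_closed_curve_iff[OF zero_less_one regular_onD(5)[OF reg[OF t]] imt[OF t] refl T(1) this]
    show ?thesis unfolding * using reg[OF t] closing[OF t] vel[OF t] T(2)[OF t]
      by (auto simp: regular_on_def)
  qed
  show "continuous_on {(t, u). t \<in> {0..1} \<and> u \<in> {0..1} \<and> pr (H (t, u)) \<in> fst c}
       (\<lambda>(t, u). chart_velocity c 0 1 (\<lambda>u. pr (H (t, u))) u)" if c: "c \<in> atlas S" for c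
  proof (rule continuous_on_eq)
    have eq: "{(t, u). t \<in> {0..1} \<and> u \<in> {0..1} \<and> pr (H (t, u)) \<in> fst c} = {x\<in>X. pr (H x) \<in> fst c}"
      by (auto simp: X_def)
    show "continuous_on {(t, u). t \<in> {0..1} \<and> u \<in> {0..1} \<and> pr (H (t, u)) \<in> fst c} (\<lambda>x. DF c (H x) (V x))"
      unfolding eq using DF_continuous_iff[of X H V] H(1) HX V(1) c unfolding X_def by blast
    fix x assume "x \<in> {(t, u). t \<in> {0..1} \<and> u \<in> {0..1} \<and> pr (H (t, u)) \<in> fst c}"
    then obtain t u where x: "x = (t, u)" "t \<in> {0..1}" "u \<in> {0..1}" "pr (H (t, u)) \<in> fst c" by auto
    have "chart_velocity c 0 1 (\<lambda>u. pr (H (t, u))) u = DF c (H (t, u)) (velocity 0 1 (\<lambda>u. H (t, u)) u)"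
    proof (rule chart_velocity_lift(2)[OF zero_less_one _ x(3) c])
      show "H (t, u) \<in> chart_dom c" using H(2)[OF x(2,3)] x(4) by simp
      show "(\<lambda>u. H (t, u)) differentiable (at u within {0..1})"
        using V(2)[OF x(2,3)] by (rule differentiableI_vector)
    qed simp
    then show "DF c (H x) (V x) = (case x of (t, u) \<Rightarrow> chart_velocity c 0 1 (\<lambda>u. pr (H (t, u))) u)"
      using vel[OF x(2,3)] by (simp add: x(1))
  qed
  show "pr (H (t, 0)) = pr (H (0, 0))" if "t \<in> {0..1}" for t using T(2) that by simp
  show "same_curve 0 1 (\<lambda>u. pr (H (0, u))) a1 b1 \<gamma>1" "same_curve 0 1 (\<lambda>u. pr (H (1, u))) a2 b2 \<gamma>2"
    by (rule sc)+
qed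

text \<open>The homotopy of logarithms of velocities is integrated to a homotopy of plane curves from \<open>z\<close> to \<open>T z\<close>, and
then mapped into \<open>U\<close> by a regular map \<open>f\<close> that is the identity on a compact set \<open>K\<close>. This \<open>K\<close> contains the two
lifts and discs around the end points; the discs make the derivative of \<open>f\<close> the identity at the ends, so
that the closing condition survives.\<close>

lemma regular_homotopy_exists:
  assumes tame: "tame_conformally_euclidean_structure S U pr"
    and \<gamma>1: "regular_closed_curve S a1 b1 \<gamma>1" and \<gamma>2: "regular_closed_curve S a2 b2 \<gamma>2"
    and z: "z \<in> U" "pr z = \<gamma>1 a1" "pr z = \<gamma>2 a2"
    and l1: "l1 = lift_curve U pr a1 b1 \<gamma>1 z" and l2: "l2 = lift_curve U pr a2 b2 \<gamma>2 z"
    and T: "deck_transformation U pr T" "T z = l1 b1" and q: "l1 b1 = l2 b2"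
    and ind: "if \<forall>x\<in>U. plane_det (DT T x) > 0 then i_index a1 b1 l1 = i_index a2 b2 l2
     else \<exists>k::int. j_index a1 b1 l1 = j_index a2 b2 l2 + 2 * k"
  shows "regularly_homotopic_fixing_base_point S a1 b1 \<gamma>1 a2 b2 \<gamma>2"
proof -
  note C1 = closed_lift[OF \<gamma>1 z(1,2) l1] and C2 = closed_lift[OF \<gamma>2 z(1,3) l2]
  define q where "q = T z"
  have qU: "q \<in> U" using deckD(3)[OF T(1) z(1)] by (simp add: q_def)
  define \<epsilon> where "\<epsilon> = orientation_sign T"
  obtain \<beta> where \<beta>0: "\<And>v x \<theta>0 \<theta>1. sgn v = cis \<theta>0 \<Longrightarrow> sgn x = cis \<theta>1 \<Longrightarrow>
     (\<exists>k>0. x = k *\<^sub>R DT T z v) \<longleftrightarrow> cis (\<theta>1 - orientation_sign T * \<theta>0) = cis \<beta>"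
    by (rule deck_turn[OF T(1) z(1)]) (rule that)
  note \<beta> = \<beta>0[folded \<epsilon>_def]
  define m1 where "m1 = unit_interval_param a1 b1 l1"
  define m2 where "m2 = unit_interval_param a2 b2 l2"
  have sc1: "same_curve 0 1 m1 a1 b1 l1" and r1: "regular_on 0 1 m1"
    unfolding m1_def by (rule regular_on_affine[OF C1(1)])+
  have sc2: "same_curve 0 1 m2 a2 b2 l2" and r2: "regular_on 0 1 m2"
    unfolding m2_def by (rule regular_on_affine[OF C2(1)])+
  have e1: "m1 0 = z" "m1 1 = q" "m1 ` {0..1} \<subseteq> U"
    using unit_param_continuous(2)[OF regular_onD(1,5)[OF C1(1)]] C1(2,4) T(2)
    by (auto simp: m1_def unit_interval_param_def q_def)
  have e2: "m2 0 = z" "m2 1 = q" "m2 ` {0..1} \<subseteq> U"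
    using unit_param_continuous(2)[OF regular_onD(1,5)[OF C2(1)]] C2(2,4) T(2) q
    by (auto simp: m2_def unit_interval_param_def q_def)
  obtain Z1 where Z1: "continuous_on {0..1} Z1" "\<And>u. u \<in> {0..1} \<Longrightarrow> velocity 0 1 m1 u = exp (Z1 u)"
    by (rule log_velocity_exists[OF r1]) (rule that)
  obtain Y2 where Y2: "continuous_on {0..1} Y2" "\<And>u. u \<in> {0..1} \<Longrightarrow> velocity 0 1 m2 u = exp (Y2 u)"
    by (rule log_velocity_exists[OF r2]) (rule that)
  define c where "c = Im (Z1 1) - \<epsilon> * Im (Z1 0)"
  have ang1: "angle_function 0 1 m1 (\<lambda>u. Im (Z1 u))" by (rule angle_function_of_log[OF Z1])
  have ang2: "angle_function 0 1 m2 (\<lambda>u. Im (Y2 u))" by (rule angle_function_of_log[OF Y2])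
  have indm: "if \<forall>x\<in>U. plane_det (DT T x) > 0 then i_index 0 1 m1 = i_index 0 1 m2
     else \<exists>k::int. j_index 0 1 m1 = j_index 0 1 m2 + 2 * k"
  proof -
    define P where "P \<longleftrightarrow> (\<forall>x\<in>U. plane_det (DT T x) > 0)"
    obtain k1 :: int where k1: "j_index 0 1 m1 = j_index a1 b1 l1 + 2 * of_int k1"
      using indices_reparam(2)[OF sc1 C1(1)] by blast
    obtain k2 :: int where k2: "j_index 0 1 m2 = j_index a2 b2 l2 + 2 * of_int k2"
      using indices_reparam(2)[OF sc2 C2(1)] by blast
    show ?thesis
      using ind unfolding P_def[symmetric] indices_reparam(1)[OF sc1 C1(1)] indices_reparam(1)[OF sc2 C2(1)]
    proof (cases P)
      case False
      assume "if P then i_index a1 b1 l1 = i_index a2 b2 l2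
        else \<exists>k::int. j_index a1 b1 l1 = j_index a2 b2 l2 + 2 * k"
      with False obtain k :: int where "j_index a1 b1 l1 = j_index a2 b2 l2 + 2 * of_int k" by auto
      then have "j_index 0 1 m1 = j_index 0 1 m2 + 2 * of_int (k + k1 - k2)" using k1 k2 by simp
      then show "if P then i_index a1 b1 l1 = i_index a2 b2 l2
        else \<exists>k::int. j_index 0 1 m1 = j_index 0 1 m2 + 2 * k" using False by (simp only: if_False) blast
    qed simp
  qed
  then obtain k :: int where k: "Im (Z1 1) - \<epsilon> * Im (Z1 0) = Im (Y2 1) - \<epsilon> * Im (Y2 0) + (1 - \<epsilon>) * (2 * pi * of_int k)"
    unfolding index_condition[OF ang1 zero_le_one ang2 zero_le_one] \<epsilon>_def by blast
  \<comment> \<open>Only the orientation reversing case needs this shift: it changes the sum of the angles at the ends by \<open>4 \<pi> k\<close>.\<close>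
  define Z2 where "Z2 = (\<lambda>u. Y2 u + \<i> * of_real (2 * pi * of_int k))"
  have Z2: "continuous_on {0..1} Z2" "\<And>u. u \<in> {0..1} \<Longrightarrow> velocity 0 1 m2 u = exp (Z2 u)"
  proof -
    show "continuous_on {0..1} Z2" unfolding Z2_def by (intro continuous_intros Y2)
    have "exp (\<i> * of_real (2 * pi * of_int k)) = 1"
      using exp_integer_2pi[of "of_int k"] by (simp add: mult_ac)
    then show "velocity 0 1 m2 u = exp (Z2 u)" if "u \<in> {0..1}" for u
      using Y2(2)[OF that] by (simp add: Z2_def exp_add)
  qed
  have integ: "integral {0..u} (\<lambda>x. exp (Z x)) = m u - m 0"
    if r: "regular_on 0 1 m" and Z: "\<And>u. u \<in> {0..1} \<Longrightarrow> velocity 0 1 m u = exp (Z u)" and u: "u \<in> {0..1}"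
    for m Z and u :: real
  proof (rule integral_unique)
    show "((\<lambda>x. exp (Z x)) has_integral m u - m 0) {0..u}"
    proof (rule fundamental_theorem_of_calculus)
      fix x assume x: "x \<in> {0..u}"
      then have "x \<in> {0..1}" using u by auto
      then have "(m has_vector_derivative exp (Z x)) (at x within {0..1})"
        using regular_onD(2)[OF r] Z by metis
      then show "(m has_vector_derivative exp (Z x)) (at x within {0..u})"
        by (rule has_vector_derivative_within_subset) (use u in auto)
    qed (use u in auto)
  qed
  have ok1: "log_velocity_ok \<epsilon> c (q - z) Z1"
    unfolding log_velocity_ok_def using integ[OF r1 Z1(2), of 1] e1 by (simp add: c_def)
  have ok2: "log_velocity_ok \<epsilon> c (q - z) Z2"
    unfolding log_velocity_ok_def using integ[OF r2 Z2(2), of 1] e2 k by (simp add: c_def Z2_def algebra_simps)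
  from log_velocities_homotopic[OF Z1(1) ok1 Z2(1) ok2]
  obtain h where h: "continuous_on ({0..1::real} \<times> {0..1}) h" "\<And>u. u \<in> {0..1} \<Longrightarrow> h (0, u) = Z1 u"
    "\<And>u. u \<in> {0..1} \<Longrightarrow> h (1, u) = Z2 u" "\<And>t. t \<in> {0..1} \<Longrightarrow> log_velocity_ok \<epsilon> c (q - z) (\<lambda>u. h (t, u))"
    unfolding log_velocity_homotopic_iff by blast
  define L where "L = (\<lambda>(t, u). z + integral {0..u} (\<lambda>x. exp (h (t, x))))"
  have ce: "continuous_on ({0..1} \<times> {0..1}) (\<lambda>x. exp (h x))" by (intro continuous_intros h(1))
  have cL: "continuous_on ({0..1} \<times> {0..1}) L"
    using continuous_on_primitive[OF ce] unfolding L_def case_prod_unfold by (intro continuous_intros)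
  have cet: "continuous_on {0..1} (\<lambda>u. exp (h (t, u)))" if "t \<in> {0..1}" for t
    by (rule continuous_on_compose2[OF ce]) (use that in \<open>auto intro!: continuous_intros\<close>)
  have dL: "((\<lambda>u. L (t, u)) has_vector_derivative exp (h (t, u))) (at u within {0..1})"
    if "t \<in> {0..1}" "u \<in> {0..1}" for t u
    using integral_has_vector_derivative[OF cet[OF that(1)] that(2)] unfolding L_def
    by (auto intro!: derivative_eq_intros)
  have regL: "regular_on 0 1 (\<lambda>u. L (t, u))" if "t \<in> {0..1}" for t
    by (rule regular_onI[OF zero_less_one dL[OF that] cet[OF that]]) auto
  have velL: "velocity 0 1 (\<lambda>u. L (t, u)) u = exp (h (t, u))" if "t \<in> {0..1}" "u \<in> {0..1}" for t u
    by (rule velocity_eqI[OF zero_less_one that(2) dL[OF that]])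
  have L0: "L (t, 0) = z" for t by (simp add: L_def)
  have L1: "L (t, 1) = q" if "t \<in> {0..1}" for t
    using h(4)[OF that] by (simp add: L_def log_velocity_ok_def)
  have Lm1: "L (0, u) = m1 u" if u: "u \<in> {0..1}" for u
  proof -
    have "integral {0..u} (\<lambda>x. exp (h (0, x))) = integral {0..u} (\<lambda>x. exp (Z1 x))"
      by (rule integral_cong) (use h(2) u in auto)
    then show ?thesis using integ[OF r1 Z1(2) u] e1 by (simp add: L_def)
  qed
  have Lm2: "L (1, u) = m2 u" if u: "u \<in> {0..1}" for u
  proof -
    have "integral {0..u} (\<lambda>x. exp (h (1, x))) = integral {0..u} (\<lambda>x. exp (Z2 x))"
      by (rule integral_cong) (use h(3) u in auto)
    then show ?thesis using integ[OF r2 Z2(2) u] e2 by (simp add: L_def)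
  qed
  obtain r1' where rz: "r1' > 0" "cball z r1' \<subseteq> U" using cover(1) z(1) open_contains_cball by blast
  obtain r2' where rq: "r2' > 0" "cball q r2' \<subseteq> U" using cover(1) qU open_contains_cball by blast
  \<comment> \<open>Full discs, not only the points \<open>z\<close> and \<open>q\<close>: the derivative of \<open>f\<close> has to be known there as well.\<close>
  define K where "K = m1 ` {0..1} \<union> m2 ` {0..1} \<union> cball z r1' \<union> cball q r2'"
  have "compact K" unfolding K_def
    by (intro compact_Un compact_continuous_image regular_onD(5)[OF r1] regular_onD(5)[OF r2]) auto
  moreover have "K \<subseteq> interior U" using e1(3) e2(3) rz(2) rq(2) by (simp add: K_def interior_open[OF cover(1)])
  moreover have "\<forall>K. compact K \<and> K \<subseteq> interior U \<longrightarrow>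
        (\<exists>f. regular_map_on UNIV f \<and> range f \<subseteq> U \<and> (\<forall>z\<in>K. f z = z))"
    using tame unfolding tame_conformally_euclidean_structure_def by (elim conjE)
  ultimately obtain f where f: "regular_map_on UNIV f" "range f \<subseteq> U" "\<And>w. w \<in> K \<Longrightarrow> f w = w"
    by meson
  define Df where "Df = (\<lambda>w. frechet_derivative f (at w))"
  have "smooth_on UNIV f" and bij: "bij (Df w)" for w
    using f(1) by (simp_all add: regular_map_on_def Df_def)
  then have ck: "Ck_on (Suc 0) UNIV f" unfolding smooth_on_def by blast
  have dfw: "f differentiable (at w)" for w using ck by simp
  have Df: "(f has_derivative Df w) (at w)" for w
    using dfw[of w] unfolding Df_def by (simp add: frechet_derivative_works)
  have cDf: "continuous_on UNIV (\<lambda>w. Df w v)" for v using ck unfolding Df_def by simp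
  have injDf: "inj (Df w)" for w using bij by (rule bij_is_inj)
  have linDf: "linear (Df w)" for w using Df has_derivative_linear by blast
  have id: "Df w = (\<lambda>v. v)" if "ball w r \<subseteq> K" "r > 0" for w r
  proof -
    have "(f has_derivative (\<lambda>v. v)) (at w)"
      by (rule has_derivative_transform_within_open[OF has_derivative_ident open_ball, of w w r])
        (use that f(3) in auto)
    then show ?thesis unfolding Df_def by (rule frechet_derivative_at[symmetric])
  qed
  have Dz: "Df z = (\<lambda>v. v)" by (rule id[of _ r1']) (use rz ball_subset_cball in \<open>auto simp: K_def\<close>)
  have Dq: "Df q = (\<lambda>v. v)" by (rule id[of _ r2']) (use rq ball_subset_cball in \<open>auto simp: K_def\<close>)
  have zK: "z \<in> K" "q \<in> K" using rz rq by (auto simp: K_def)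
  define H where "H = (\<lambda>x. f (L x))"
  define V where "V = (\<lambda>x. Df (L x) (exp (h x)))"
  show ?thesis
  proof (rule projected_homotopy[of H V T z])
    have cf: "continuous_on UNIV f"
      using dfw by (meson continuous_at_imp_continuous_on differentiable_imp_continuous_within)
    show "continuous_on ({0..1} \<times> {0..1}) H" unfolding H_def
      by (rule continuous_on_compose2[OF cf cL]) simp
    show "H (t, u) \<in> U" for t u using f(2) by (auto simp: H_def)
    show "continuous_on ({0..1} \<times> {0..1}) V" unfolding V_def
      by (rule continuous_on_linear_family[OF linDf cDf cL _ ce]) simp
    show "((\<lambda>u. H (t, u)) has_vector_derivative V (t, u)) (at u within {0..1})" "V (t, u) \<noteq> 0"
      if "t \<in> {0..1}" "u \<in> {0..1}" for t u
    proof -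
      note rc = regular_on_compose[OF Df cDf injDf regL[OF that(1)], simplified]
      have "velocity 0 1 (f \<circ> (\<lambda>u. L (t, u))) u = V (t, u)"
        using rc(2)[of u] that velL[OF that] by (simp add: V_def)
      then show "((\<lambda>u. H (t, u)) has_vector_derivative V (t, u)) (at u within {0..1})" "V (t, u) \<noteq> 0"
        using regular_onD(2,4)[OF rc(1) that(2)] by (simp_all add: H_def o_def)
    qed
    show "deck_transformation U pr T" by (rule T(1))
    show "H (t, 0) = z" for t using f(3) zK by (simp add: H_def L0)
    show "H (t, 1) = T z" if "t \<in> {0..1}" for t using f(3) zK L1[OF that] by (simp add: H_def q_def)
    show "\<exists>k>0. V (t, 1) = k *\<^sub>R DT T z (V (t, 0))" if t: "t \<in> {0..1}" for t
    proof -
      have V: "V (t, 0) = exp (h (t, 0))" "V (t, 1) = exp (h (t, 1))"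
        using Dz Dq L1[OF t] by (simp_all add: V_def L0)
      have turn: "Im (h (t, 1)) - \<epsilon> * Im (h (t, 0)) = c"
        using h(4)[OF t] by (simp add: log_velocity_ok_def)
      have "cis c = cis \<beta>"
      proof -
        obtain g where g: "g 0 = a1" "g 1 = b1"
          "\<And>u. u \<in> {0..1} \<Longrightarrow> sgn (velocity 0 1 m1 u) = sgn (velocity a1 b1 l1 (g u))"
          by (rule same_curve_velocity[OF sc1 C1(1)]) (rule that)
        have s: "sgn (velocity a1 b1 l1 a1) = cis (Im (Z1 0))" "sgn (velocity a1 b1 l1 b1) = cis (Im (Z1 1))"
          using g(3)[of 0] g(3)[of 1] g(1,2) Z1(2)[of 0] Z1(2)[of 1] by (simp_all add: sgn_exp_complex)
        show ?thesis using \<beta>[OF s] C1(6)[OF T] unfolding c_def by blast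
      qed
      then show ?thesis unfolding V using \<beta>[OF sgn_exp_complex sgn_exp_complex] turn by simp
    qed
    show "same_curve 0 1 (\<lambda>u. pr (H (0, u))) a1 b1 \<gamma>1"
    proof -
      obtain g where g: "C1_curve 0 1 g" "\<forall>u\<in>{0..1}. velocity 0 1 g u > 0" "g 0 = a1" "g 1 = b1"
        "\<forall>u\<in>{0..1}. m1 u = l1 (g u)" "\<forall>u\<in>{0..1}. g u \<in> {a1..b1}"
        by (rule same_curve_param[OF sc1]) (rule that)
      have "pr (H (0, u)) = \<gamma>1 (g u)" if u: "u \<in> {0..1}" for u
      proof -
        have "m1 u \<in> K" using u by (auto simp: K_def)
        then show ?thesis using f(3) Lm1[OF u] g(5,6) u C1(3) by (simp add: H_def)
      qed
      then show ?thesis unfolding same_curve_def using g by blast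
    qed
    show "same_curve 0 1 (\<lambda>u. pr (H (1, u))) a2 b2 \<gamma>2"
    proof -
      obtain g where g: "C1_curve 0 1 g" "\<forall>u\<in>{0..1}. velocity 0 1 g u > 0" "g 0 = a2" "g 1 = b2"
        "\<forall>u\<in>{0..1}. m2 u = l2 (g u)" "\<forall>u\<in>{0..1}. g u \<in> {a2..b2}"
        by (rule same_curve_param[OF sc2]) (rule that)
      have "pr (H (1, u)) = \<gamma>2 (g u)" if u: "u \<in> {0..1}" for u
      proof -
        have "m2 u \<in> K" using u by (auto simp: K_def)
        then show ?thesis using f(3) Lm2[OF u] g(5,6) u C2(3) by (simp add: H_def)
      qed
      then show ?thesis unfolding same_curve_def using g by blast
    qed
  qed
qed

end

section \<open>The classification\<close>

theorem theorem1p1: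
  fixes S :: "'m::topological_space surface"
    and U :: "complex set" and pr :: "complex \<Rightarrow> 'm"
    and \<gamma>\<^sub>1 \<gamma>\<^sub>2 :: "real \<Rightarrow> 'm" and a\<^sub>1 b\<^sub>1 a\<^sub>2 b\<^sub>2 :: real
    and p :: 'm and p' :: complex
  assumes "riemannian_surface S"
    and "tame_conformally_euclidean_structure S U pr"
    and "regular_closed_curve S a\<^sub>1 b\<^sub>1 \<gamma>\<^sub>1"
    and "regular_closed_curve S a\<^sub>2 b\<^sub>2 \<gamma>\<^sub>2"
    and "\<gamma>\<^sub>1 a\<^sub>1 = p" and "\<gamma>\<^sub>2 a\<^sub>2 = p"
    and "p' \<in> U" and "pr p' = p"
  shows "regularly_homotopic_fixing_base_point S a\<^sub>1 b\<^sub>1 \<gamma>\<^sub>1 a\<^sub>2 b\<^sub>2 \<gamma>\<^sub>2 \<longleftrightarrow>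
         same_pi1_class S a\<^sub>1 b\<^sub>1 \<gamma>\<^sub>1 a\<^sub>2 b\<^sub>2 \<gamma>\<^sub>2 \<and>
         based_winding_number S U pr p' a\<^sub>1 b\<^sub>1 \<gamma>\<^sub>1 = based_winding_number S U pr p' a\<^sub>2 b\<^sub>2 \<gamma>\<^sub>2"
proof -
  have "conformally_euclidean_structure S U pr"
    using assms(2) unfolding tame_conformally_euclidean_structure_def by (elim conjE)
  then interpret conformal_cover S U pr using assms(1) by unfold_locales
  have z: "p' \<in> U" "pr p' = \<gamma>\<^sub>1 a\<^sub>1" "pr p' = \<gamma>\<^sub>2 a\<^sub>2" using assms by auto
  define l1 where "l1 = lift_curve U pr a\<^sub>1 b\<^sub>1 \<gamma>\<^sub>1 p'"
  define l2 where "l2 = lift_curve U pr a\<^sub>2 b\<^sub>2 \<gamma>\<^sub>2 p'"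
  note C1 = closed_lift[OF assms(3) z(1,2) l1_def] and C2 = closed_lift[OF assms(4) z(1,3) l2_def]
  note R1 = regular_onD[OF C1(1)] and R2 = regular_onD[OF C2(1)]
  obtain T where T: "deck_transformation U pr T" "T p' = l1 b\<^sub>1" using C1(5) by blast
  have pi1: "same_pi1_class S a\<^sub>1 b\<^sub>1 \<gamma>\<^sub>1 a\<^sub>2 b\<^sub>2 \<gamma>\<^sub>2 \<longleftrightarrow> l1 b\<^sub>1 = l2 b\<^sub>2"
    by (rule homotopic_params_iff[OF R1(1,5) C1(2,3) R2(1,5) C2(2,3)]) (use C1(4) C2(4) in simp_all)
  have w: "based_winding_number S U pr p' a\<^sub>1 b\<^sub>1 \<gamma>\<^sub>1 = based_winding_number S U pr p' a\<^sub>2 b\<^sub>2 \<gamma>\<^sub>2 \<longleftrightarrow>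
    (if \<forall>x\<in>U. plane_det (DT T x) > 0 then i_index a\<^sub>1 b\<^sub>1 l1 = i_index a\<^sub>2 b\<^sub>2 l2
     else \<exists>k::int. j_index a\<^sub>1 b\<^sub>1 l1 = j_index a\<^sub>2 b\<^sub>2 l2 + 2 * k)" if "l1 b\<^sub>1 = l2 b\<^sub>2"
    by (rule based_winding_number_eq_iff[OF assms(2) R1(1) R2(1) l1_def R1(5) C1(2,3,4) refl
          l2_def R2(5) C2(2,3,4) that[symmetric] T z(1)])
  show ?thesis
  proof
    assume "regularly_homotopic_fixing_base_point S a\<^sub>1 b\<^sub>1 \<gamma>\<^sub>1 a\<^sub>2 b\<^sub>2 \<gamma>\<^sub>2"
    note inv = regular_homotopy_invariants[OF this assms(3,4) z l1_def l2_def T]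
    show "same_pi1_class S a\<^sub>1 b\<^sub>1 \<gamma>\<^sub>1 a\<^sub>2 b\<^sub>2 \<gamma>\<^sub>2 \<and>
         based_winding_number S U pr p' a\<^sub>1 b\<^sub>1 \<gamma>\<^sub>1 = based_winding_number S U pr p' a\<^sub>2 b\<^sub>2 \<gamma>\<^sub>2"
      unfolding pi1 w[OF inv(1)] by (rule conjI[OF inv])
  next
    assume *: "same_pi1_class S a\<^sub>1 b\<^sub>1 \<gamma>\<^sub>1 a\<^sub>2 b\<^sub>2 \<gamma>\<^sub>2 \<and>
         based_winding_number S U pr p' a\<^sub>1 b\<^sub>1 \<gamma>\<^sub>1 = based_winding_number S U pr p' a\<^sub>2 b\<^sub>2 \<gamma>\<^sub>2"
    then have q: "l1 b\<^sub>1 = l2 b\<^sub>2" unfolding pi1 by (rule conjunct1)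
    show "regularly_homotopic_fixing_base_point S a\<^sub>1 b\<^sub>1 \<gamma>\<^sub>1 a\<^sub>2 b\<^sub>2 \<gamma>\<^sub>2"
      by (rule regular_homotopy_exists[OF assms(2-4) z l1_def l2_def T q
            conjunct2[OF *, unfolded w[OF q]]])
  qed
qed

end
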